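(* Fix $\Delta<\infty$ and $\mathfrak{i}>0$. If $\mathcal{L}$ is a unimodular network concentrated on infinite trees with degrees at most $\Delta$ and isoperimetric constant at least $\mathfrak{i}$, then $$\Sigma_{p.p.}(\mathcal{L})\;\subseteq\;\left\{\lambda\in\mathbb{A}\colon\tau(\lambda)<\frac{\Delta}{\mathfrak{i}}\right\}.$$
   Context: Unimodular networks. Let $\mathcal{G}_\star$ be the set of isomorphism classes of connected, locally finite, countable rooted graphs $(G,o)$ (isomorphisms preserve the root). It is a Polish space under the distance $1/(1+R)$, where $R$ is the supremum of the $r\ge 0$ such that the balls of radius $r$ around the two roots are isomorphic as rooted graphs. Let $\mathcal{G}_{\star\star}$ be the analogous space of doubly rooted graphs $(G,x,y)$. A probability measure $\mathcal{L}$ on $\mathcal{G}_\star$ (or a random rooted graph $(G,o)\sim\mathcal{L}$) is called unimodular, or a unimodular network, if for every Borel $f\colon\mathcal{G}_{\star\star}\to[0,\infty]$, $\mathbb{E}[\sum_{x\in V(G)}f(G,o,x)]=\mathbb{E}[\sum_{x\in V(G)}f(G,x,o)]$. It is concentrated on trees with given properties if almost surely $G$ is a tree with those properties. Spectral measures. For a countable locally finite graph $G=(V,E)$, the adjacency operator $A$ acts on finitely supported functions in $\ell^2_{\mathbb{C}}(V)$, with $\langle \mathfrak{e}_x|A\mathfrak{e}_y\rangle=1$ if $\{x,y\}\in E$ and $0$ otherwise, where $(\mathfrak{e}_x)_{x\in V}$ is the canonical basis. $G$ is called self-adjoint if $A$ is essentially self-adjoint. In that case, for $o\in V$, $\mu_{(G,o)}$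 is the unique Borel probability measure on $\mathbb{R}$ such that $\langle \mathfrak{e}_o|(A-z)^{-1}\mathfrak{e}_o\rangle=\int_{\mathbb{R}}\frac{1}{\xi-z}\,\mu_{(G,o)}(d\xi)$ for all $z\in\mathbb{C}\setminus\mathbb{R}$. It is known that under any unimodular network, $G$ is almost surely self-adjoint; one sets $\mu_{\mathcal{L}}(\cdot):=\mathbb{E}[\mu_{(G,o)}(\cdot)]$ with $(G,o)\sim\mathcal{L}$. The pure-point support is $\Sigma_{p.p.}(\mathcal{L}):=\{\lambda\in\mathbb{R}\colon\mu_{\mathcal{L}}(\{\lambda\})>0\}$. The isoperimetric constant of an infinite locally finite graph $G$ is $\mathfrak{i}(G):=\inf\{|\partial S|/|S|\colon S\subseteq V(G),\,0<|S|<\infty\}$, where $\partial S$ is the set of vertices outside $S$ having at least one neighbor in $S$. $\mathbb{A}$ is the set of totally real algebraic integers, i.e. roots of monic polynomials with integer coefficients all of whose complex roots are real. For $\lambda\in\mathbb{A}$, the tree-complexity $\tau(\lambda)$ is the minimum possible number of vertices of a finite tree whose adjacency matrix has $\lambda$ as an eigenvalue (it is known that such a tree exists for every $\lambda\in\mathbb{A}$). *)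

theory Defs
  imports "HOL-Probability.Probability" "Jordan_Normal_Form.Char_Poly"
begin

section \<open>Graphs\<close>

text \<open>A simple undirected graph is given by a vertex set and a symmetric irreflexive relation;
  an undirected edge is represented by both of its orientations, and the set of neighbours of a
  vertex \<open>x\<close> is \<open>E `` {x}\<close>.\<close>

definition simple_graph :: "'a set \<Rightarrow> 'a rel \<Rightarrow> bool" where
  "simple_graph V E \<longleftrightarrow> E \<subseteq> V \<times> V \<and> sym E \<and> irrefl E"

definition graph_connected :: "'a set \<Rightarrow> 'a rel \<Rightarrow> bool" where
  "graph_connected V E \<longleftrightarrow> V \<noteq> {} \<and> (\<forall>x\<in>V. \<forall>y\<in>V. (x, y) \<in> E\<^sup>*)"

definition locally_finite_graph :: "'a set \<Rightarrow> 'a rel \<Rightarrow> bool" where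
  "locally_finite_graph V E \<longleftrightarrow> (\<forall>x\<in>V. finite (E `` {x}))"

definition is_cycle :: "'a rel \<Rightarrow> 'a list \<Rightarrow> bool" where
  "is_cycle E xs \<longleftrightarrow> length xs \<ge> 3 \<and> distinct xs \<and>
     (\<forall>i<length xs. (xs ! i, xs ! (Suc i mod length xs)) \<in> E)"

definition is_tree :: "'a set \<Rightarrow> 'a rel \<Rightarrow> bool" where
  "is_tree V E \<longleftrightarrow> simple_graph V E \<and> graph_connected V E \<and> (\<nexists>xs. is_cycle E xs)"

definition degree_of :: "'a rel \<Rightarrow> 'a \<Rightarrow> nat" where
  "degree_of E x = card (E `` {x})"

definition vertex_boundary :: "'a rel \<Rightarrow> 'a set \<Rightarrow> 'a set" where
  "vertex_boundary E S = {y. y \<notin> S \<and> (\<exists>x\<in>S. (x, y) \<in> E)}"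

definition isoperimetric_constant :: "'a set \<Rightarrow> 'a rel \<Rightarrow> real" where
  "isoperimetric_constant V E =
     Inf {real (card (vertex_boundary E S)) / real (card S) | S. S \<subseteq> V \<and> finite S \<and> S \<noteq> {}}"

text \<open>Only the part of \<open>E\<close> inside \<open>V\<close> is used, so this also expresses isomorphism of the
  subgraphs induced on \<open>V\<close> and \<open>V'\<close>.\<close>

definition graph_iso :: "('a \<Rightarrow> 'b) \<Rightarrow> 'a set \<Rightarrow> 'a rel \<Rightarrow> 'b set \<Rightarrow> 'b rel \<Rightarrow> bool" where
  "graph_iso \<phi> V E V' E' \<longleftrightarrow>
     bij_betw \<phi> V V' \<and> (\<forall>x\<in>V. \<forall>y\<in>V. (x, y) \<in> E \<longleftrightarrow> (\<phi> x, \<phi> y) \<in> E')"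

lemma graph_iso_id: "graph_iso id V E V E"
  by (simp add: graph_iso_def)

lemma graph_iso_sym:
  assumes "graph_iso \<phi> V E V' E'"
  shows "graph_iso (inv_into V \<phi>) V' E' V E"
  using assms unfolding graph_iso_def
  by (auto simp: bij_betw_inv_into bij_betw_inv_into_right bij_betwE[OF bij_betw_inv_into])

lemma graph_iso_trans:
  assumes "graph_iso \<phi> V E V' E'" and "graph_iso \<psi> V' E' V'' E''"
  shows "graph_iso (\<psi> \<circ> \<phi>) V E V'' E''"
  using assms unfolding graph_iso_def
  by (auto intro: bij_betw_trans dest: bij_betwE)


section \<open>The spaces of rooted and doubly rooted graphs\<close>

definition network_graph :: "nat set \<Rightarrow> nat rel \<Rightarrow> bool" where
  "network_graph V E \<longleftrightarrow> simple_graph V E \<and> graph_connected V E \<and> locally_finite_graph V E"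

text \<open>Every countable graph is isomorphic to one whose vertices are natural numbers.\<close>

definition rooted_iso :: "nat set \<times> nat rel \<times> nat \<Rightarrow> nat set \<times> nat rel \<times> nat \<Rightarrow> bool" where
  "rooted_iso = (\<lambda>(V, E, v) (V', E', v').
     network_graph V E \<and> v \<in> V \<and> network_graph V' E' \<and> v' \<in> V' \<and>
     (\<exists>\<phi>. graph_iso \<phi> V E V' E' \<and> \<phi> v = v'))"

definition doubly_rooted_iso ::
    "nat set \<times> nat rel \<times> nat \<times> nat \<Rightarrow> nat set \<times> nat rel \<times> nat \<times> nat \<Rightarrow> bool" where
  "doubly_rooted_iso = (\<lambda>(V, E, x, y) (V', E', x', y').
     network_graph V E \<and> x \<in> V \<and> y \<in> V \<and> network_graph V' E' \<and> x' \<in> V' \<and> y' \<in> V' \<and>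
     (\<exists>\<phi>. graph_iso \<phi> V E V' E' \<and> \<phi> x = x' \<and> \<phi> y = y'))"

lemma network_graph_singleton: "network_graph {0} {}"
  by (auto simp: network_graph_def simple_graph_def graph_connected_def locally_finite_graph_def
      sym_def irrefl_def)

lemma graph_iso_inv_root:
  assumes "graph_iso \<phi> V E V' E'" and "x \<in> V"
  shows "inv_into V \<phi> (\<phi> x) = x"
  using assms unfolding graph_iso_def by (blast intro: bij_betw_inv_into_left)

lemma rooted_iso_iff:
  "rooted_iso (V, E, v) (V', E', v') \<longleftrightarrow>
     network_graph V E \<and> v \<in> V \<and> network_graph V' E' \<and> v' \<in> V' \<and>
     (\<exists>\<phi>. graph_iso \<phi> V E V' E' \<and> \<phi> v = v')"
  by (simp only: rooted_iso_def case_prod_conv)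

lemma doubly_rooted_iso_iff:
  "doubly_rooted_iso (V, E, x, y) (V', E', x', y') \<longleftrightarrow>
     network_graph V E \<and> x \<in> V \<and> y \<in> V \<and> network_graph V' E' \<and> x' \<in> V' \<and> y' \<in> V' \<and>
     (\<exists>\<phi>. graph_iso \<phi> V E V' E' \<and> \<phi> x = x' \<and> \<phi> y = y')"
  by (simp only: doubly_rooted_iso_def case_prod_conv)

lemma rooted_iso_symp:
  assumes "rooted_iso G H"
  shows "rooted_iso H G"
proof -
  obtain V E v where G: "G = (V, E, v)" by (rule prod_cases3)
  obtain V' E' v' where H: "H = (V', E', v')" by (rule prod_cases3)
  from assms obtain \<phi> where *: "network_graph V E" "v \<in> V" "network_graph V' E'" "v' \<in> V'"
    and iso: "graph_iso \<phi> V E V' E'" and eq: "\<phi> v = v'"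
    unfolding G H rooted_iso_iff by blast
  have "inv_into V \<phi> v' = v"
    using graph_iso_inv_root[OF iso *(2)] unfolding eq .
  with graph_iso_sym[OF iso] * show ?thesis
    unfolding G H rooted_iso_iff by blast
qed

lemma rooted_iso_transp:
  assumes "rooted_iso G H" and "rooted_iso H K"
  shows "rooted_iso G K"
proof -
  obtain V E v where G: "G = (V, E, v)" by (rule prod_cases3)
  obtain V' E' v' where H: "H = (V', E', v')" by (rule prod_cases3)
  obtain W F w where K: "K = (W, F, w)" by (rule prod_cases3)
  from assms(1) obtain \<phi> where *: "network_graph V E" "v \<in> V"
    and iso1: "graph_iso \<phi> V E V' E'" and eq1: "\<phi> v = v'"
    unfolding G H rooted_iso_iff by blast
  from assms(2) obtain \<psi> where **: "network_graph W F" "w \<in> W"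
    and iso2: "graph_iso \<psi> V' E' W F" and eq2: "\<psi> v' = w"
    unfolding H K rooted_iso_iff by blast
  have "(\<psi> \<circ> \<phi>) v = w"
    by (simp only: comp_apply eq1 eq2)
  with graph_iso_trans[OF iso1 iso2] * ** show ?thesis
    unfolding G K rooted_iso_iff by blast
qed

lemma doubly_rooted_iso_symp:
  assumes "doubly_rooted_iso G H"
  shows "doubly_rooted_iso H G"
proof -
  obtain V E x y where G: "G = (V, E, x, y)" by (rule prod_cases4)
  obtain V' E' x' y' where H: "H = (V', E', x', y')" by (rule prod_cases4)
  from assms obtain \<phi> where *: "network_graph V E" "x \<in> V" "y \<in> V"
      "network_graph V' E'" "x' \<in> V'" "y' \<in> V'"
    and iso: "graph_iso \<phi> V E V' E'" and eq: "\<phi> x = x'" "\<phi> y = y'"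
    unfolding G H doubly_rooted_iso_iff by blast
  have "inv_into V \<phi> x' = x" "inv_into V \<phi> y' = y"
    using graph_iso_inv_root[OF iso *(2)] graph_iso_inv_root[OF iso *(3)] unfolding eq by blast+
  with graph_iso_sym[OF iso] * show ?thesis
    unfolding G H doubly_rooted_iso_iff by blast
qed

lemma doubly_rooted_iso_transp:
  assumes "doubly_rooted_iso G H" and "doubly_rooted_iso H K"
  shows "doubly_rooted_iso G K"
proof -
  obtain V E x y where G: "G = (V, E, x, y)" by (rule prod_cases4)
  obtain V' E' x' y' where H: "H = (V', E', x', y')" by (rule prod_cases4)
  obtain W F a b where K: "K = (W, F, a, b)" by (rule prod_cases4)
  from assms(1) obtain \<phi> where *: "network_graph V E" "x \<in> V" "y \<in> V"
    and iso1: "graph_iso \<phi> V E V' E'" and eq1: "\<phi> x = x'" "\<phi> y = y'"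
    unfolding G H doubly_rooted_iso_iff by blast
  from assms(2) obtain \<psi> where **: "network_graph W F" "a \<in> W" "b \<in> W"
    and iso2: "graph_iso \<psi> V' E' W F" and eq2: "\<psi> x' = a" "\<psi> y' = b"
    unfolding H K doubly_rooted_iso_iff by blast
  have "(\<psi> \<circ> \<phi>) x = a" "(\<psi> \<circ> \<phi>) y = b"
    by (simp_all only: comp_apply eq1 eq2)
  with graph_iso_trans[OF iso1 iso2] * ** show ?thesis
    unfolding G K doubly_rooted_iso_iff by blast
qed

quotient_type rooted_graph = "nat set \<times> nat rel \<times> nat" / partial: rooted_iso
proof (rule part_equivpI)
  have "rooted_iso ({0}, {}, 0) ({0}, {}, 0)"
    unfolding rooted_iso_iff by (auto simp: network_graph_singleton intro: exI[of _ id] graph_iso_id)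
  then show "\<exists>x. rooted_iso x x" ..
  show "symp rooted_iso"
    by (rule sympI) (rule rooted_iso_symp)
  show "transp rooted_iso"
    by (rule transpI) (rule rooted_iso_transp)
qed

quotient_type doubly_rooted_graph = "nat set \<times> nat rel \<times> nat \<times> nat" / partial: doubly_rooted_iso
proof (rule part_equivpI)
  have "doubly_rooted_iso ({0}, {}, 0, 0) ({0}, {}, 0, 0)"
    unfolding doubly_rooted_iso_iff by (auto simp: network_graph_singleton intro: exI[of _ id] graph_iso_id)
  then show "\<exists>x. doubly_rooted_iso x x" ..
  show "symp doubly_rooted_iso"
    by (rule sympI) (rule doubly_rooted_iso_symp)
  show "transp doubly_rooted_iso"
    by (rule transpI) (rule doubly_rooted_iso_transp)
qed

text \<open>Vertices, edges and root of a fixed representative of an isomorphism class.  They are only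
  used in expressions invariant under rooted isomorphism.\<close>

definition rg_verts :: "rooted_graph \<Rightarrow> nat set" where
  "rg_verts g = fst (rep_rooted_graph g)"

definition rg_edges :: "rooted_graph \<Rightarrow> nat rel" where
  "rg_edges g = fst (snd (rep_rooted_graph g))"

definition rg_root :: "rooted_graph \<Rightarrow> nat" where
  "rg_root g = snd (snd (rep_rooted_graph g))"

text \<open>The class of \<open>(G, x, y)\<close>, where \<open>G\<close> is the representative of \<open>g\<close> and
  \<open>x\<close>, \<open>y\<close> are two of its vertices.\<close>

definition with_two_roots :: "rooted_graph \<Rightarrow> nat \<Rightarrow> nat \<Rightarrow> doubly_rooted_graph" where
  "with_two_roots g x y = abs_doubly_rooted_graph (rg_verts g, rg_edges g, x, y)"

definition graph_ball :: "'a rel \<Rightarrow> 'a \<Rightarrow> real \<Rightarrow> 'a set" where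
  "graph_ball E x r = {y. \<exists>n. real n \<le> r \<and> (x, y) \<in> E ^^ n}"

text \<open>For one root this says that the balls of radius \<open>r\<close> around the roots are isomorphic as rooted
  graphs.  For two roots, the neighbourhood is the subgraph induced on the union of the two balls.
  The radius \<open>r\<close> of agreement is downward closed.  In a connected graph the two roots are at finite
  distance, so using the balls around the first root only, with the second root marked as soon as
  it is reached, would give the same topology.\<close>

definition locally_agree :: "'a rel \<Rightarrow> 'a list \<Rightarrow> 'a rel \<Rightarrow> 'a list \<Rightarrow> real \<Rightarrow> bool" where
  "locally_agree E xs E' ys r \<longleftrightarrow>
     (\<exists>\<phi>. graph_iso \<phi> (\<Union>x\<in>set xs. graph_ball E x r) E (\<Union>y\<in>set ys. graph_ball E' y r) E' \<and>
          map \<phi> xs = ys)"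

text \<open>The number \<open>1 / (1 + R)\<close>, which is \<open>0\<close> for \<open>R = \<infinity>\<close>.  The supremum is taken in
  the extended nonnegative reals, so it is \<open>0\<close> when there is no agreement even at radius \<open>0\<close>
  (two coinciding roots against two distinct ones).\<close>

definition local_distance :: "'a rel \<Rightarrow> 'a list \<Rightarrow> 'a rel \<Rightarrow> 'a list \<Rightarrow> real" where
  "local_distance E xs E' ys =
     enn2real (1 / (1 + (SUP r\<in>{r. 0 \<le> r \<and> locally_agree E xs E' ys r}. ennreal r)))"

definition rg_dist :: "rooted_graph \<Rightarrow> rooted_graph \<Rightarrow> real" where
  "rg_dist g h = local_distance (rg_edges g) [rg_root g] (rg_edges h) [rg_root h]"

definition drg_dist :: "doubly_rooted_graph \<Rightarrow> doubly_rooted_graph \<Rightarrow> real" where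
  "drg_dist g h = (case (rep_doubly_rooted_graph g, rep_doubly_rooted_graph h) of
     ((V, E, x, y), (V', E', x', y')) \<Rightarrow> local_distance E [x, y] E' [x', y'])"

instantiation rooted_graph :: topological_space
begin

definition open_rooted_graph :: "rooted_graph set \<Rightarrow> bool" where
  "open_rooted_graph U \<longleftrightarrow> (\<forall>g\<in>U. \<exists>e>0. \<forall>h. rg_dist g h < e \<longrightarrow> h \<in> U)"

instance
proof
  show "open (UNIV :: rooted_graph set)"
    unfolding open_rooted_graph_def by (auto intro: exI[of _ 1])
next
  fix S T :: "rooted_graph set"
  assume S: "open S" and T: "open T"
  show "open (S \<inter> T)"
    unfolding open_rooted_graph_def
  proof
    fix g assume "g \<in> S \<inter> T"
    then obtain d e where "d > 0" "\<forall>h. rg_dist g h < d \<longrightarrow> h \<in> S"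
      "e > 0" "\<forall>h. rg_dist g h < e \<longrightarrow> h \<in> T"
      using S T unfolding open_rooted_graph_def by blast
    then show "\<exists>e>0. \<forall>h. rg_dist g h < e \<longrightarrow> h \<in> S \<inter> T"
      by (intro exI[of _ "min d e"]) auto
  qed
next
  fix K :: "rooted_graph set set"
  assume K: "\<forall>S\<in>K. open S"
  show "open (\<Union>K)"
    unfolding open_rooted_graph_def
  proof
    fix g assume "g \<in> \<Union>K"
    then obtain S where "S \<in> K" "g \<in> S" by (rule UnionE)
    with K obtain e where "e > 0" "\<forall>h. rg_dist g h < e \<longrightarrow> h \<in> S"
      unfolding open_rooted_graph_def by blast
    with \<open>S \<in> K\<close> show "\<exists>e>0. \<forall>h. rg_dist g h < e \<longrightarrow> h \<in> \<Union>K"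
      by (intro exI[of _ e]) auto
  qed
qed

end

instantiation doubly_rooted_graph :: topological_space
begin

definition open_doubly_rooted_graph :: "doubly_rooted_graph set \<Rightarrow> bool" where
  "open_doubly_rooted_graph U \<longleftrightarrow> (\<forall>g\<in>U. \<exists>e>0. \<forall>h. drg_dist g h < e \<longrightarrow> h \<in> U)"

instance
proof
  show "open (UNIV :: doubly_rooted_graph set)"
    unfolding open_doubly_rooted_graph_def by (auto intro: exI[of _ 1])
next
  fix S T :: "doubly_rooted_graph set"
  assume S: "open S" and T: "open T"
  show "open (S \<inter> T)"
    unfolding open_doubly_rooted_graph_def
  proof
    fix g assume "g \<in> S \<inter> T"
    then obtain d e where "d > 0" "\<forall>h. drg_dist g h < d \<longrightarrow> h \<in> S"
      "e > 0" "\<forall>h. drg_dist g h < e \<longrightarrow> h \<in> T"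
      using S T unfolding open_doubly_rooted_graph_def by blast
    then show "\<exists>e>0. \<forall>h. drg_dist g h < e \<longrightarrow> h \<in> S \<inter> T"
      by (intro exI[of _ "min d e"]) auto
  qed
next
  fix K :: "doubly_rooted_graph set set"
  assume K: "\<forall>S\<in>K. open S"
  show "open (\<Union>K)"
    unfolding open_doubly_rooted_graph_def
  proof
    fix g assume "g \<in> \<Union>K"
    then obtain S where "S \<in> K" "g \<in> S" by (rule UnionE)
    with K obtain e where "e > 0" "\<forall>h. drg_dist g h < e \<longrightarrow> h \<in> S"
      unfolding open_doubly_rooted_graph_def by blast
    with \<open>S \<in> K\<close> show "\<exists>e>0. \<forall>h. drg_dist g h < e \<longrightarrow> h \<in> \<Union>K"
      by (intro exI[of _ e]) auto
  qed
qed

end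

definition unimodular :: "rooted_graph measure \<Rightarrow> bool" where
  "unimodular L \<longleftrightarrow> prob_space L \<and> sets L = sets borel \<and>
     (\<forall>f :: doubly_rooted_graph \<Rightarrow> ennreal. f \<in> borel_measurable borel \<longrightarrow>
        (\<integral>\<^sup>+ g. (\<Sum>\<^sub>\<infinity>x\<in>rg_verts g. f (with_two_roots g (rg_root g) x)) \<partial>L) =
        (\<integral>\<^sup>+ g. (\<Sum>\<^sub>\<infinity>x\<in>rg_verts g. f (with_two_roots g x (rg_root g))) \<partial>L))"


section \<open>The adjacency operator and spectral measures\<close>

text \<open>The space \<open>\<ell>\<^sup>2(V)\<close> consists of functions on the ambient type that vanish outside \<open>V\<close>;
  an (unbounded) operator is represented by its graph, a set of pairs of such functions.\<close>

type_synonym 'a operator = "(('a \<Rightarrow> complex) \<times> ('a \<Rightarrow> complex)) set"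

definition ell2 :: "'a set \<Rightarrow> ('a \<Rightarrow> complex) set" where
  "ell2 V = {f. (\<forall>x. x \<notin> V \<longrightarrow> f x = 0) \<and> (\<lambda>x. (cmod (f x))\<^sup>2) summable_on V}"

definition ell2_inner :: "'a set \<Rightarrow> ('a \<Rightarrow> complex) \<Rightarrow> ('a \<Rightarrow> complex) \<Rightarrow> complex" where
  "ell2_inner V f g = (\<Sum>\<^sub>\<infinity>x\<in>V. cnj (f x) * g x)"

definition ell2_norm :: "'a set \<Rightarrow> ('a \<Rightarrow> complex) \<Rightarrow> real" where
  "ell2_norm V f = sqrt (\<Sum>\<^sub>\<infinity>x\<in>V. (cmod (f x))\<^sup>2)"

definition basis_vec :: "'a \<Rightarrow> 'a \<Rightarrow> complex" where
  "basis_vec x = (\<lambda>y. if y = x then 1 else 0)"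

definition adjacency_operator :: "'a set \<Rightarrow> 'a rel \<Rightarrow> 'a operator" where
  "adjacency_operator V E =
     {(f, \<lambda>x. \<Sum>y\<in>E `` {x}. f y) | f. finite {x. f x \<noteq> 0} \<and> {x. f x \<noteq> 0} \<subseteq> V}"

definition operator_closure :: "'a set \<Rightarrow> 'a operator \<Rightarrow> 'a operator" where
  "operator_closure V T = {(f, g). f \<in> ell2 V \<and> g \<in> ell2 V \<and>
     (\<exists>F G. (\<forall>n::nat. (F n, G n) \<in> T) \<and>
        (\<lambda>n. ell2_norm V (\<lambda>x. F n x - f x)) \<longlonglongrightarrow> 0 \<and>
        (\<lambda>n. ell2_norm V (\<lambda>x. G n x - g x)) \<longlonglongrightarrow> 0)}"

definition operator_adjoint :: "'a set \<Rightarrow> 'a operator \<Rightarrow> 'a operator" where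
  "operator_adjoint V T = {(u, w). u \<in> ell2 V \<and> w \<in> ell2 V \<and>
     (\<forall>(f, g)\<in>T. ell2_inner V u g = ell2_inner V w f)}"

definition essentially_self_adjoint :: "'a set \<Rightarrow> 'a operator \<Rightarrow> bool" where
  "essentially_self_adjoint V T \<longleftrightarrow>
     operator_adjoint V (operator_closure V T) = operator_closure V T"

definition self_adjoint_graph :: "'a set \<Rightarrow> 'a rel \<Rightarrow> bool" where
  "self_adjoint_graph V E \<longleftrightarrow> essentially_self_adjoint V (adjacency_operator V E)"

text \<open>\<open>(A - z)\<^sup>-\<^sup>1 h\<close> for the self-adjoint operator \<open>A\<close>, i.e. the solution \<open>u\<close> in the domain of \<open>A\<close>
  of \<open>A u - z u = h\<close>.\<close>

definition resolvent_apply :: "'a operator \<Rightarrow> complex \<Rightarrow> ('a \<Rightarrow> complex) \<Rightarrow> ('a \<Rightarrow> complex)" where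
  "resolvent_apply A z h = (THE u. \<exists>w. (u, w) \<in> A \<and> (\<forall>x. w x - z * u x = h x))"

definition resolvent_entry :: "'a set \<Rightarrow> 'a rel \<Rightarrow> 'a \<Rightarrow> complex \<Rightarrow> complex" where
  "resolvent_entry V E v z = ell2_inner V (basis_vec v)
     (resolvent_apply (operator_closure V (adjacency_operator V E)) z (basis_vec v))"

text \<open>The value for graphs that are not self-adjoint is a dummy: under any unimodular network,
  such graphs have probability zero.\<close>

definition spectral_measure :: "'a set \<Rightarrow> 'a rel \<Rightarrow> 'a \<Rightarrow> real measure" where
  "spectral_measure V E v =
     (if self_adjoint_graph V E then
        (THE \<mu>. prob_space \<mu> \<and> sets \<mu> = sets borel \<and>
           (\<forall>z. Im z \<noteq> 0 \<longrightarrow>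
              resolvent_entry V E v z = (LINT \<xi>|\<mu>. 1 / (complex_of_real \<xi> - z))))
      else null_measure borel)"

definition mean_spectral_measure :: "rooted_graph measure \<Rightarrow> real set \<Rightarrow> ennreal" where
  "mean_spectral_measure L B =
     (\<integral>\<^sup>+ g. emeasure (spectral_measure (rg_verts g) (rg_edges g) (rg_root g)) B \<partial>L)"

definition pure_point_support :: "rooted_graph measure \<Rightarrow> real set" where
  "pure_point_support L = {t. mean_spectral_measure L {t} > 0}"


section \<open>Totally real algebraic integers and tree-complexity\<close>

definition totally_real_algebraic_integers :: "real set" where
  "totally_real_algebraic_integers =
     {t. \<exists>p :: int poly. lead_coeff p = 1 \<and> poly (map_poly of_int p) t = 0 \<and>
        (\<forall>z :: complex. poly (map_poly of_int p) z = 0 \<longrightarrow> z \<in> \<real>)}"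

definition adjacency_matrix :: "nat \<Rightarrow> nat rel \<Rightarrow> real mat" where
  "adjacency_matrix n E = Matrix.mat n n (\<lambda>(i, j). if (i, j) \<in> E then 1 else 0)"

text \<open>A minimum over a nonempty set for every totally real algebraic integer.\<close>

definition tree_complexity :: "real \<Rightarrow> nat" where
  "tree_complexity t =
     (LEAST n. \<exists>E. is_tree {..<n} E \<and> eigenvalue (adjacency_matrix n E) t)"

end

theory Submission
  imports Defs
begin

text \<open>
  Let \<open>P\<close> be the orthogonal projection onto the eigenspace of the adjacency operator at \<open>t\<close>, so that
  \<open>\<mu>\<^bsub>(G,o)\<^esub> {t} = P\<^sub>o\<^sub>o\<close>, and let \<open>S\<close> be the set of vertices \<open>x\<close> with \<open>P\<^sub>x\<^sub>x > 0\<close>.  On a tree, all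
  eigenfunctions are proportional on each component \<open>C\<close> of \<open>S\<close>: otherwise some eigenfunction would
  vanish at a vertex \<open>x\<close> of \<open>C\<close> but not at a neighbour, and cutting it off at \<open>x\<close> would put \<open>\<delta>\<^sub>x\<close> in
  the range of \<open>A - t\<close>, forcing \<open>P\<^sub>x\<^sub>x = 0\<close>.  A finite component is therefore a finite tree with
  eigenvalue \<open>t\<close>.

  Let \<open>f\<^sub>C\<close> be the unit eigenfunction spanning the \<open>P e\<^sub>x\<close> with \<open>x \<in> C\<close>.  Each vertex \<open>y\<close> of the boundary
  of \<open>S\<close> gives to each adjacent component \<open>C\<close> the mass of \<open>f\<^sub>C\<close> beyond \<open>y\<close>.  In total \<open>y\<close> gives 1,
  while \<open>C\<close> receives less than 1.  Since \<open>C\<close> has at least \<open>\<iota> |C|\<close> boundary vertices, each adjacent to at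
  most \<open>\<Delta>\<close> components, mass transport yields \<open>\<iota> \<cdot> Pr(o \<in> S) < \<Delta> \<cdot> E[1 / |C(o)|; o \<in> S]\<close> whenever
  \<open>Pr(o \<in> S) > 0\<close>, hence some component has fewer than \<open>\<Delta> / \<iota>\<close> vertices.
\<close>

section \<open>Spectral measures of bounded self-adjoint operators\<close>

text \<open>Two obstacles shape the proof. The spectral measure is specified only by its resolvent,
  so its atom at t must be identified: moments of a bounded symmetric operator yield a measure, its
  Stieltjes transform is matched with the resolvent, and the atom becomes the limit of <e_o, b(A)^n
  e_o> for an explicit polynomial b. Moreover, every transported mass must be a measurable function
  of isomorphism classes; the same limit writes P_xy in terms of walk counts, which depend on finite
  balls only. A component receives less than 1 because the edges leaving C open onto disjoint
  branches that avoid C: it collects disjoint parts of the mass of f_C, and the part on C itself is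
  missing. This strictness turns a comparison of expectations that would otherwise allow equality
  into a contradiction. Components are finite by a separate transport: each x in C sends the mass
  (P_xy)^2 / P_xx to y in C. It sends at most 1, while proportionality on C makes y receive the same
  P_yy from every vertex of C.\<close>

lemma borel_measurable_poly [measurable]: "poly (p :: real poly) \<in> borel_measurable borel"
  by (intro borel_measurable_continuous_onI continuous_intros)

section \<open>The Hausdorff moment problem\<close>

text \<open>Compares falling factorials, whose averages under the Bernstein weights are exact, with
  ordinary powers. The condition \<open>2 * j < n\<close> keeps every factor in [-1, 1] even for k <
  i, where it is negative, so the products differ by at most the sum of the differences of the
  factors.\<close>

lemma falling_quotient_diff_le:
  fixes j k n :: nat
  assumes "k \<le> n" "2 * j < n"
  shows "\<bar>(\<Prod>i<j. (real k - real i) / (real n - real i)) - (k / n) ^ j\<bar> \<le> j * (j / (real n - j))"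
proof -
  have "norm ((\<Prod>i<j. (real k - real i) / (real n - real i)) - (\<Prod>i<j. real k / n))
      \<le> (\<Sum>i<j. norm ((real k - i) / (real n - i) - real k / n))"
  proof (rule norm_prod_diff)
    fix i assume "i \<in> {..<j}"
    then have i: "i < j" by simp
    show "norm ((real k - i) / (real n - i)) \<le> 1"
      using assms i by (auto simp: divide_le_eq abs_le_iff)
    show "norm (real k / n) \<le> 1"
      using assms by (auto simp: divide_le_eq)
  qed
  also have "\<dots> \<le> (\<Sum>i<j. j / (real n - j))"
  proof (rule sum_mono)
    fix i assume "i \<in> {..<j}"
    then have i: "i < j" by simp
    have "(real k - i) / (real n - i) - real k / n = - (i / (real n - i) * ((real n - k) / n))"
      using assms i by (simp add: field_simps)
    then have "norm ((real k - i) / (real n - i) - real k / n)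
        = (i / (real n - i)) * ((real n - k) / n)"
      using assms i by (simp add: abs_mult)
    also have "\<dots> \<le> (j / (real n - j)) * 1"
      using assms i by (intro mult_mono frac_le) (auto simp: divide_le_eq)
    finally show "norm ((real k - i) / (real n - i) - real k / n) \<le> j / (real n - j)"
      by simp
  qed
  finally show ?thesis by simp
qed

lemma binomial_quotient_eq_prod:
  assumes "j \<le> n"
  shows "real (k choose j) / real (n choose j) = (\<Prod>i<j. (real k - real i) / (real n - real i))"
  by (simp add: binomial_gbinomial gbinomial_prod_rev prod_dividef lessThan_atLeast0)

text \<open>Stated in a commutative ring because x will be the polynomial \<open>[:0, 1:]\<close>,
  before the functional \<open>L\<close> is applied. Once \<open>n choose j\<close> and x^j are
  pulled out, what remains is the binomial expansion of (x + (1 - x))^(n - j) = 1.\<close>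

lemma Bernstein_falling_moment:
  fixes x :: "'a::comm_ring_1"
  assumes "j \<le> n"
  shows "(\<Sum>k\<le>n. of_nat ((n choose k) * (k choose j)) * (x ^ k * (1 - x) ^ (n - k)))
     = of_nat (n choose j) * x ^ j"
proof -
  have "(\<Sum>k\<le>n. of_nat ((n choose k) * (k choose j)) * (x ^ k * (1 - x) ^ (n - k)))
      = (\<Sum>k\<in>{j..n}. of_nat ((n choose k) * (k choose j)) * (x ^ k * (1 - x) ^ (n - k)))"
    by (rule sum.mono_neutral_right) (auto simp: not_le binomial_eq_0)
  also have "\<dots> = (\<Sum>k\<in>{j..n}. of_nat (n choose j) * (of_nat ((n - j) choose (k - j)) * (x ^ k * (1 - x) ^ (n - k))))"
  proof (rule sum.cong)
    fix k assume "k \<in> {j..n}"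
    then have "(n choose k) * (k choose j) = (n choose j) * ((n - j) choose (k - j))"
      by (intro choose_mult) auto
    then show "of_nat ((n choose k) * (k choose j)) * (x ^ k * (1 - x) ^ (n - k))
      = of_nat (n choose j) * (of_nat ((n - j) choose (k - j)) * (x ^ k * (1 - x) ^ (n - k)))"
      by (simp add: mult.assoc)
  qed auto
  also have "\<dots> = of_nat (n choose j) * (\<Sum>i\<le>n - j. of_nat ((n - j) choose i) * (x ^ (i + j) * (1 - x) ^ (n - (i + j))))"
    unfolding sum_distrib_left[symmetric]
    by (rule arg_cong[where f="\<lambda>z. _ * z"], rule sum.reindex_bij_witness[of _ "\<lambda>i. i + j" "\<lambda>k. k - j"])
       (use assms in auto)
  also have "(\<Sum>i\<le>n - j. of_nat ((n - j) choose i) * (x ^ (i + j) * (1 - x) ^ (n - (i + j))))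
      = x ^ j * (\<Sum>i\<le>n - j. of_nat ((n - j) choose i) * x ^ i * (1 - x) ^ (n - j - i))"
    by (simp add: sum_distrib_left power_add algebra_simps)
  also have "\<dots> = x ^ j"
    using binomial_ring[of x "1 - x" "n - j"] by simp
  finally show ?thesis .
qed

text \<open>
  The Hausdorff moment problem on \<open>[0, 1]\<close>: the \<open>n\<close>-th Bernstein weights of \<open>L\<close> form a probability
  measure on the points \<open>k / n\<close>, whose moments converge to those of \<open>L\<close>, and Helly's theorem provides
  a limit of these measures.
\<close>

locale Hausdorff_functional =
  fixes L :: "real poly \<Rightarrow> real"
  assumes L_add: "L (p + q) = L p + L q"
    and L_smult: "L (Polynomial.smult c p) = c * L p"
    and L_one: "L 1 = 1"
    and L_Bernstein: "L ([:0, 1:] ^ k * (1 - [:0, 1:]) ^ m) \<ge> 0"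
begin

definition weight :: "nat \<Rightarrow> nat \<Rightarrow> real" where
  "weight n k = (n choose k) * L ([:0, 1:] ^ k * (1 - [:0, 1:]) ^ (n - k))"

lemma L_zero: "L 0 = 0"
  using L_smult[of 0 0] by simp

lemma L_sum: "L (\<Sum>i\<in>I. f i) = (\<Sum>i\<in>I. L (f i))"
  by (induction I rule: infinite_finite_induct) (auto simp: L_zero L_add)

lemma L_of_nat: "L (of_nat c * p) = c * L p"
  using L_smult[of "of_nat c" p] by (simp add: of_nat_poly)

lemma weight_nonneg: "weight n k \<ge> 0"
  unfolding weight_def using L_Bernstein by simp

lemma weight_falling:
  assumes "j \<le> n"
  shows "(\<Sum>k\<le>n. weight n k * real (k choose j)) = (n choose j) * L ([:0, 1:] ^ j)"
proof -
  have "(\<Sum>k\<le>n. weight n k * real (k choose j))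
      = L (\<Sum>k\<le>n. of_nat ((n choose k) * (k choose j)) * ([:0, 1:] ^ k * (1 - [:0, 1:]) ^ (n - k)))"
    unfolding L_sum L_of_nat weight_def by (simp add: algebra_simps)
  also have "\<dots> = (n choose j) * L ([:0, 1:] ^ j)"
    unfolding Bernstein_falling_moment[OF assms] L_of_nat ..
  finally show ?thesis .
qed

lemma weight_sum: "(\<Sum>k\<le>n. weight n k) = 1"
  using weight_falling[of 0 n] by (simp add: L_one)

text \<open>\<open>weight_falling\<close> gives the falling factorial moments exactly. Passing to
  ordinary powers costs at most j * j / (n - j) at each point, hence also on average, since the
  weights sum to 1.\<close>

lemma weight_moment:
  "(\<lambda>n. \<Sum>k\<le>n. weight n k * (k / n) ^ j) \<longlonglongrightarrow> L ([:0, 1:] ^ j)"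
proof -
  have ev: "\<forall>\<^sub>F n in sequentially. n > 2 * j"
    by (rule eventually_gt_at_top)
  have "(\<lambda>n. (\<Sum>k\<le>n. weight n k * (k / n) ^ j) - L ([:0, 1:] ^ j)) \<longlonglongrightarrow> 0"
  proof (rule Lim_null_comparison)
    show "(\<lambda>n. real j * (real j / (real n - real j))) \<longlonglongrightarrow> 0"
      by real_asymp
    show "\<forall>\<^sub>F n in sequentially. norm ((\<Sum>k\<le>n. weight n k * (k / n) ^ j) - L ([:0, 1:] ^ j))
       \<le> real j * (real j / (real n - real j))"
      using ev
    proof eventually_elim
      case (elim n)
      have nj: "real (n choose j) \<noteq> 0" using elim by simp
      have "L ([:0, 1:] ^ j) = (\<Sum>k\<le>n. weight n k * real (k choose j)) / real (n choose j)"
        using weight_falling[of j n] elim nj by simp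
      also have "\<dots> = (\<Sum>k\<le>n. weight n k * (\<Prod>i<j. (real k - real i) / (real n - real i)))"
        unfolding sum_divide_distrib using elim
        by (intro sum.cong) (auto simp flip: binomial_quotient_eq_prod)
      finally have "(\<Sum>k\<le>n. weight n k * (k / n) ^ j) - L ([:0, 1:] ^ j)
         = (\<Sum>k\<le>n. weight n k * ((k / n) ^ j - (\<Prod>i<j. (real k - real i) / (real n - real i))))"
        by (simp add: algebra_simps sum_subtractf)
      also have "norm \<dots> \<le> (\<Sum>k\<le>n. weight n k * (real j * (real j / (real n - real j))))"
      proof (rule norm_sum[THEN order_trans], rule sum_mono)
        fix k assume "k \<in> {..n}"
        then have "\<bar>(k / n) ^ j - (\<Prod>i<j. (real k - real i) / (real n - real i))\<bar>
            \<le> real j * (real j / (real n - real j))"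
          using falling_quotient_diff_le[of k n j] elim by (simp add: abs_minus_commute)
        then show "norm (weight n k * ((k / n) ^ j - (\<Prod>i<j. (real k - real i) / (real n - real i))))
            \<le> weight n k * (real j * (real j / (real n - real j)))"
          using weight_nonneg by (simp add: abs_mult mult_left_mono del: times_divide_eq_right)
      qed
      also have "\<dots> = real j * (real j / (real n - real j))"
        unfolding sum_distrib_right[symmetric] weight_sum by simp
      finally show ?case .
    qed
  qed
  then show ?thesis by (simp add: LIM_zero_iff)
qed

lemma weight_poly:
  "(\<lambda>n. \<Sum>k\<le>n. weight n k * poly p (k / n)) \<longlonglongrightarrow> L p"
proof -
  have p: "p = (\<Sum>i\<le>degree p. Polynomial.smult (coeff p i) ([:0, 1:] ^ i))"
    by (simp add: poly_as_sum_of_monoms flip: monom_altdef)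
  have "(\<lambda>n. \<Sum>i\<le>degree p. coeff p i * (\<Sum>k\<le>n. weight n k * (k / n) ^ i)) \<longlonglongrightarrow>
      (\<Sum>i\<le>degree p. coeff p i * L ([:0, 1:] ^ i))"
    by (intro tendsto_intros weight_moment)
  also have "(\<Sum>i\<le>degree p. coeff p i * L ([:0, 1:] ^ i)) = L p"
    by (subst (2) p) (simp add: L_sum L_smult)
  also have "(\<lambda>n. \<Sum>i\<le>degree p. coeff p i * (\<Sum>k\<le>n. weight n k * (k / n) ^ i))
     = (\<lambda>n. \<Sum>k\<le>n. weight n k * poly p (k / n))"
    unfolding poly_altdef sum_distrib_left by (rule ext, subst sum.swap) (simp add: algebra_simps)
  finally show ?thesis .
qed

definition weight_pmf :: "nat \<Rightarrow> nat pmf" where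
  "weight_pmf n = embed_pmf (\<lambda>k. if k \<le> n then weight n k else 0)"

lemma pmf_weight_pmf: "pmf (weight_pmf n) k = (if k \<le> n then weight n k else 0)"
  unfolding weight_pmf_def
proof (rule pmf_embed_pmf)
  have "(\<integral>\<^sup>+ k. ennreal (if k \<le> n then weight n k else 0) \<partial>count_space UNIV)
     = (\<Sum>k\<le>n. ennreal (weight n k))"
    by (subst nn_integral_count_space'[of "{..n}"]) auto
  also have "\<dots> = 1"
    using weight_nonneg weight_sum by (subst sum_ennreal) auto
  finally show "(\<integral>\<^sup>+ k. ennreal (if k \<le> n then weight n k else 0) \<partial>count_space UNIV) = 1" .
qed (use weight_nonneg in auto)

definition Bernstein_measure :: "nat \<Rightarrow> real measure" where
  "Bernstein_measure n = distr (measure_pmf (weight_pmf n)) borel (\<lambda>k. real k / n)"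

lemma real_distribution_Bernstein: "real_distribution (Bernstein_measure n)"
  unfolding Bernstein_measure_def real_distribution_def real_distribution_axioms_def
  by (auto intro!: measure_pmf.prob_space_distr)

lemma integral_Bernstein_measure:
  fixes f :: "real \<Rightarrow> real"
  assumes [measurable]: "f \<in> borel_measurable borel"
  shows "integral\<^sup>L (Bernstein_measure n) f = (\<Sum>k\<le>n. weight n k * f (k / n))"
proof -
  have "integral\<^sup>L (Bernstein_measure n) f = (\<integral>k. f (k / n) \<partial>measure_pmf (weight_pmf n))"
    unfolding Bernstein_measure_def by (subst integral_distr) auto
  also have "\<dots> = (\<Sum>k\<le>n. pmf (weight_pmf n) k * f (k / n))"
    by (subst integral_measure_pmf[of "{..n}"])
       (auto simp: set_pmf_iff pmf_weight_pmf split: if_splits)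
  finally show ?thesis by (simp add: pmf_weight_pmf)
qed

theorem ex_representing_measure:
  obtains \<nu> where "real_distribution \<nu>" "AE s in \<nu>. 0 \<le> s \<and> s \<le> 1"
    "\<And>p. integral\<^sup>L \<nu> (poly p) = L p"
proof -
  have AE01: "AE s in Bernstein_measure n. 0 \<le> s \<and> s \<le> 1" for n
    unfolding Bernstein_measure_def
    by (subst AE_distr_iff)
       (auto simp: AE_measure_pmf_iff set_pmf_iff pmf_weight_pmf divide_le_eq split: if_splits)
  have "tight Bernstein_measure"
    unfolding tight_def
  proof (intro conjI allI impI, goal_cases)
    case (2 e)
    have "measure (Bernstein_measure n) {-1<..1} > 1 - e" for n
    proof -
      interpret real_distribution "Bernstein_measure n" by (rule real_distribution_Bernstein)
      have "prob {-1<..1} = 1"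
        by (rule prob_eq_1[THEN iffD2]) (use AE01[of n] in auto)
      then show ?thesis using 2 by simp
    qed
    then show ?case by (intro exI[of _ "-1"] exI[of _ 1]) auto
  qed (auto simp: real_distribution_Bernstein)
  then obtain r \<nu> where r: "strict_mono r" and \<nu>: "real_distribution \<nu>"
    and conv: "weak_conv_m (Bernstein_measure \<circ> id \<circ> r) \<nu>"
    using tight_imp_convergent_subsubsequence[of Bernstein_measure id] by (auto simp: strict_mono_id)
  interpret \<nu>: real_distribution \<nu> by fact
  have lim: "(\<lambda>n. integral\<^sup>L (Bernstein_measure (r n)) f) \<longlonglongrightarrow> integral\<^sup>L \<nu> f"
    if "\<And>x. isCont f x" "\<And>x. norm (f x) \<le> c" for f :: "real \<Rightarrow> real" and c :: real
    using weak_conv_imp_integral_bdd_continuous_conv[of "Bernstein_measure \<circ> id \<circ> r" \<nu> f c]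
      that conv \<nu> real_distribution_Bernstein by (simp add: comp_def)
  \<comment> \<open>Weak convergence only tests bounded continuous functions. Composing with this
    clamp onto [0, 1] makes any polynomial bounded without changing it where the measures
    live.\<close>
  define cl :: "real \<Rightarrow> real" where "cl s = max 0 (min 1 s)" for s
  have cl: "0 \<le> cl s" "cl s \<le> 1" "isCont cl x" for s x
    unfolding cl_def by (auto intro!: continuous_intros)
  have clb[measurable]: "cl \<in> borel_measurable borel"
    unfolding cl_def by measurable
  have cl_id: "cl (real k / real n) = real k / real n" if "k \<le> n" for k n
    using that by (auto simp: cl_def divide_le_eq)
  have AE: "AE s in \<nu>. 0 \<le> s \<and> s \<le> 1"
  proof -
    \<comment> \<open>The truncated distance to [0, 1] integrates to 0 against every Bernstein
      measure, hence also against the limit.\<close>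
    define f where "f = (\<lambda>s. min 1 \<bar>s - cl s\<bar>)"
    have [measurable]: "f \<in> borel_measurable borel" unfolding f_def by measurable
    have "(\<lambda>n. integral\<^sup>L (Bernstein_measure (r n)) f) \<longlonglongrightarrow> integral\<^sup>L \<nu> f"
      by (rule lim[of f 1]) (auto simp: f_def intro!: continuous_intros cl)
    moreover have "integral\<^sup>L (Bernstein_measure (r n)) f = 0" for n
      by (subst integral_Bernstein_measure) (auto simp: f_def cl_id)
    ultimately have "integral\<^sup>L \<nu> f = 0" by (simp add: LIMSEQ_const_iff)
    then have "AE s in \<nu>. f s = 0"
      by (subst (asm) integral_nonneg_eq_0_iff_AE)
         (auto simp: f_def intro!: \<nu>.integrable_const_bound[of _ 1])
    then show ?thesis
      by eventually_elim (auto simp: f_def cl_def min_def max_def split: if_splits)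
  qed
  show ?thesis
  proof (rule that[OF \<nu> AE])
    fix p :: "real poly"
    obtain B where B: "\<And>s. s \<in> {0..1} \<Longrightarrow> norm (poly p s) \<le> B"
      using compact_imp_bounded[OF compact_continuous_image[of "{0..1}" "poly p"]]
      by (force simp: bounded_iff intro!: continuous_intros)
    have "(\<lambda>n. integral\<^sup>L (Bernstein_measure (r n)) (\<lambda>s. poly p (cl s))) \<longlonglongrightarrow> (\<integral>s. poly p (cl s) \<partial>\<nu>)"
      by (rule lim[of _ B]) (use B[of "cl _"] cl in \<open>auto intro!: continuous_intros simp del: real_norm_def\<close>)
    moreover have "(\<integral>s. poly p (cl s) \<partial>\<nu>) = integral\<^sup>L \<nu> (poly p)"
    proof (rule integral_cong_AE)
      show "AE s in \<nu>. poly p (cl s) = poly p s"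
        using AE by eventually_elim (simp add: cl_def)
    qed measurable
    moreover have "integral\<^sup>L (Bernstein_measure (r n)) (\<lambda>s. poly p (cl s))
       = (\<Sum>k\<le>r n. weight (r n) k * poly p (k / r n))" for n
      by (subst integral_Bernstein_measure) (auto intro!: sum.cong simp: cl_id)
    moreover have "(\<lambda>n. \<Sum>k\<le>r n. weight (r n) k * poly p (k / r n)) \<longlonglongrightarrow> L p"
      using LIMSEQ_subseq_LIMSEQ[OF weight_poly r] by (simp add: comp_def)
    ultimately show "integral\<^sup>L \<nu> (poly p) = L p"
      by (auto intro: LIMSEQ_unique)
  qed
qed

end

section \<open>Uniqueness of a measure with given Stieltjes transform\<close>

definition cauchy_density :: "real \<Rightarrow> real" where
  "cauchy_density u = 1 / (pi * (1 + u\<^sup>2))"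

definition cauchy_measure :: "real measure" where
  "cauchy_measure = density lborel (\<lambda>u. ennreal (cauchy_density u))"

lemma borel_measurable_cauchy_density [measurable]: "cauchy_density \<in> borel_measurable borel"
  unfolding cauchy_density_def[abs_def] by measurable

lemma cauchy_density_nonneg: "cauchy_density u \<ge> 0"
  unfolding cauchy_density_def by (intro divide_nonneg_nonneg mult_nonneg_nonneg) auto

lemma real_distribution_cauchy: "real_distribution cauchy_measure"
proof -
  have "(\<integral>\<^sup>+u. ennreal (cauchy_density u) \<partial>lborel) = 1"
  proof -
    have int: "integrable lborel (\<lambda>u::real. inverse (1 + u\<^sup>2))"
      using integrable_inverse_1_plus_square by (simp add: set_integrable_def)
    have "(LBINT u. inverse (1 + u\<^sup>2)) = pi"
      using LBINT_inverse_1_plus_square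
      by (simp add: interval_lebesgue_integral_def set_lebesgue_integral_def)
    then have "(LBINT u. cauchy_density u) = 1"
      by (simp add: cauchy_density_def[abs_def] divide_inverse)
    moreover have "integrable lborel cauchy_density"
      using int by (simp add: cauchy_density_def[abs_def] divide_inverse)
    ultimately show ?thesis
      by (subst nn_integral_eq_integral) (auto simp: cauchy_density_nonneg)
  qed
  then show ?thesis
    unfolding real_distribution_def real_distribution_axioms_def cauchy_measure_def
    by (auto intro!: prob_spaceI simp: emeasure_density)
qed

text \<open>
  Adding an independent Cauchy variable of scale \<open>\<epsilon>\<close> gives a law whose density at \<open>x\<close> is
  \<open>Im s(x + \<i>\<epsilon>) / \<pi>\<close> with \<open>s\<close> the Stieltjes transform, and multiplies the characteristic function by
  a factor close to 1 for small \<open>\<epsilon>\<close>.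
\<close>

lemma Poisson_smoothing_eq:
  assumes "real_distribution M"
    and B: "B \<in> sets borel" and \<epsilon>: "\<epsilon> > 0"
  shows "emeasure (distr (M \<Otimes>\<^sub>M cauchy_measure) borel (\<lambda>(s, u). s + \<epsilon> * u)) B
     = (\<integral>\<^sup>+x. indicator B x * ennreal (Im (\<integral>s. 1 / (complex_of_real s - Complex x \<epsilon>) \<partial>M) / pi) \<partial>lborel)"
proof -
  interpret M: real_distribution M by fact
  interpret C: real_distribution cauchy_measure by (rule real_distribution_cauchy)
  interpret P: pair_prob_space M cauchy_measure ..
  interpret Q: pair_sigma_finite M lborel ..
  note B[measurable]
  \<comment> \<open>The kernel Im (1 / (s - x - i \<epsilon>)) / pi is the density at x of a Cauchy
    variable of scale \<epsilon> centred at s. The bound 1 / \<epsilon> on the modulus of the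
    Stieltjes kernel gives the integrability needed to take the imaginary part inside.\<close>
  have kern: "Im (\<integral>s. 1 / (complex_of_real s - Complex x \<epsilon>) \<partial>M) / pi
     = (\<integral>s. cauchy_density ((x - s) / \<epsilon>) / \<epsilon> \<partial>M)"
    and int: "integrable M (\<lambda>s. cauchy_density ((x - s) / \<epsilon>) / \<epsilon>)" for x
  proof -
    have "norm (1 / (complex_of_real s - Complex x \<epsilon>)) \<le> 1 / \<epsilon>" for s
    proof -
      have "\<bar>Im (complex_of_real s - Complex x \<epsilon>)\<bar> \<le> norm (complex_of_real s - Complex x \<epsilon>)"
        by (rule abs_Im_le_cmod)
      then show ?thesis using \<epsilon> by (auto simp: norm_divide intro!: frac_le)
    qed
    then have i: "integrable M (\<lambda>s. 1 / (complex_of_real s - Complex x \<epsilon>))"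
      by (intro M.integrable_const_bound[of _ "1 / \<epsilon>"]) auto
    have eq: "Im (1 / (complex_of_real s - Complex x \<epsilon>)) / pi = cauchy_density ((x - s) / \<epsilon>) / \<epsilon>" for s
    proof -
      have "Im (1 / (complex_of_real s - Complex x \<epsilon>)) = \<epsilon> / ((s - x)\<^sup>2 + \<epsilon>\<^sup>2)"
        by (simp add: Im_divide)
      moreover have "1 + ((x - s) / \<epsilon>)\<^sup>2 = ((s - x)\<^sup>2 + \<epsilon>\<^sup>2) / \<epsilon>\<^sup>2"
        using \<epsilon> by (simp add: field_simps power2_eq_square)
      ultimately show ?thesis
        using \<epsilon> by (simp add: cauchy_density_def power2_eq_square)
    qed
    show "integrable M (\<lambda>s. cauchy_density ((x - s) / \<epsilon>) / \<epsilon>)"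
      unfolding eq[symmetric] by (intro integrable_divide integrable_Im i)
    show "Im (\<integral>s. 1 / (complex_of_real s - Complex x \<epsilon>) \<partial>M) / pi
     = (\<integral>s. cauchy_density ((x - s) / \<epsilon>) / \<epsilon> \<partial>M)"
      unfolding eq[symmetric] using i by simp
  qed
  have "emeasure (distr (M \<Otimes>\<^sub>M cauchy_measure) borel (\<lambda>(s, u). s + \<epsilon> * u)) B
     = (\<integral>\<^sup>+p. indicator B (fst p + \<epsilon> * snd p) \<partial>(M \<Otimes>\<^sub>M cauchy_measure))"
    by (subst nn_integral_indicator[symmetric], simp, subst nn_integral_distr)
       (auto simp: case_prod_beta)
  also have "\<dots> = (\<integral>\<^sup>+s. \<integral>\<^sup>+u. indicator B (s + \<epsilon> * u) \<partial>cauchy_measure \<partial>M)"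
    by (subst C.nn_integral_fst[symmetric]) auto
  also have "\<dots> = (\<integral>\<^sup>+s. \<integral>\<^sup>+x. indicator B x * ennreal (cauchy_density ((x - s) / \<epsilon>) / \<epsilon>) \<partial>lborel \<partial>M)"
  proof (rule nn_integral_cong)
    fix s
    have "(\<integral>\<^sup>+x. indicator B x * ennreal (cauchy_density ((x - s) / \<epsilon>) / \<epsilon>) \<partial>lborel)
       = ennreal \<bar>\<epsilon>\<bar> * (\<integral>\<^sup>+u. indicator B (s + \<epsilon> * u) * ennreal (cauchy_density ((s + \<epsilon> * u - s) / \<epsilon>) / \<epsilon>) \<partial>lborel)"
      by (rule nn_integral_real_affine) (use \<epsilon> in auto)
    also have "\<dots> = (\<integral>\<^sup>+u. ennreal (cauchy_density u) * indicator B (s + \<epsilon> * u) \<partial>lborel)"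
      using \<epsilon> cauchy_density_nonneg
      by (subst nn_integral_cmult[symmetric])
         (auto intro!: nn_integral_cong simp: ennreal_mult[symmetric] indicator_def split: if_splits)
    also have "\<dots> = (\<integral>\<^sup>+u. indicator B (s + \<epsilon> * u) \<partial>cauchy_measure)"
      unfolding cauchy_measure_def by (subst nn_integral_density) auto
    finally show "(\<integral>\<^sup>+u. indicator B (s + \<epsilon> * u) \<partial>cauchy_measure)
      = (\<integral>\<^sup>+x. indicator B x * ennreal (cauchy_density ((x - s) / \<epsilon>) / \<epsilon>) \<partial>lborel)" ..
  qed
  also have "\<dots> = (\<integral>\<^sup>+x. \<integral>\<^sup>+s. indicator B x * ennreal (cauchy_density ((x - s) / \<epsilon>) / \<epsilon>) \<partial>M \<partial>lborel)"
    by (rule Q.Fubini'[symmetric]) measurable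
  also have "\<dots> = (\<integral>\<^sup>+x. indicator B x * ennreal (Im (\<integral>s. 1 / (complex_of_real s - Complex x \<epsilon>) \<partial>M) / pi) \<partial>lborel)"
    using int \<epsilon> cauchy_density_nonneg unfolding kern
    by (intro nn_integral_cong, subst nn_integral_cmult) (auto simp: nn_integral_eq_integral)
  finally show ?thesis .
qed

lemma char_smoothing:
  assumes "real_distribution M"
  shows "char (distr (M \<Otimes>\<^sub>M cauchy_measure) borel (\<lambda>(s, u). s + \<epsilon> * u)) t
     = char M t * char cauchy_measure (\<epsilon> * t)"
proof -
  interpret M: real_distribution M by fact
  interpret C: real_distribution cauchy_measure by (rule real_distribution_cauchy)
  interpret P: pair_prob_space M cauchy_measure ..
  have "char (distr (M \<Otimes>\<^sub>M cauchy_measure) borel (\<lambda>(s, u). s + \<epsilon> * u)) t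
     = (\<integral>p. iexp (t * fst p) * iexp (\<epsilon> * t * snd p) \<partial>(M \<Otimes>\<^sub>M cauchy_measure))"
    unfolding char_def
    by (subst integral_distr) (auto simp: case_prod_beta exp_add[symmetric] algebra_simps)
  also have "\<dots> = (\<integral>s. \<integral>u. iexp (t * s) * iexp (\<epsilon> * t * u) \<partial>cauchy_measure \<partial>M)"
    by (subst P.integral_fst'[symmetric])
       (auto intro!: P.integrable_const_bound[of _ 1] simp: norm_mult)
  also have "\<dots> = char M t * char cauchy_measure (\<epsilon> * t)"
    unfolding char_def by (simp add: mult.commute)
  finally show ?thesis .
qed

theorem Stieltjes_unique:
  assumes M: "real_distribution M" "real_distribution N"
    and eq: "\<And>z. Im z \<noteq> 0 \<Longrightarrow> (\<integral>s. 1 / (complex_of_real s - z) \<partial>M) = (\<integral>s. 1 / (complex_of_real s - z) \<partial>N)"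
  shows "M = N"
proof (rule Levy_uniqueness[OF M], rule ext)
  fix t
  interpret C: real_distribution cauchy_measure by (rule real_distribution_cauchy)
  have "char cauchy_measure \<midarrow>0\<rightarrow> 1"
    using C.isCont_char[of 0] C.char_zero by (simp add: isCont_def)
  then have "\<exists>d>0. \<forall>x. x \<noteq> 0 \<and> norm (x - 0) < d \<longrightarrow> norm (char cauchy_measure x - 1) < 1"
    by (rule LIM_D) simp
  then obtain d where d: "d > 0" and near: "\<And>x. x \<noteq> 0 \<Longrightarrow> norm x < d \<Longrightarrow> norm (char cauchy_measure x - 1) < 1"
    by auto
  \<comment> \<open>The scale depends on t: it brings \<epsilon> t into the neighbourhood of 0 on
    which the Cauchy characteristic function is within distance less than 1 of 1, hence nonzero and
    cancellable.\<close>
  define \<epsilon> where "\<epsilon> = d / (\<bar>t\<bar> + 1)"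
  have \<epsilon>: "\<epsilon> > 0" unfolding \<epsilon>_def using d by simp
  have "norm (\<epsilon> * t) < d"
    unfolding \<epsilon>_def using d by (simp add: abs_mult field_simps)
  then have nz: "char cauchy_measure (\<epsilon> * t) \<noteq> 0"
    using near[of "\<epsilon> * t"] C.char_zero by (cases "\<epsilon> * t = 0") auto
  have "distr (M \<Otimes>\<^sub>M cauchy_measure) borel (\<lambda>(s, u). s + \<epsilon> * u)
      = distr (N \<Otimes>\<^sub>M cauchy_measure) borel (\<lambda>(s, u). s + \<epsilon> * u)"
    by (rule measure_eqI) (use Poisson_smoothing_eq[OF M(1) _ \<epsilon>] Poisson_smoothing_eq[OF M(2) _ \<epsilon>] eq \<epsilon> in auto)
  then show "char M t = char N t"
    using char_smoothing[OF M(1), of \<epsilon> t] char_smoothing[OF M(2), of \<epsilon> t] nz by simp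
qed

section \<open>Spectral measure, kernel projection and resolvent of a bounded symmetric
  operator\<close>

definition opoly :: "('a::real_vector \<Rightarrow> 'a) \<Rightarrow> real poly \<Rightarrow> 'a \<Rightarrow> 'a" where
  "opoly A p v = (\<Sum>i\<le>degree p. coeff p i *\<^sub>R (A ^^ i) v)"

lemma opoly_eq_sum:
  assumes "degree p \<le> n"
  shows "opoly A p v = (\<Sum>i\<le>n. coeff p i *\<^sub>R (A ^^ i) v)"
  unfolding opoly_def
  by (rule sum.mono_neutral_left) (use assms in \<open>auto simp: coeff_eq_0\<close>)

text \<open>
  On \<open>{s. \<bar>s - t\<bar> < M}\<close> the powers of this polynomial decrease to the indicator function of \<open>{t}\<close>.
\<close>

definition kernel_poly :: "real \<Rightarrow> real \<Rightarrow> real poly" where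
  "kernel_poly M t = 1 - Polynomial.smult (1 / M\<^sup>2) ([:-t, 1:] ^ 2)"

locale selfadjoint_operator =
  fixes A :: "'a::{real_inner,complete_space} \<Rightarrow> 'a" and D :: real
  assumes bounded_linear_A: "bounded_linear A"
    and symmetric: "inner (A u) v = inner u (A v)"
    and norm_le: "norm (A v) \<le> D * norm v"
    and D_pos: "D > 0"
begin

interpretation A: bounded_linear A by (rule bounded_linear_A)

lemma opoly_0 [simp]: "opoly A 0 v = 0"
  by (simp add: opoly_def)

lemma opoly_pCons [simp]: "opoly A (pCons a p) v = a *\<^sub>R v + A (opoly A p v)"
proof -
  have "opoly A (pCons a p) v = (\<Sum>i\<le>Suc (degree p). coeff (pCons a p) i *\<^sub>R (A ^^ i) v)"
    by (rule opoly_eq_sum) (simp add: degree_pCons_le)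
  also have "\<dots> = a *\<^sub>R v + A (opoly A p v)"
    unfolding sum.atMost_Suc_shift by (simp add: opoly_def A.sum A.scaleR)
  finally show ?thesis .
qed

lemma opoly_1 [simp]: "opoly A 1 v = v"
  by (simp add: one_pCons A.zero)

lemma opoly_add: "opoly A (p + q) v = opoly A p v + opoly A q v"
  by (induction p q rule: poly_induct2) (simp_all add: A.add A.zero algebra_simps)

lemma opoly_smult: "opoly A (Polynomial.smult c p) v = c *\<^sub>R opoly A p v"
  by (induction p) (simp_all add: A.scaleR scaleR_add_right)

lemma opoly_diff: "opoly A (p - q) v = opoly A p v - opoly A q v"
  using opoly_add[of p "- q" v] opoly_smult[of "-1" q v] by simp

lemma opoly_mult: "opoly A (p * q) v = opoly A p (opoly A q v)"
  by (induction p) (simp_all add: opoly_add opoly_smult)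

lemma opoly_commute: "opoly A p (opoly A q v) = opoly A q (opoly A p v)"
  by (metis mult.commute opoly_mult)

lemma opoly_A: "opoly A p (A v) = A (opoly A p v)"
  using opoly_commute[of p "[:0, 1:]" v] by (simp add: A.zero)

lemma bounded_linear_opoly: "bounded_linear (opoly A p)"
proof (induction p)
  case (pCons a p)
  then show ?case
    by (subst opoly_pCons[abs_def])
       (intro bounded_linear_add bounded_linear_scaleR_right bounded_linear_compose[OF bounded_linear_A])
qed simp

lemma opoly_symmetric: "inner (opoly A p u) v = inner u (opoly A p v)"
proof (induction p arbitrary: v)
  case (pCons a p)
  have "inner (A (opoly A p u)) v = inner u (A (opoly A p v))"
    by (simp add: symmetric pCons.IH opoly_A)
  then show ?case by (simp add: inner_add_left inner_add_right)
qed simp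

definition op_nonneg :: "real poly \<Rightarrow> bool" where
  "op_nonneg p \<longleftrightarrow> (\<forall>v. inner v (opoly A p v) \<ge> 0)"

text \<open>q(A) is symmetric and commutes with p(A), so the quadratic form of q^2 p at v is that of
  p at q(A) v.\<close>

lemma op_nonneg_square_mult:
  assumes "op_nonneg p"
  shows "op_nonneg (q * q * p)"
  unfolding op_nonneg_def
proof
  fix v
  have "inner v (opoly A (q * q * p) v) = inner (opoly A q v) (opoly A p (opoly A q v))"
    by (metis opoly_mult opoly_symmetric mult.assoc mult.commute)
  then show "inner v (opoly A (q * q * p) v) \<ge> 0"
    using assms unfolding op_nonneg_def by simp
qed

lemma op_nonneg_add: "op_nonneg p \<Longrightarrow> op_nonneg q \<Longrightarrow> op_nonneg (p + q)"
  unfolding op_nonneg_def by (simp add: opoly_add inner_add_right)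

text \<open>The affine map from [-D, D], where the spectrum lies, onto [0, 1], the interval of the
  moment problem.\<close>

definition rescale :: "real poly" where "rescale = [:1/2, 1/(2*D):]"

lemma inner_A_abs: "\<bar>inner v (A v)\<bar> \<le> D * (norm v)\<^sup>2"
proof -
  have "\<bar>inner v (A v)\<bar> \<le> norm v * norm (A v)" by (rule Cauchy_Schwarz_ineq2)
  also have "\<dots> \<le> norm v * (D * norm v)" by (intro mult_left_mono norm_le) auto
  finally show ?thesis by (simp add: power2_eq_square algebra_simps)
qed

lemma op_nonneg_X: "op_nonneg rescale" and op_nonneg_1_X: "op_nonneg (1 - rescale)"
proof -
  have "(inner v v / 2 + inner v (A v) / (2 * D) \<ge> 0) \<and> (inner v v / 2 - inner v (A v) / (2 * D) \<ge> 0)" for v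
    using inner_A_abs[of v] D_pos by (auto simp: field_simps dot_square_norm abs_le_iff)
  then show "op_nonneg rescale" "op_nonneg (1 - rescale)"
    unfolding op_nonneg_def rescale_def
    by (auto simp: opoly_diff A.zero A.scaleR inner_add_right inner_diff_right algebra_simps)
qed

text \<open>Pulling out the largest square leaves one of 1, X, 1 - X and X (1 - X). The last is not
  a square times one of the others, but X (1 - X) = (1 - X)^2 X + X^2 (1 - X) is a sum of two such
  products.\<close>

lemma op_nonneg_Bernstein: "op_nonneg (rescale ^ k * (1 - rescale) ^ m)"
proof -
  define q where "q = rescale ^ (k div 2) * (1 - rescale) ^ (m div 2)"
  have one: "op_nonneg 1" by (simp add: op_nonneg_def)
  have "rescale * (1 - rescale) = (1 - rescale) * (1 - rescale) * rescale + rescale * rescale * (1 - rescale)"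
    by (simp add: algebra_simps)
  then have X1X: "op_nonneg (rescale * (1 - rescale))"
    by (metis op_nonneg_add op_nonneg_square_mult op_nonneg_X op_nonneg_1_X)
  have "rescale ^ k * (1 - rescale) ^ m = q * q * (rescale ^ (k mod 2) * (1 - rescale) ^ (m mod 2))"
  proof -
    have "rescale ^ k = rescale ^ (k div 2) * rescale ^ (k div 2) * rescale ^ (k mod 2)"
      by (metis mult_2 power_add mult_div_mod_eq)
    moreover have "(1 - rescale) ^ m = (1 - rescale) ^ (m div 2) * (1 - rescale) ^ (m div 2) * (1 - rescale) ^ (m mod 2)"
      by (metis mult_2 power_add mult_div_mod_eq)
    ultimately show ?thesis unfolding q_def by (simp add: algebra_simps)
  qed
  moreover have "op_nonneg (rescale ^ (k mod 2) * (1 - rescale) ^ (m mod 2))"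
    using one op_nonneg_X op_nonneg_1_X X1X
    by (cases "even k"; cases "even m") (auto simp: even_iff_mod_2_eq_zero odd_iff_mod_2_eq_one)
  ultimately show ?thesis using op_nonneg_square_mult by simp
qed

text \<open>Positivity of the Bernstein polynomials makes p \<mapsto> <e, p(X) e>, with X the
  rescaled operator, a Hausdorff functional. Its representing measure is pushed back from [0, 1] to
  [-D, D].\<close>

theorem ex_spectral_measure:
  assumes e: "norm e = 1"
  obtains \<mu> where "real_distribution \<mu>" "AE s in \<mu>. \<bar>s\<bar> \<le> D"
    "\<And>p. integral\<^sup>L \<mu> (poly p) = inner e (opoly A p e)"
proof -
  interpret H: Hausdorff_functional "\<lambda>p. inner e (opoly A (p \<circ>\<^sub>p rescale) e)"
  proof
    have power: "(p ^ k) \<circ>\<^sub>p rescale = (p \<circ>\<^sub>p rescale) ^ k" for p :: "real poly" and k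
      by (induction k) (simp_all add: pcompose_mult pcompose_1)
    show "inner e (opoly A (([:0, 1:] ^ k * (1 - [:0, 1:]) ^ m) \<circ>\<^sub>p rescale) e) \<ge> 0" for k m
      using op_nonneg_Bernstein[of k m] unfolding op_nonneg_def
      by (simp add: pcompose_mult pcompose_diff pcompose_pCons pcompose_1 power)
  qed (use e in \<open>auto simp: pcompose_add pcompose_1 pcompose_smult opoly_add opoly_smult inner_add_right dot_square_norm\<close>)
  obtain \<nu> where \<nu>: "real_distribution \<nu>" "AE s in \<nu>. 0 \<le> s \<and> s \<le> 1"
    and mom: "\<And>p. integral\<^sup>L \<nu> (poly p) = inner e (opoly A (p \<circ>\<^sub>p rescale) e)"
    using H.ex_representing_measure by metis
  interpret \<nu>: real_distribution \<nu> by fact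
  define \<mu> where "\<mu> = distr \<nu> borel (\<lambda>s. 2 * D * s - D)"
  show ?thesis
  proof (rule that[of \<mu>])
    show "real_distribution \<mu>"
      unfolding \<mu>_def real_distribution_def real_distribution_axioms_def
      by (auto intro!: \<nu>.prob_space_distr)
    show "AE s in \<mu>. \<bar>s\<bar> \<le> D"
      unfolding \<mu>_def
    proof (subst AE_distr_iff)
      show "AE s in \<nu>. \<bar>2 * D * s - D\<bar> \<le> D"
        using \<nu>(2)
      proof eventually_elim
        case (elim s)
        then have "D * s \<ge> 0" "D * s \<le> D * 1" using D_pos by (auto intro: mult_left_mono)
        then show ?case by (simp add: abs_le_iff)
      qed
    qed auto
    fix p :: "real poly"
    have "integral\<^sup>L \<mu> (poly p) = (\<integral>s. poly p (2 * D * s - D) \<partial>\<nu>)"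
      unfolding \<mu>_def by (subst integral_distr) (auto intro!: borel_measurable_continuous_onI continuous_intros)
    also have "\<dots> = integral\<^sup>L \<nu> (poly (p \<circ>\<^sub>p [:-D, 2*D:]))"
      by (simp add: poly_pcompose[abs_def] algebra_simps)
    also have "\<dots> = inner e (opoly A p e)"
      unfolding mom using D_pos by (simp add: pcompose_assoc[symmetric] rescale_def pcompose_pCons)
    finally show "integral\<^sup>L \<mu> (poly p) = inner e (opoly A p e)" .
  qed
qed


text \<open>The isometry p(A) e \<mapsto> p into L^2 of the spectral measure.\<close>

lemma norm_opoly_sq:
  assumes "\<And>p. integral\<^sup>L \<mu> (poly p) = inner e (opoly A p e)"
  shows "(norm (opoly A p e))\<^sup>2 = (\<integral>s. (poly p s)\<^sup>2 \<partial>\<mu>)"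
proof -
  have "(norm (opoly A p e))\<^sup>2 = inner e (opoly A (p * p) e)"
    by (simp add: dot_square_norm[symmetric] opoly_symmetric opoly_mult)
  also have "\<dots> = integral\<^sup>L \<mu> (poly (p * p))" using assms by simp
  finally show ?thesis by (simp add: poly_mult[abs_def] power2_eq_square)
qed

text \<open>Since D + |t| < M, the base polynomial b takes values in (0, 1] on the spectrum, with
  value 1 only at t, so the moments c n of b^n tend to the mass of t. As <b^n e, b^m e> = c (n + m),
  convergence of these numbers alone makes b(A)^n e a Cauchy sequence.\<close>

theorem kernel_projection:
  assumes e: "norm e = 1" and M: "D + \<bar>t\<bar> < M"
    and \<mu>: "real_distribution \<mu>" "AE s in \<mu>. \<bar>s\<bar> \<le> D"
    and mom: "\<And>p. integral\<^sup>L \<mu> (poly p) = inner e (opoly A p e)"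
  obtains h where "(\<lambda>n. opoly A (kernel_poly M t ^ n) e) \<longlonglongrightarrow> h"
    "A h = t *\<^sub>R h" "\<And>f. A f = t *\<^sub>R f \<Longrightarrow> inner h f = inner e f"
    "inner e h = measure \<mu> {t}"
proof -
  interpret \<mu>: real_distribution \<mu> by fact
  let ?b = "kernel_poly M t"
  define B where "B n = opoly A (?b ^ n)" for n
  define c where "c n = inner e (B n e)" for n
  have pb: "poly (?b ^ n) s = (1 - (s - t)\<^sup>2 / M\<^sup>2) ^ n" for n s
    by (simp add: kernel_poly_def)
  have M0: "M > 0" using M D_pos by simp
  have bd: "0 < 1 - (s - t)\<^sup>2 / M\<^sup>2" "1 - (s - t)\<^sup>2 / M\<^sup>2 \<le> 1" "1 - (s - t)\<^sup>2 / M\<^sup>2 = 1 \<longleftrightarrow> s = t"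
    if "\<bar>s\<bar> \<le> D" for s
  proof -
    have "\<bar>s - t\<bar> < M" using that M by linarith
    then have "(s - t)\<^sup>2 < M\<^sup>2" using M0 by (metis abs_ge_zero power2_abs power_strict_mono zero_less_numeral)
    then show "0 < 1 - (s - t)\<^sup>2 / M\<^sup>2" "1 - (s - t)\<^sup>2 / M\<^sup>2 \<le> 1" "1 - (s - t)\<^sup>2 / M\<^sup>2 = 1 \<longleftrightarrow> s = t"
      using M0 by (auto simp: field_simps)
  qed
  have c_lim: "c \<longlonglongrightarrow> measure \<mu> {t}"
  proof -
    have "(\<lambda>n. \<integral>s. poly (?b ^ n) s \<partial>\<mu>) \<longlonglongrightarrow> (\<integral>s. indicator {t} s \<partial>\<mu>)"
    proof (rule integral_dominated_convergence[where w = "\<lambda>_. 1"])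
      show "AE s in \<mu>. (\<lambda>n. poly (?b ^ n) s) \<longlonglongrightarrow> indicator {t} s"
        using \<mu>(2)
      proof eventually_elim
        case (elim s)
        show ?case
        proof (cases "s = t")
          case False
          then have "1 - (s - t)\<^sup>2 / M\<^sup>2 < 1" using bd[OF elim] by linarith
          then show ?thesis unfolding pb using bd(1)[OF elim] False
            by (auto intro!: LIMSEQ_realpow_zero)
        qed (simp add: pb del: poly_power)
      qed
      show "AE s in \<mu>. norm (poly (?b ^ n) s) \<le> 1" for n
        using \<mu>(2)
      proof eventually_elim
        case (elim s)
        show ?case
          unfolding pb norm_power using bd(1,2)[OF elim] by (intro power_le_one) auto
      qed
    qed auto
    then show ?thesis unfolding c_def B_def mom by simp
  qed
  have BB: "inner (B n e) (B m e) = c (n + m)" for n m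
    unfolding c_def B_def by (simp add: opoly_symmetric power_add opoly_mult)
  have nB: "(norm (B n e - B m e))\<^sup>2 = c (n + n) - 2 * c (n + m) + c (m + m)" for n m
    by (simp add: dot_square_norm[symmetric] inner_diff_left inner_diff_right BB add.commute)
  have "Cauchy (\<lambda>n. B n e)"
  proof (rule metric_CauchyI)
    fix r :: real assume r: "r > 0"
    obtain N where N: "\<And>n. n \<ge> N \<Longrightarrow> \<bar>c n - measure \<mu> {t}\<bar> < r\<^sup>2 / 4"
      using LIMSEQ_D[OF c_lim, of "r\<^sup>2 / 4"] r by auto
    show "\<exists>N. \<forall>m\<ge>N. \<forall>n\<ge>N. dist (B m e) (B n e) < r"
    proof (intro exI[of _ N] allI impI)
      fix m n assume mn: "N \<le> m" "N \<le> n"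
      have "(norm (B m e - B n e))\<^sup>2 < r\<^sup>2"
        unfolding nB using N[of "m + m"] N[of "m + n"] N[of "n + n"] mn
        unfolding abs_less_iff by linarith
      then show "dist (B m e) (B n e) < r"
        unfolding dist_norm using r by (simp add: power_less_imp_less_base)
    qed
  qed
  then obtain h where h: "(\<lambda>n. B n e) \<longlonglongrightarrow> h"
    using Cauchy_convergent convergent_def by blast
  have ker: "A h = t *\<^sub>R h"
  proof -
    \<comment> \<open>From the definition of b, (s - t)^2 b^n = M^2 (b^n - b^(n + 1)): applying (A -
      t)^2 turns the sequence into its increments, which tend to 0.\<close>
    have eq: "opoly A ([:-t, 1:] ^ 2) (B n e) = M\<^sup>2 *\<^sub>R (B n e - B (Suc n) e)" for n
    proof -
      have "[:-t, 1:] ^ 2 * ?b ^ n = Polynomial.smult (M\<^sup>2) (?b ^ n - ?b ^ Suc n)"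
        using M0 by (simp add: kernel_poly_def algebra_simps smult_diff_right)
      then show ?thesis
        unfolding B_def by (simp only: opoly_mult[symmetric] opoly_smult opoly_diff)
    qed
    have "(\<lambda>n. opoly A ([:-t, 1:] ^ 2) (B n e)) \<longlonglongrightarrow> opoly A ([:-t, 1:] ^ 2) h"
      by (rule bounded_linear.tendsto[OF bounded_linear_opoly h])
    moreover have "(\<lambda>n. M\<^sup>2 *\<^sub>R (B n e - B (Suc n) e)) \<longlonglongrightarrow> M\<^sup>2 *\<^sub>R (h - h)"
      by (intro tendsto_intros h LIMSEQ_Suc[OF h])
    ultimately have "opoly A ([:-t, 1:] ^ 2) h = M\<^sup>2 *\<^sub>R (h - h)"
      unfolding eq by (rule LIMSEQ_unique)
    then have "opoly A [:-t, 1:] (opoly A [:-t, 1:] h) = 0"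
      by (simp only: power2_eq_square opoly_mult diff_self scaleR_zero_right)
    \<comment> \<open>For a symmetric operator the kernel of (A - t)^2 is that of A - t, because <(A
      - t) h, (A - t) h> = <h, (A - t)^2 h>.\<close>
    then have "inner (opoly A [:-t, 1:] h) (opoly A [:-t, 1:] h) = 0"
      by (simp only: opoly_symmetric inner_zero_right)
    then have "opoly A [:-t, 1:] h = 0" by (simp only: inner_eq_zero_iff)
    then show ?thesis by (simp add: A.zero)
  qed
  have proj: "inner h f = inner e f" if f: "A f = t *\<^sub>R f" for f
  proof -
    have "opoly A [:-t, 1:] f = 0"
      using f by (simp add: A.zero)
    then have "opoly A ([:-t, 1:] ^ 2) f = 0"
      by (simp only: power2_eq_square opoly_mult linear_0[OF bounded_linear.linear[OF bounded_linear_opoly]])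
    then have "opoly A ?b f = f"
      by (simp only: kernel_poly_def opoly_diff opoly_smult opoly_1 scaleR_zero_right diff_zero)
    then have "B n f = f" for n
      unfolding B_def by (induction n) (simp_all add: opoly_mult)
    then have "inner (B n e) f = inner e f" for n
      unfolding B_def by (simp add: opoly_symmetric)
    moreover have "(\<lambda>n. inner (B n e) f) \<longlonglongrightarrow> inner h f"
      by (intro tendsto_intros h)
    ultimately show ?thesis by (simp add: LIMSEQ_const_iff)
  qed
  have "(\<lambda>n. c n) \<longlonglongrightarrow> inner e h"
    unfolding c_def by (intro tendsto_intros h)
  then have "inner e h = measure \<mu> {t}"
    using c_lim by (rule LIMSEQ_unique)
  with h ker proj show ?thesis unfolding B_def by (intro that)
qed

text \<open>
  With \<open>z = a + \<i> b\<close> and \<open>g(s) = 1 / ((s - a)\<^sup>2 + b\<^sup>2)\<close> one has \<open>1 / (s - z) = (s - a + \<i> b) g(s)\<close>, so it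
  suffices to approximate \<open>g\<close> uniformly on the spectrum by real polynomials.
\<close>

theorem resolvent_approximation:
  fixes a b :: real
  assumes e: "norm e = 1" and b: "b \<noteq> 0"
    and \<mu>: "real_distribution \<mu>" "AE s in \<mu>. \<bar>s\<bar> \<le> D"
    and mom: "\<And>p. integral\<^sup>L \<mu> (poly p) = inner e (opoly A p e)"
  obtains p1 p2 :: "nat \<Rightarrow> real poly" and u1 u2 where
    "(\<lambda>n. opoly A (p1 n) e) \<longlonglongrightarrow> u1" "(\<lambda>n. opoly A (p2 n) e) \<longlonglongrightarrow> u2"
    "A u1 = a *\<^sub>R u1 - b *\<^sub>R u2 + e" "A u2 = a *\<^sub>R u2 + b *\<^sub>R u1"
    "Complex (inner e u1) (inner e u2) = (\<integral>s. 1 / (complex_of_real s - Complex a b) \<partial>\<mu>)"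
proof -
  interpret \<mu>: real_distribution \<mu> by fact
  define k :: "real \<Rightarrow> real" where "k s = (s - a)\<^sup>2 + b\<^sup>2" for s
  have k_pos: "k s \<ge> b\<^sup>2" "k s > 0" for s
    unfolding k_def using b by (auto intro: add_nonneg_pos)
  define g where "g s = 1 / k s" for s
  have g_bound: "0 \<le> g s" "g s \<le> 1 / b\<^sup>2" for s
    unfolding g_def using k_pos[of s] b by (auto intro!: frac_le)
  have g_cont: "continuous_on T g" for T
    unfolding g_def[abs_def] k_def using b by (intro continuous_intros) (auto simp: sum_power2_eq_zero_iff)
  have [measurable]: "g \<in> borel_measurable borel" "k \<in> borel_measurable borel"
    by (intro borel_measurable_continuous_onI g_cont) (simp add: k_def[abs_def])
  have "\<exists>q. \<forall>s. \<bar>s\<bar> \<le> D \<longrightarrow> \<bar>g s - poly q s\<bar> < 1 / Suc n" for n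
  proof -
    obtain f where f: "real_polynomial_function f" "\<And>s. s \<in> {-D..D} \<Longrightarrow> \<bar>g s - f s\<bar> < 1 / Suc n"
      by (rule Stone_Weierstrass_real_polynomial_function[of "{-D..D}" g "1 / Suc n"]) (auto intro: g_cont)
    obtain c m where c: "f = (\<lambda>x. \<Sum>i\<le>m. c i * x ^ i)"
      using f(1) real_polynomial_function_iff_sum by metis
    define q where "q = (\<Sum>i\<le>m. Polynomial.monom (c i) i)"
    have "poly q s = f s" for s
      by (simp add: q_def c poly_sum poly_monom)
    then show ?thesis using f(2) by (intro exI[of _ q]) (auto simp: abs_le_iff)
  qed
  then obtain q where q: "\<And>n s. \<bar>s\<bar> \<le> D \<Longrightarrow> \<bar>g s - poly (q n) s\<bar> < 1 / Suc n"
    by metis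
  have q1: "\<bar>g s - poly (q n) s\<bar> \<le> 1" if "\<bar>s\<bar> \<le> D" for n s
    using q[OF that, of n] by (smt (verit) divide_le_eq_1 of_nat_Suc of_nat_0_le_iff)
  have q_lim: "(\<lambda>n. poly (q n) s) \<longlonglongrightarrow> g s" if "\<bar>s\<bar> \<le> D" for s
  proof -
    have "(\<lambda>n. g s - poly (q n) s) \<longlonglongrightarrow> 0"
      by (rule Lim_null_comparison[OF _ LIMSEQ_inverse_real_of_nat])
         (use q[OF that] in \<open>auto intro!: always_eventually less_imp_le simp: inverse_eq_divide\<close>)
    then have "(\<lambda>n. g s - (g s - poly (q n) s)) \<longlonglongrightarrow> g s - 0"
      by (intro tendsto_intros)
    then show ?thesis by simp
  qed
  define w where "w n = opoly A (q n) e" for n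
  \<comment> \<open>The isometry with L^2 of \<mu> bounds p(A) e by the supremum of |p| on [-D, D];
    uniform approximation on the spectrum thus becomes convergence of vectors.\<close>
  have nrm: "norm (opoly A p e) \<le> r" if "\<And>s. \<bar>s\<bar> \<le> D \<Longrightarrow> \<bar>poly p s\<bar> \<le> r" "r \<ge> 0" for p r
  proof -
    have "(norm (opoly A p e))\<^sup>2 = (\<integral>s. (poly p s)\<^sup>2 \<partial>\<mu>)"
      using mom by (rule norm_opoly_sq)
    also have "\<dots> \<le> (\<integral>s. r\<^sup>2 \<partial>\<mu>)"
    proof (rule integral_mono_AE)
      have b: "AE s in \<mu>. (poly p s)\<^sup>2 \<le> r\<^sup>2"
        using \<mu>(2) by eventually_elim (metis that(1) abs_le_square_iff abs_of_nonneg that(2))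
      then show "AE s in \<mu>. (poly p s)\<^sup>2 \<le> r\<^sup>2" .
      show "integrable \<mu> (\<lambda>s. (poly p s)\<^sup>2)"
        by (rule \<mu>.integrable_const_bound[of _ "r\<^sup>2"]) (use b in auto)
    qed auto
    also have "\<dots> = r\<^sup>2" using \<mu>.prob_space by simp
    finally show ?thesis using that(2) by (rule power2_le_imp_le)
  qed
  have "Cauchy w"
  proof (rule metric_CauchyI)
    fix r :: real assume r: "r > 0"
    obtain N where N: "1 / Suc N < r / 2"
      using nat_approx_posE[of "r / 2"] r by auto
    show "\<exists>N. \<forall>m\<ge>N. \<forall>n\<ge>N. dist (w m) (w n) < r"
    proof (intro exI[of _ N] allI impI)
      fix m n assume mn: "N \<le> m" "N \<le> n"
      have le: "1 / real (Suc m) \<le> 1 / Suc N" "1 / real (Suc n) \<le> 1 / Suc N"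
        using mn by (auto intro!: frac_le)
      have "norm (opoly A (q m - q n) e) \<le> 2 * (1 / Suc N)"
      proof (rule nrm)
        fix s assume "\<bar>s\<bar> \<le> D"
        from q[OF this, of m] q[OF this, of n] le
        show "\<bar>poly (q m - q n) s\<bar> \<le> 2 * (1 / Suc N)"
          unfolding poly_diff abs_less_iff abs_le_iff by linarith
      qed auto
      then show "dist (w m) (w n) < r"
        using N unfolding dist_norm w_def by (simp add: opoly_diff)
    qed
  qed
  then obtain u where u: "w \<longlonglongrightarrow> u"
    using Cauchy_convergent convergent_def by blast
  \<comment> \<open>This is k as a polynomial. Since |k q_n - 1| = k |g - q_n| is uniformly small on
    the spectrum, the limit u of q_n(A) e solves k(A) u = e, so u plays the role of g(A) e.\<close>
  define kp :: "real poly" where "kp = [:-a, 1:] ^ 2 + [:b\<^sup>2:]"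
  have kp: "poly kp s = k s" for s
    by (simp add: kp_def k_def)
  have ku: "opoly A kp u = e"
  proof -
    define C where "C = (D + \<bar>a\<bar>)\<^sup>2 + b\<^sup>2"
    have "k s \<le> C" if "\<bar>s\<bar> \<le> D" for s
      unfolding k_def C_def using that by (intro add_right_mono) (simp add: abs_le_square_iff[symmetric])
    then have "norm (opoly A (kp * q n - 1) e) \<le> C / Suc n" for n
    proof (intro nrm)
      fix s assume s: "\<bar>s\<bar> \<le> D" and "\<And>s. \<bar>s\<bar> \<le> D \<Longrightarrow> k s \<le> C"
      then have kC: "k s \<le> C" by blast
      have "poly (kp * q n - 1) s = - k s * (g s - poly (q n) s)"
        unfolding poly_diff poly_mult kp g_def using k_pos[of s] by (simp add: field_simps)
      then have "\<bar>poly (kp * q n - 1) s\<bar> = k s * \<bar>g s - poly (q n) s\<bar>"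
        using k_pos[of s] by (simp add: abs_mult)
      also have "\<dots> \<le> C * (1 / Suc n)"
        using q[OF s, of n] kC k_pos[of s] by (intro mult_mono) auto
      finally show "\<bar>poly (kp * q n - 1) s\<bar> \<le> C / Suc n" by simp
    qed (auto simp: C_def)
    then have "norm (opoly A kp (w n) - e) \<le> C / Suc n" for n
      by (simp add: opoly_diff opoly_mult w_def)
    moreover have "(\<lambda>n. C / Suc n) \<longlonglongrightarrow> 0"
      by real_asymp
    ultimately have "(\<lambda>n. opoly A kp (w n) - e) \<longlonglongrightarrow> 0"
      by (rule Lim_null_comparison[OF always_eventually[OF allI]])
    then have "(\<lambda>n. opoly A kp (w n)) \<longlonglongrightarrow> e"
      by (simp add: LIM_zero_iff)
    moreover have "(\<lambda>n. opoly A kp (w n)) \<longlonglongrightarrow> opoly A kp u"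
      by (rule bounded_linear.tendsto[OF bounded_linear_opoly u])
    ultimately have "e = opoly A kp u" by (rule LIMSEQ_unique)
    then show ?thesis ..
  qed
  \<comment> \<open>Real and imaginary part of s - cnj z. Hence u1 + i u2 stands for (A - cnj z)
    g(A) e, which is the resolvent at z applied to e.\<close>
  define l1 l2 :: "real poly" where "l1 = [:-a, 1:]" and "l2 = [:b:]"
  define u1 u2 where "u1 = opoly A l1 u" and "u2 = opoly A l2 u"
  have l: "(\<lambda>n. opoly A (l * q n) e) \<longlonglongrightarrow> opoly A l u" for l
    using bounded_linear.tendsto[OF bounded_linear_opoly u] by (simp add: opoly_mult w_def)
  have inn: "inner e (opoly A l u) = (\<integral>s. poly l s * g s \<partial>\<mu>) \<and> integrable \<mu> (\<lambda>s. poly l s * g s)" for l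
  proof -
    obtain c where c: "\<And>s. s \<in> {-D..D} \<Longrightarrow> norm (poly l s) \<le> c"
      using compact_imp_bounded[OF compact_continuous_image[of "{-D..D}" "poly l"]]
      by (force simp: bounded_iff intro!: continuous_intros)
    have c0: "c \<ge> 0" using c[of 0] D_pos by (simp add: order_trans[OF abs_ge_zero])
    have "(\<lambda>n. inner e (opoly A (l * q n) e)) \<longlonglongrightarrow> inner e (opoly A l u)"
      by (intro tendsto_intros l)
    then have 1: "(\<lambda>n. \<integral>s. poly l s * poly (q n) s \<partial>\<mu>) \<longlonglongrightarrow> inner e (opoly A l u)"
      unfolding mom[symmetric] by (simp add: poly_mult[abs_def])
    have 2: "(\<lambda>n. \<integral>s. poly l s * poly (q n) s \<partial>\<mu>) \<longlonglongrightarrow> (\<integral>s. poly l s * g s \<partial>\<mu>)"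
    proof (rule integral_dominated_convergence[where w = "\<lambda>_. c * (1 / b\<^sup>2 + 1)"])
      show "AE s in \<mu>. (\<lambda>n. poly l s * poly (q n) s) \<longlonglongrightarrow> poly l s * g s"
        using \<mu>(2) by eventually_elim (intro tendsto_intros q_lim)
      show "AE s in \<mu>. norm (poly l s * poly (q n) s) \<le> c * (1 / b\<^sup>2 + 1)" for n
        using \<mu>(2)
      proof eventually_elim
        case (elim s)
        have "\<bar>poly (q n) s\<bar> \<le> 1 / b\<^sup>2 + 1"
          using q1[OF elim, of n] g_bound[of s] unfolding abs_le_iff by linarith
        then show ?case using c[of s] elim c0 by (auto simp: abs_mult abs_le_iff intro!: mult_mono)
      qed
    qed auto
    have "integrable \<mu> (\<lambda>s. poly l s * g s)"
    proof (rule \<mu>.integrable_const_bound[of _ "c * (1 / b\<^sup>2)"])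
      show "AE s in \<mu>. norm (poly l s * g s) \<le> c * (1 / b\<^sup>2)"
        using \<mu>(2)
      proof eventually_elim
        case (elim s)
        then have "\<bar>poly l s\<bar> * g s \<le> c * (1 / b\<^sup>2)"
          using c[of s] c0 g_bound[of s] by (intro mult_mono) (auto simp: abs_le_iff)
        then show ?case using g_bound(1)[of s] by (simp add: abs_mult)
      qed
    qed auto
    with LIMSEQ_unique[OF 1 2] show ?thesis by simp
  qed
  show ?thesis
  proof (rule that[of "\<lambda>n. l1 * q n" u1 "\<lambda>n. l2 * q n" u2])
    show "(\<lambda>n. opoly A (l1 * q n) e) \<longlonglongrightarrow> u1" "(\<lambda>n. opoly A (l2 * q n) e) \<longlonglongrightarrow> u2"
      unfolding u1_def u2_def by (rule l)+
    have u12: "u1 = A u - a *\<^sub>R u" "u2 = b *\<^sub>R u"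
      by (simp_all add: u1_def u2_def l1_def l2_def A.zero)
    show "A u2 = a *\<^sub>R u2 + b *\<^sub>R u1"
      unfolding u12 by (simp add: A.scaleR algebra_simps)
    have l1_eq: "opoly A l1 v = A v - a *\<^sub>R v" for v
      by (simp add: l1_def A.zero)
    have "e = opoly A l1 (opoly A l1 u) + opoly A [:b\<^sup>2:] u"
      using ku by (simp only: kp_def l1_def opoly_add power2_eq_square opoly_mult)
    then have "e = A u1 - a *\<^sub>R u1 + (b * b) *\<^sub>R u"
      by (simp add: u1_def l1_eq A.zero power2_eq_square)
    then show "A u1 = a *\<^sub>R u1 - b *\<^sub>R u2 + e"
      by (simp add: u12(2))
    have "(\<integral>s. 1 / (complex_of_real s - Complex a b) \<partial>\<mu>)
       = (\<integral>s. complex_of_real (poly l1 s * g s) + \<i> * complex_of_real (poly l2 s * g s) \<partial>\<mu>)"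
    proof (rule Bochner_Integration.integral_cong)
      fix s
      have kn: "complex_of_real (k s) = (complex_of_real s - Complex a b) * (complex_of_real (s - a) + \<i> * complex_of_real b)"
        by (simp add: complex_eq_iff k_def power2_eq_square algebra_simps)
      moreover have "complex_of_real s - Complex a b \<noteq> 0"
        using b by (simp add: complex_eq_iff)
      ultimately have "1 / (complex_of_real s - Complex a b)
          = (complex_of_real (s - a) + \<i> * complex_of_real b) / complex_of_real (k s)"
        using k_pos(2)[of s] by (subst frac_eq_eq) (auto simp: mult.commute)
      then show "1 / (complex_of_real s - Complex a b)
        = complex_of_real (poly l1 s * g s) + \<i> * complex_of_real (poly l2 s * g s)"
        by (simp add: l1_def l2_def g_def add_divide_distrib algebra_simps diff_divide_distrib)
    qed simp
    also have "\<dots> = complex_of_real (\<integral>s. poly l1 s * g s \<partial>\<mu>) + \<i> * complex_of_real (\<integral>s. poly l2 s * g s \<partial>\<mu>)"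
      using inn by (subst Bochner_Integration.integral_add) (auto simp del: of_real_mult)
    also have "\<dots> = Complex (inner e u1) (inner e u2)"
      using inn[of l1] inn[of l2] by (simp add: u1_def u2_def complex_eq_iff)
    finally show "Complex (inner e u1) (inner e u2) = (\<integral>s. 1 / (complex_of_real s - Complex a b) \<partial>\<mu>)" by simp
  qed
qed

end

section \<open>The adjacency operator on square-summable functions\<close>

text \<open>Real sequences over all of \<open>nat\<close> serve every graph at once. The adjacency
  operator has real entries, so a complex vector is treated as a pair of real ones, and
  \<open>ell2 V\<close> consists of pairs supported in V.\<close>

typedef l2 = "{f :: nat \<Rightarrow> real. summable (\<lambda>n. (f n)\<^sup>2)}"
  morphisms coord L2
  by (rule exI[of _ "\<lambda>_. 0"]) simp

lemma coord_L2: "summable (\<lambda>n. (f n)\<^sup>2) \<Longrightarrow> coord (L2 f) = f"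
  by (simp add: L2_inverse)

lemma summable_coord_sq: "summable (\<lambda>n. (coord u n)\<^sup>2)"
  using coord[of u] by simp

lemma l2_eqI: "(\<And>n. coord u n = coord v n) \<Longrightarrow> u = v"
  by (simp add: coord_inject[symmetric] fun_eq_iff)

lemma summable_mult_of_squares:
  fixes f g :: "nat \<Rightarrow> real"
  assumes "summable (\<lambda>n. (f n)\<^sup>2)" "summable (\<lambda>n. (g n)\<^sup>2)"
  shows "summable (\<lambda>n. f n * g n)"
proof (rule summable_comparison_test)
  show "summable (\<lambda>n. (f n)\<^sup>2 + (g n)\<^sup>2)" using assms by (rule summable_add)
  have "\<bar>a * b\<bar> \<le> a\<^sup>2 + b\<^sup>2" for a b :: real
    using sum_squares_bound[of "\<bar>a\<bar>" "\<bar>b\<bar>"] abs_ge_zero[of "a * b"]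
    unfolding abs_mult power2_abs by linarith
  then show "\<exists>N. \<forall>n\<ge>N. norm (f n * g n) \<le> (f n)\<^sup>2 + (g n)\<^sup>2" by simp
qed

lemma summable_square_add:
  fixes f g :: "nat \<Rightarrow> real"
  assumes "summable (\<lambda>n. (f n)\<^sup>2)" "summable (\<lambda>n. (g n)\<^sup>2)"
  shows "summable (\<lambda>n. (f n + g n)\<^sup>2)"
  unfolding power2_sum
  by (intro summable_add assms) (simp add: mult.assoc summable_mult summable_mult_of_squares assms)

instantiation l2 :: real_inner
begin

definition "0 = L2 (\<lambda>_. 0)"
definition "u + v = L2 (\<lambda>n. coord u n + coord v n)"
definition "- u = L2 (\<lambda>n. - coord u n)"
definition "u - v = L2 (\<lambda>n. coord u n - coord v n)" for u v :: l2
definition "r *\<^sub>R u = L2 (\<lambda>n. r * coord u n)"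
definition "inner u v = (\<Sum>n. coord u n * coord v n)"
definition "norm u = sqrt (inner u u)" for u :: l2
definition "dist u v = norm (u - v)" for u v :: l2
definition "sgn u = inverse (norm u) *\<^sub>R u" for u :: l2
definition [code del]: "(uniformity :: (l2 \<times> l2) filter) = (INF e\<in>{0 <..}. principal {(x, y). dist x y < e})"
definition [code del]: "open (U :: l2 set) \<longleftrightarrow> (\<forall>x\<in>U. eventually (\<lambda>(x', y). x' = x \<longrightarrow> y \<in> U) uniformity)"

lemma coord_zero [simp]: "coord 0 n = 0"
  by (simp add: zero_l2_def coord_L2)

lemma coord_add [simp]: "coord (u + v) n = coord u n + coord v n"
  by (simp add: plus_l2_def coord_L2 summable_square_add summable_coord_sq)

lemma coord_minus [simp]: "coord (- u) n = - coord u n"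
  by (simp add: uminus_l2_def coord_L2 summable_coord_sq)

lemma coord_diff [simp]: "coord (u - v) n = coord u n - coord v n"
  using summable_square_add[OF summable_coord_sq[of u] summable_coord_sq[of "- v"]]
  by (simp add: minus_l2_def coord_L2)

lemma coord_scaleR [simp]: "coord (r *\<^sub>R u) n = r * coord u n"
  by (simp add: scaleR_l2_def coord_L2 power_mult_distrib summable_mult summable_coord_sq)

lemma summable_coord_mult: "summable (\<lambda>n. coord u n * coord v n)"
  by (intro summable_mult_of_squares summable_coord_sq)

instance
proof
  fix u v w :: l2 and r :: real
  show "dist u v = norm (u - v)" by (rule dist_l2_def)
  show "inner u v = inner v u" by (simp add: inner_l2_def mult.commute)
  show "inner (u + v) w = inner u w + inner v w"
    by (simp add: inner_l2_def distrib_right suminf_add summable_coord_mult)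
  show "inner (r *\<^sub>R u) v = r * inner u v"
    by (simp add: inner_l2_def mult.assoc suminf_mult summable_coord_mult)
  show "0 \<le> inner u u"
    by (auto simp: inner_l2_def intro!: suminf_nonneg summable_coord_mult)
  have "(\<Sum>n. coord u n * coord u n) = 0 \<longleftrightarrow> (\<forall>n. coord u n * coord u n = 0)"
    by (rule suminf_eq_zero_iff) (auto intro: summable_coord_mult)
  then show "inner u u = 0 \<longleftrightarrow> u = 0"
    by (auto simp: inner_l2_def intro: l2_eqI)
qed (auto intro!: l2_eqI simp: algebra_simps sgn_l2_def norm_l2_def uniformity_l2_def open_l2_def)

end

lemma norm_l2_sq: "(norm u)\<^sup>2 = (\<Sum>n. (coord u n)\<^sup>2)" for u :: l2
  unfolding power2_norm_eq_inner inner_l2_def by (simp add: power2_eq_square)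

lemma sum_coord_sq_le: "finite F \<Longrightarrow> (\<Sum>n\<in>F. (coord u n)\<^sup>2) \<le> (norm u)\<^sup>2"
  unfolding norm_l2_sq by (rule sum_le_suminf) (auto simp: summable_coord_sq)

lemma abs_coord_le_norm: "\<bar>coord u n\<bar> \<le> norm u"
  using sum_coord_sq_le[of "{n}" u] abs_le_square_iff[of "coord u n" "norm u"] by simp

lemma bounded_linear_coord: "bounded_linear (\<lambda>u. coord u n)"
  by (rule bounded_linear_intro[of _ 1]) (use abs_coord_le_norm in auto)

lemmas tendsto_coord = bounded_linear.tendsto[OF bounded_linear_coord]

lemma l2_of_bounded_sums:
  fixes f :: "nat \<Rightarrow> real"
  assumes "\<And>N. (\<Sum>n<N. (f n)\<^sup>2) \<le> C"
  shows "summable (\<lambda>n. (f n)\<^sup>2)" "(norm (L2 f))\<^sup>2 \<le> C"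
proof -
  show s: "summable (\<lambda>n. (f n)\<^sup>2)"
    by (rule summableI_nonneg_bounded[of _ C]) (use assms in auto)
  show "(norm (L2 f))\<^sup>2 \<le> C"
    unfolding norm_l2_sq coord_L2[OF s] by (rule suminf_le_const[OF s]) (use assms in auto)
qed

instance l2 :: complete_space
proof
  fix X :: "nat \<Rightarrow> l2" assume X: "Cauchy X"
  have "convergent (\<lambda>k. coord (X k) n)" for n
    using bounded_linear.Cauchy[OF bounded_linear_coord X] by (rule Cauchy_convergent)
  then obtain g where g: "\<And>n. (\<lambda>k. coord (X k) n) \<longlonglongrightarrow> g n"
    unfolding convergent_def by metis
  \<comment> \<open>The coordinatewise limit is controlled through finite partial sums: there the
    limit in m can be taken termwise, with a bound uniform in N.\<close>
  have main: "summable (\<lambda>n. (coord (X k) n - g n)\<^sup>2) \<and> (norm (L2 (\<lambda>n. coord (X k) n - g n)))\<^sup>2 \<le> r\<^sup>2"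
    if K: "\<And>m. m \<ge> K \<Longrightarrow> norm (X k - X m) \<le> r" for k K r
  proof -
    have b: "(\<Sum>n<N. (coord (X k) n - g n)\<^sup>2) \<le> r\<^sup>2" for N
    proof (rule LIMSEQ_le_const2)
      show "(\<lambda>m. \<Sum>n<N. (coord (X k) n - coord (X m) n)\<^sup>2) \<longlonglongrightarrow> (\<Sum>n<N. (coord (X k) n - g n)\<^sup>2)"
        by (intro tendsto_intros g)
      have "(\<Sum>n<N. (coord (X k) n - coord (X m) n)\<^sup>2) \<le> r\<^sup>2" if "m \<ge> K" for m
      proof -
        have "(\<Sum>n<N. (coord (X k) n - coord (X m) n)\<^sup>2) \<le> (norm (X k - X m))\<^sup>2"
          using sum_coord_sq_le[of "{..<N}" "X k - X m"] by simp
        also have "\<dots> \<le> r\<^sup>2" using K[OF that] by (intro power_mono) auto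
        finally show ?thesis .
      qed
      then show "\<exists>K. \<forall>m\<ge>K. (\<Sum>n<N. (coord (X k) n - coord (X m) n)\<^sup>2) \<le> r\<^sup>2" by blast
    qed
    show ?thesis using l2_of_bounded_sums[OF b] by blast
  qed
  have Cau: "\<exists>K. \<forall>k\<ge>K. \<forall>m\<ge>K. norm (X k - X m) \<le> r" if "r > 0" for r
    using metric_CauchyD[OF X that] by (auto simp: dist_norm intro: less_imp_le)
  obtain K0 where K0: "\<forall>k\<ge>K0. \<forall>m\<ge>K0. norm (X k - X m) \<le> 1"
    using Cau[of 1] by auto
  have s0: "summable (\<lambda>n. (coord (X K0) n - g n)\<^sup>2)"
    using main[of K0 K0 1] K0 by simp
  have sg: "summable (\<lambda>n. (g n)\<^sup>2)"
    using summable_square_add[OF summable_coord_sq[of "- X K0"] s0] by (simp add: power2_commute)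
  have eq: "L2 (\<lambda>n. coord (X k) n - g n) = X k - L2 g" for k
    by (simp add: minus_l2_def coord_L2[OF sg])
  have "X \<longlonglongrightarrow> L2 g"
  proof (rule LIMSEQ_I)
    fix r :: real assume r: "r > 0"
    obtain K where K: "\<forall>k\<ge>K. \<forall>m\<ge>K. norm (X k - X m) \<le> r / 2" using Cau[of "r / 2"] r by auto
    have "norm (X k - L2 g) < r" if "k \<ge> K" for k
    proof -
      have "(norm (X k - L2 g))\<^sup>2 \<le> (r / 2)\<^sup>2"
        using main[of K k "r / 2"] K that unfolding eq by simp
      then have "norm (X k - L2 g) \<le> r / 2" by (rule power2_le_imp_le) (use r in simp)
      then show ?thesis using r by simp
    qed
    then show "\<exists>K. \<forall>k\<ge>K. norm (X k - L2 g) < r" by blast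
  qed
  then show "convergent X" unfolding convergent_def by blast
qed

definition bvec :: "nat \<Rightarrow> l2" where
  "bvec x = L2 (\<lambda>n. if n = x then 1 else 0)"

lemma coord_bvec: "coord (bvec x) n = (if n = x then 1 else 0)"
proof -
  have "summable (\<lambda>n. (if n = x then 1 else 0 :: real)\<^sup>2)"
    by (rule summable_finite[of "{x}"]) auto
  then show ?thesis by (simp add: bvec_def coord_L2)
qed

lemma inner_bvec: "inner u (bvec x) = coord u x" "inner (bvec x) u = coord u x"
proof -
  have "inner u (bvec x) = (\<Sum>n\<in>{x}. coord u n * coord (bvec x) n)"
    unfolding inner_l2_def by (rule suminf_finite) (auto simp: coord_bvec)
  then show "inner u (bvec x) = coord u x" by (simp add: coord_bvec)
  then show "inner (bvec x) u = coord u x" by (simp add: inner_commute)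
qed

lemma norm_bvec [simp]: "norm (bvec x) = 1"
  by (simp add: norm_eq_sqrt_inner inner_bvec coord_bvec)

lemma coord_sum: "coord (\<Sum>i\<in>I. f i) n = (\<Sum>i\<in>I. coord (f i) n)"
  by (induction I rule: infinite_finite_induct) auto

lemma truncation_tendsto: "(\<lambda>N. \<Sum>n<N. coord u n *\<^sub>R bvec n) \<longlonglongrightarrow> u"
proof -
  define T where "T N = (\<Sum>n<N. coord u n *\<^sub>R bvec n)" for N
  have T: "coord (T N) m = (if m < N then coord u m else 0)" for N m
    by (simp add: T_def coord_sum coord_bvec if_distrib[of "\<lambda>z. _ * z"] cong: if_cong)
  have "(norm (u - T N))\<^sup>2 = (norm u)\<^sup>2 - (\<Sum>n<N. (coord u n)\<^sup>2)" for N
  proof -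
    have "inner u (T N) = (\<Sum>n<N. (coord u n)\<^sup>2)" "inner (T N) (T N) = (\<Sum>n<N. (coord u n)\<^sup>2)"
      by (simp_all add: T_def inner_sum_right inner_sum_left inner_bvec power2_eq_square)
         (simp add: coord_sum coord_bvec if_distrib[of "\<lambda>z. _ * z"] cong: if_cong)
    then show ?thesis
      by (simp add: power2_norm_eq_inner inner_diff_left inner_diff_right inner_commute)
  qed
  moreover have "(\<lambda>N. (norm u)\<^sup>2 - (\<Sum>n<N. (coord u n)\<^sup>2)) \<longlonglongrightarrow> (norm u)\<^sup>2 - (norm u)\<^sup>2"
    unfolding norm_l2_sq by (intro tendsto_intros summable_LIMSEQ summable_coord_sq)
  ultimately have "(\<lambda>N. sqrt ((norm (u - T N))\<^sup>2)) \<longlonglongrightarrow> sqrt 0"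
    by (intro tendsto_real_sqrt) simp
  then have "(\<lambda>N. norm (T N - u)) \<longlonglongrightarrow> 0" by (simp add: norm_minus_commute)
  then show ?thesis unfolding T_def by (simp add: tendsto_norm_zero_iff LIM_zero_iff)
qed

definition restr :: "nat set \<Rightarrow> l2 \<Rightarrow> l2" where
  "restr B u = L2 (\<lambda>n. if n \<in> B then coord u n else 0)"

lemma coord_restr [simp]: "coord (restr B u) n = (if n \<in> B then coord u n else 0)"
proof -
  have "summable (\<lambda>n. (if n \<in> B then coord u n else 0)\<^sup>2)"
    by (rule summable_comparison_test[OF _ summable_coord_sq[of u]]) auto
  then show ?thesis by (simp add: restr_def coord_L2)
qed

lemma inner_restr_right: "inner u (restr B v) = inner (restr B u) (restr B v)"
  by (simp add: inner_l2_def) (rule suminf_cong, simp)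

section \<open>The adjacency operator of a graph of bounded degree\<close>

definition adj :: "nat rel \<Rightarrow> (nat \<Rightarrow> real) \<Rightarrow> nat \<Rightarrow> real" where
  "adj E f x = (\<Sum>y\<in>E `` {x}. f y)"

definition adjop :: "nat rel \<Rightarrow> l2 \<Rightarrow> l2" where
  "adjop E u = L2 (adj E (coord u))"

locale bounded_degree_graph =
  fixes E :: "nat rel" and D :: nat
  assumes sym_E: "sym E" and finite_nbrs: "finite (E `` {x})" and card_nbrs: "card (E `` {x}) \<le> D"
    and D_pos: "D > 0"
begin

text \<open>Cauchy-Schwarz on each neighbourhood costs one factor D, and counting how often each
  vertex occurs as a neighbour costs another. Finite sums are used because square-summability of the
  image is itself derived from this bound.\<close>

lemma sum_adj_sq_le:
  "(\<Sum>x<N. (adj E (coord u) x)\<^sup>2) \<le> (D * norm u)\<^sup>2"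
proof -
  define U where "U = (\<Union>x<N. E `` {x})"
  have finU: "finite U" unfolding U_def using finite_nbrs by auto
  have "(\<Sum>x<N. (adj E (coord u) x)\<^sup>2) \<le> (\<Sum>x<N. D * (\<Sum>y\<in>E `` {x}. (coord u y)\<^sup>2))"
  proof (rule sum_mono)
    fix x
    have "(adj E (coord u) x)\<^sup>2 \<le> card (E `` {x}) * (\<Sum>y\<in>E `` {x}. (coord u y)\<^sup>2)"
      unfolding adj_def using sum_squared_le_sum_of_squares[of "coord u" "E `` {x}"]
      by (simp add: mult.commute)
    also have "\<dots> \<le> D * (\<Sum>y\<in>E `` {x}. (coord u y)\<^sup>2)"
      using card_nbrs by (intro mult_right_mono sum_nonneg) auto
    finally show "(adj E (coord u) x)\<^sup>2 \<le> D * (\<Sum>y\<in>E `` {x}. (coord u y)\<^sup>2)" .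
  qed
  also have "\<dots> = D * (\<Sum>x<N. \<Sum>y | y \<in> U \<and> (x, y) \<in> E. (coord u y)\<^sup>2)"
    unfolding sum_distrib_left by (intro sum.cong refl) (auto simp: U_def)
  also have "(\<Sum>x<N. \<Sum>y | y \<in> U \<and> (x, y) \<in> E. (coord u y)\<^sup>2)
      = (\<Sum>y\<in>U. \<Sum>x | x \<in> {..<N} \<and> (x, y) \<in> E. (coord u y)\<^sup>2)"
    by (rule sum.swap_restrict) (auto simp: finU)
  also have "\<dots> \<le> (\<Sum>y\<in>U. D * (coord u y)\<^sup>2)"
  proof (rule sum_mono)
    fix y
    have "{x. x \<in> {..<N} \<and> (x, y) \<in> E} \<subseteq> E `` {y}"
      using sym_E by (auto dest: symD)
    then have "card {x. x \<in> {..<N} \<and> (x, y) \<in> E} \<le> D"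
      using card_mono[OF finite_nbrs] card_nbrs order_trans by blast
    then show "(\<Sum>x | x \<in> {..<N} \<and> (x, y) \<in> E. (coord u y)\<^sup>2) \<le> D * (coord u y)\<^sup>2"
      by (simp add: mult_right_mono)
  qed
  also have "\<dots> \<le> D * (norm u)\<^sup>2"
    unfolding sum_distrib_left[symmetric] by (intro mult_left_mono sum_coord_sq_le finU) auto
  finally show ?thesis using D_pos by (simp add: power2_eq_square algebra_simps)
qed

lemma coord_adjop: "coord (adjop E u) x = adj E (coord u) x"
  unfolding adjop_def using l2_of_bounded_sums(1)[OF sum_adj_sq_le] by (simp add: coord_L2)

lemma norm_adjop_le: "norm (adjop E u) \<le> D * norm u"
proof -
  have "(norm (adjop E u))\<^sup>2 \<le> (D * norm u)\<^sup>2"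
    unfolding adjop_def by (rule l2_of_bounded_sums(2)[OF sum_adj_sq_le])
  then show ?thesis by (rule power2_le_imp_le) simp
qed

lemma bounded_linear_adjop: "bounded_linear (adjop E)"
  by (rule bounded_linear_intro[of _ D])
     (auto intro!: l2_eqI simp: coord_adjop adj_def sum.distrib sum_distrib_left norm_adjop_le mult.commute)

lemma adjop_bvec_coord: "coord (adjop E (bvec y)) x = (if (x, y) \<in> E then 1 else 0)"
proof -
  have "coord (adjop E (bvec y)) x = (\<Sum>z\<in>E `` {x}. if z = y then 1 else 0)"
    by (simp add: coord_adjop adj_def coord_bvec)
  then show ?thesis using finite_nbrs by simp
qed

text \<open>Against a basis vector this is the symmetry of E; linearity and continuity along the
  truncations of v give the general case.\<close>

lemma adjop_symmetric: "inner (adjop E u) v = inner u (adjop E v)"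
proof -
  interpret A: bounded_linear "adjop E" by (rule bounded_linear_adjop)
  have b: "inner (adjop E u) (bvec n) = inner u (adjop E (bvec n))" for u n
  proof -
    have "adj E (coord u) n = inner (adjop E (bvec n)) u" if "\<And>m. coord w m = (if m \<in> E `` {n} then coord u m else 0)" for w
    proof -
      have "inner (adjop E (bvec n)) u = (\<Sum>m. coord (adjop E (bvec n)) m * coord u m)"
        by (simp add: inner_l2_def)
      also have "\<dots> = (\<Sum>m\<in>E `` {n}. coord (adjop E (bvec n)) m * coord u m)"
        by (rule suminf_finite) (use finite_nbrs sym_E in \<open>auto simp: adjop_bvec_coord dest: symD\<close>)
      also have "\<dots> = adj E (coord u) n"
        unfolding adj_def by (rule sum.cong) (use sym_E in \<open>auto simp: adjop_bvec_coord dest: symD\<close>)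
      finally show ?thesis ..
    qed
    from this[of "restr (E `` {n}) u"] show ?thesis
      by (simp add: inner_bvec coord_adjop inner_commute)
  qed
  define T where "T N = (\<Sum>n<N. coord v n *\<^sub>R bvec n)" for N
  have T: "T \<longlonglongrightarrow> v" unfolding T_def by (rule truncation_tendsto)
  have eq: "inner (adjop E u) (T N) = inner u (adjop E (T N))" for N
    unfolding T_def by (simp add: inner_sum_right A.sum A.scaleR b)
  have "(\<lambda>N. inner (adjop E u) (T N)) \<longlonglongrightarrow> inner (adjop E u) v"
    by (intro tendsto_intros T)
  moreover have "(\<lambda>N. inner (adjop E u) (T N)) \<longlonglongrightarrow> inner u (adjop E v)"
    unfolding eq by (intro tendsto_intros A.tendsto T)
  ultimately show ?thesis by (rule LIMSEQ_unique)
qed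

sublocale selfadjoint_operator "adjop E" "real D"
  by (rule selfadjoint_operator.intro) (use D_pos in \<open>simp_all add: bounded_linear_adjop adjop_symmetric norm_adjop_le\<close>)

lemma coord_adjop_funpow: "coord ((adjop E ^^ i) u) = (adj E ^^ i) (coord u)"
  by (induction i) (simp_all add: ext[OF coord_adjop])

end

section \<open>The resolvent entry and the atoms of the spectral measure of a graph\<close>

definition cplx :: "l2 \<Rightarrow> l2 \<Rightarrow> nat \<Rightarrow> complex" where
  "cplx f g x = Complex (coord f x) (coord g x)"

definition supported :: "nat set \<Rightarrow> l2 \<Rightarrow> bool" where
  "supported V u \<longleftrightarrow> (\<forall>x. x \<notin> V \<longrightarrow> coord u x = 0)"

lemma supported_lim:
  assumes "\<And>n. supported V (F n)" "F \<longlonglongrightarrow> u"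
  shows "supported V u"
  unfolding supported_def
proof (intro allI impI)
  fix x assume "x \<notin> V"
  then have "(\<lambda>n. coord (F n) x) = (\<lambda>_. 0)" using assms(1) by (auto simp: supported_def)
  then show "coord u x = 0"
    using tendsto_coord[OF assms(2), of x] by (simp add: LIMSEQ_const_iff)
qed

lemma coord_sq_has_sum:
  assumes "supported V u"
  shows "((\<lambda>x. (coord u x)\<^sup>2) has_sum (norm u)\<^sup>2) V"
proof -
  have "((\<lambda>x. (coord u x)\<^sup>2) has_sum (norm u)\<^sup>2) UNIV"
    unfolding norm_l2_sq
    by (rule norm_summable_imp_has_sum) (use summable_coord_sq in \<open>auto intro: summable_sums\<close>)
  then show ?thesis
    by (rule has_sum_cong_neutral[THEN iffD1, rotated -1]) (use assms in \<open>auto simp: supported_def\<close>)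
qed

lemma cmod_cplx_has_sum:
  assumes "supported V f" "supported V g"
  shows "((\<lambda>x. (cmod (cplx f g x))\<^sup>2) has_sum ((norm f)\<^sup>2 + (norm g)\<^sup>2)) V"
  using has_sum_add[OF coord_sq_has_sum[OF assms(1)] coord_sq_has_sum[OF assms(2)]]
  by (simp add: cplx_def cmod_power2)

lemma cplx_ell2: "supported V f \<Longrightarrow> supported V g \<Longrightarrow> cplx f g \<in> ell2 V"
  using cmod_cplx_has_sum[of V f g]
  by (auto simp: ell2_def summable_on_def cplx_def supported_def complex_eq_iff)

lemma ell2_norm_cplx:
  assumes "supported V f" "supported V g"
  shows "ell2_norm V (cplx f g) = sqrt ((norm f)\<^sup>2 + (norm g)\<^sup>2)"
  unfolding ell2_norm_def using infsumI[OF cmod_cplx_has_sum[OF assms]] by simp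

lemma ell2_norm_cplx_tendsto:
  assumes "\<And>n. supported V (F n)" "\<And>n. supported V (G n)" "F \<longlonglongrightarrow> f" "G \<longlonglongrightarrow> g"
  shows "(\<lambda>n. ell2_norm V (\<lambda>x. cplx (F n) (G n) x - cplx f g x)) \<longlonglongrightarrow> 0"
proof -
  have s: "supported V f" "supported V g" using assms supported_lim by blast+
  have "(\<lambda>x. cplx (F n) (G n) x - cplx f g x) = cplx (F n - f) (G n - g)" for n
    by (rule ext) (simp add: cplx_def complex_eq_iff)
  moreover have "supported V (F n - f)" "supported V (G n - g)" for n
    using s assms by (auto simp: supported_def)
  ultimately have "ell2_norm V (\<lambda>x. cplx (F n) (G n) x - cplx f g x)
      = sqrt ((norm (F n - f))\<^sup>2 + (norm (G n - g))\<^sup>2)" for n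
    by (simp add: ell2_norm_cplx)
  moreover have "(\<lambda>n. sqrt ((norm (F n - f))\<^sup>2 + (norm (G n - g))\<^sup>2)) \<longlonglongrightarrow> sqrt (0\<^sup>2 + 0\<^sup>2)"
    using assms(3,4) by (intro tendsto_intros) (simp_all add: tendsto_norm_zero_iff LIM_zero_iff)
  ultimately show ?thesis by simp
qed

lemma ell2_cplxE:
  fixes u :: "nat \<Rightarrow> complex"
  assumes "u \<in> ell2 V"
  obtains f g where "supported V f" "supported V g" "u = cplx f g"
proof -
  have s: "(\<lambda>x. (cmod (u x))\<^sup>2) summable_on UNIV"
    using assms unfolding ell2_def
    by (auto elim!: summable_on_cong_neutral[THEN iffD1, rotated -1])
  then have s: "summable (\<lambda>x. (cmod (u x))\<^sup>2)"
    using summable_on_UNIV_nonneg_real_iff[of "\<lambda>x. (cmod (u x))\<^sup>2"] by simp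
  have s1: "summable (\<lambda>x. (Re (u x))\<^sup>2)" "summable (\<lambda>x. (Im (u x))\<^sup>2)"
    by (rule summable_comparison_test[OF _ s]; simp add: cmod_power2)+
  show ?thesis
    by (rule that[of "L2 (\<lambda>x. Re (u x))" "L2 (\<lambda>x. Im (u x))"])
       (use assms in \<open>auto simp: supported_def coord_L2[OF s1(1)] coord_L2[OF s1(2)] cplx_def ell2_def\<close>)
qed

lemma ell2_norm_tendsto_pointwise:
  fixes x :: nat
  assumes F: "\<And>n. F n \<in> ell2 V" and u: "u \<in> ell2 V"
    and lim: "(\<lambda>n. ell2_norm V (\<lambda>x. F n x - u x)) \<longlonglongrightarrow> 0"
  shows "(\<lambda>n. F n x) \<longlonglongrightarrow> u x"
proof -
  have "cmod (F n x - u x) \<le> ell2_norm V (\<lambda>x. F n x - u x)" for n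
  proof -
    obtain f g where fg: "supported V f" "supported V g" "F n = cplx f g" using ell2_cplxE[OF F] by metis
    obtain f' g' where fg': "supported V f'" "supported V g'" "u = cplx f' g'" using ell2_cplxE[OF u] by metis
    have eq: "(\<lambda>x. F n x - u x) = cplx (f - f') (g - g')"
      unfolding fg fg' by (rule ext) (simp add: cplx_def complex_eq_iff)
    have "(cmod (F n x - u x))\<^sup>2 \<le> (norm (f - f'))\<^sup>2 + (norm (g - g'))\<^sup>2"
      using sum_coord_sq_le[of "{x}" "f - f'"] sum_coord_sq_le[of "{x}" "g - g'"]
      unfolding fun_cong[OF eq] by (simp add: cplx_def cmod_power2)
    then have "cmod (F n x - u x) \<le> sqrt ((norm (f - f'))\<^sup>2 + (norm (g - g'))\<^sup>2)"
      by (rule real_le_rsqrt)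
    then show ?thesis
      unfolding eq using fg fg' by (subst ell2_norm_cplx) (auto simp: supported_def)
  qed
  then have "(\<lambda>n. F n x - u x) \<longlonglongrightarrow> 0"
    by (intro Lim_null_comparison[OF always_eventually[OF allI] lim])
  then show ?thesis by (simp add: LIM_zero_iff)
qed

locale bounded_degree_network = bounded_degree_graph +
  fixes V :: "nat set"
  assumes E_V: "E \<subseteq> V \<times> V"
begin

lemma supported_adjop: "supported V (adjop E u)"
  using E_V by (auto simp: supported_def coord_adjop adj_def intro!: sum.neutral)

text \<open>Keeps polynomial approximants inside the domain of the adjacency operator before
  closure, so that their limits can be placed in the closure.\<close>

lemma finite_support_opoly:
  assumes "finite {x. coord u x \<noteq> 0}" "supported V u"
  shows "finite {x. coord (opoly (adjop E) p u) x \<noteq> 0}" "supported V (opoly (adjop E) p u)"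
proof -
  have fin: "finite {x. coord (adjop E w) x \<noteq> 0}" if "finite {x. coord w x \<noteq> 0}" for w
  proof (rule finite_subset)
    show "{x. coord (adjop E w) x \<noteq> 0} \<subseteq> (\<Union>y\<in>{y. coord w y \<noteq> 0}. E `` {y})"
    proof
      fix x assume "x \<in> {x. coord (adjop E w) x \<noteq> 0}"
      then obtain y where "(x, y) \<in> E" "coord w y \<noteq> 0"
        unfolding coord_adjop adj_def using sum.not_neutral_contains_not_neutral by blast
      then show "x \<in> (\<Union>y\<in>{y. coord w y \<noteq> 0}. E `` {y})"
        using sym_E by (auto dest: symD)
    qed
  qed (use that finite_nbrs in auto)
  have "finite {x. coord (opoly (adjop E) p u) x \<noteq> 0} \<and> supported V (opoly (adjop E) p u)"
  proof (induction p)
    case (pCons a p)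
    have "finite ({x. coord u x \<noteq> 0} \<union> {x. coord (adjop E (opoly (adjop E) p u)) x \<noteq> 0})"
      using assms pCons.IH fin by blast
    then have "finite {x. coord (opoly (adjop E) (pCons a p) u) x \<noteq> 0}"
      by (rule rev_finite_subset) auto
    then show ?case
      using assms supported_adjop by (auto simp: supported_def)
  qed (auto simp: supported_def)
  then show "finite {x. coord (opoly (adjop E) p u) x \<noteq> 0}" "supported V (opoly (adjop E) p u)"
    by auto
qed

lemma cplx_adjop: "cplx (adjop E f) (adjop E g) x = (\<Sum>y\<in>E `` {x}. cplx f g y)"
  by (simp add: cplx_def coord_adjop adj_def complex_eq_iff)

text \<open>Norm convergence implies pointwise convergence, and every neighbourhood sum is finite.
  Elements of the closure thus still satisfy the local equation, which is what uniqueness of the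
  resolvent solution requires.\<close>

lemma closure_adjacency_pointwise:
  assumes "(u, w) \<in> operator_closure V (adjacency_operator V E)"
  shows "w x = (\<Sum>y\<in>E `` {x}. u y)"
proof -
  obtain F G where FG: "\<And>n. (F n, G n) \<in> adjacency_operator V E"
    and lim: "(\<lambda>n. ell2_norm V (\<lambda>x. F n x - u x)) \<longlonglongrightarrow> 0" "(\<lambda>n. ell2_norm V (\<lambda>x. G n x - w x)) \<longlonglongrightarrow> 0"
    and uw: "u \<in> ell2 V" "w \<in> ell2 V"
    using assms unfolding operator_closure_def by auto
  have G: "G n = (\<lambda>x. \<Sum>y\<in>E `` {x}. F n y)" and finF: "finite {x. F n x \<noteq> 0}" and subF: "{x. F n x \<noteq> 0} \<subseteq> V" for n
    using FG[of n] by (auto simp: adjacency_operator_def)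
  have fin_ell2: "f \<in> ell2 V" if "finite {x. f x \<noteq> 0}" "{x. f x \<noteq> 0} \<subseteq> V" for f :: "nat \<Rightarrow> complex"
  proof -
    have "(\<lambda>x. (cmod (f x))\<^sup>2) summable_on {x. f x \<noteq> 0}" using that by (intro summable_on_finite)
    then have "(\<lambda>x. (cmod (f x))\<^sup>2) summable_on V"
      by (rule summable_on_cong_neutral[THEN iffD1, rotated -1]) (use that in auto)
    then show ?thesis using that by (auto simp: ell2_def)
  qed
  have "finite {x. G n x \<noteq> 0}" "{x. G n x \<noteq> 0} \<subseteq> V" for n
  proof -
    have "{x. G n x \<noteq> 0} \<subseteq> (\<Union>y\<in>{y. F n y \<noteq> 0}. E `` {y})"
    proof
      fix x assume "x \<in> {x. G n x \<noteq> 0}"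
      then obtain y where "(x, y) \<in> E" "F n y \<noteq> 0"
        unfolding G using sum.not_neutral_contains_not_neutral by blast
      then show "x \<in> (\<Union>y\<in>{y. F n y \<noteq> 0}. E `` {y})"
        using sym_E by (auto dest: symD)
    qed
    then show "finite {x. G n x \<noteq> 0}" "{x. G n x \<noteq> 0} \<subseteq> V"
      using finF finite_nbrs E_V by (auto intro: finite_subset)
  qed
  then have ell: "F n \<in> ell2 V" "G n \<in> ell2 V" for n using finF subF fin_ell2 by blast+
  have "(\<lambda>n. G n x) \<longlonglongrightarrow> w x"
    by (rule ell2_norm_tendsto_pointwise[OF ell(2) uw(2) lim(2)])
  moreover have "(\<lambda>n. G n x) \<longlonglongrightarrow> (\<Sum>y\<in>E `` {x}. u y)"
    unfolding G by (intro tendsto_intros ell2_norm_tendsto_pointwise[OF ell(1) uw(1) lim(1)])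
  ultimately show ?thesis by (rule LIMSEQ_unique)
qed

text \<open>A symmetric operator has no nonreal eigenvalue: written for real and imaginary parts,
  symmetry forces b (<f, f> + <g, g>) = 0.\<close>

lemma resolvent_equation_unique:
  assumes b: "b \<noteq> 0"
    and f: "adjop E f = a *\<^sub>R f - b *\<^sub>R g" and g: "adjop E g = a *\<^sub>R g + b *\<^sub>R f"
  shows "f = 0 \<and> g = 0"
proof -
  have "inner (adjop E f) g = inner f (adjop E g)" by (rule adjop_symmetric)
  then have "b * (inner f f + inner g g) = 0"
    unfolding f g by (simp add: inner_diff_left inner_add_right algebra_simps)
  then show ?thesis
    using b inner_ge_zero[of f] inner_ge_zero[of g]
    by (auto simp: add_nonneg_eq_0_iff)
qed

text \<open>Evaluates the description in \<open>resolvent_apply\<close>. The vector from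
  \<open>resolvent_approximation\<close> is a limit of finitely supported ones, so it lies in the
  closure. Any other solution satisfies the same pointwise equation, and the difference solves the
  homogeneous one.\<close>

theorem resolvent_entry_eq:
  assumes v: "v \<in> V" and z: "Im z \<noteq> 0"
    and \<mu>: "real_distribution \<mu>" "AE s in \<mu>. \<bar>s\<bar> \<le> D"
    and mom: "\<And>p. integral\<^sup>L \<mu> (poly p) = inner (bvec v) (opoly (adjop E) p (bvec v))"
  shows "resolvent_entry V E v z = (\<integral>s. 1 / (complex_of_real s - z) \<partial>\<mu>)"
proof -
  obtain a b where zab: "z = Complex a b" by (cases z)
  have b: "b \<noteq> 0" using z zab by simp
  obtain p1 p2 :: "nat \<Rightarrow> real poly" and u1 u2 where
    lim: "(\<lambda>n. opoly (adjop E) (p1 n) (bvec v)) \<longlonglongrightarrow> u1" "(\<lambda>n. opoly (adjop E) (p2 n) (bvec v)) \<longlonglongrightarrow> u2"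
    and eqs: "adjop E u1 = a *\<^sub>R u1 - b *\<^sub>R u2 + bvec v" "adjop E u2 = a *\<^sub>R u2 + b *\<^sub>R u1"
    and val: "Complex (inner (bvec v) u1) (inner (bvec v) u2) = (\<integral>s. 1 / (complex_of_real s - Complex a b) \<partial>\<mu>)"
    using resolvent_approximation[OF norm_bvec b \<mu> mom] by metis
  have bv: "finite {x. coord (bvec v) x \<noteq> 0}" "supported V (bvec v)"
    using v by (auto simp: coord_bvec supported_def)
  note fs = finite_support_opoly[OF bv]
  have su: "supported V u1" "supported V u2"
    by (rule supported_lim[OF fs(2) lim(1)]) (rule supported_lim[OF fs(2) lim(2)])
  define u w where "u = cplx u1 u2" and "w = cplx (adjop E u1) (adjop E u2)"
  have in_cl: "(u, w) \<in> operator_closure V (adjacency_operator V E)"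
  proof -
    define F where "F n = cplx (opoly (adjop E) (p1 n) (bvec v)) (opoly (adjop E) (p2 n) (bvec v))" for n
    define G where "G n = cplx (adjop E (opoly (adjop E) (p1 n) (bvec v))) (adjop E (opoly (adjop E) (p2 n) (bvec v)))" for n
    have "(F n, G n) \<in> adjacency_operator V E" for n
    proof -
      have "{x. F n x \<noteq> 0} \<subseteq> {x. coord (opoly (adjop E) (p1 n) (bvec v)) x \<noteq> 0} \<union> {x. coord (opoly (adjop E) (p2 n) (bvec v)) x \<noteq> 0}"
        by (auto simp: F_def cplx_def complex_eq_iff)
      then have "finite {x. F n x \<noteq> 0}"
        using fs(1) by (auto intro: finite_subset)
      moreover have "{x. F n x \<noteq> 0} \<subseteq> V"
        using fs(2)[of "p1 n"] fs(2)[of "p2 n"]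
        by (auto simp: F_def cplx_def complex_eq_iff supported_def)
      moreover have "G n = (\<lambda>x. \<Sum>y\<in>E `` {x}. F n y)"
        by (rule ext) (simp only: F_def G_def cplx_adjop)
      ultimately show ?thesis by (auto simp: adjacency_operator_def)
    qed
    moreover have "(\<lambda>n. ell2_norm V (\<lambda>x. F n x - u x)) \<longlonglongrightarrow> 0"
      unfolding F_def u_def by (intro ell2_norm_cplx_tendsto fs(2) lim)
    moreover have "(\<lambda>n. ell2_norm V (\<lambda>x. G n x - w x)) \<longlonglongrightarrow> 0"
      unfolding G_def w_def
      by (intro ell2_norm_cplx_tendsto supported_adjop bounded_linear.tendsto[OF bounded_linear_adjop] lim)
    moreover have "u \<in> ell2 V" "w \<in> ell2 V"
      unfolding u_def w_def by (intro cplx_ell2 su supported_adjop)+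
    ultimately show ?thesis unfolding operator_closure_def by auto
  qed
  have eq: "w x - z * u x = basis_vec v x" for x
    unfolding u_def w_def eqs zab
    by (simp add: cplx_def basis_vec_def coord_bvec complex_eq_iff)
  have "resolvent_apply (operator_closure V (adjacency_operator V E)) z (basis_vec v) = u"
    unfolding resolvent_apply_def
  proof (rule the_equality)
    show "\<exists>w. (u, w) \<in> operator_closure V (adjacency_operator V E) \<and> (\<forall>x. w x - z * u x = basis_vec v x)"
      using in_cl eq by blast
    fix u' assume "\<exists>w. (u', w) \<in> operator_closure V (adjacency_operator V E) \<and> (\<forall>x. w x - z * u' x = basis_vec v x)"
    then obtain w' where w': "(u', w') \<in> operator_closure V (adjacency_operator V E)"
      and eq': "\<And>x. w' x - z * u' x = basis_vec v x" by blast
    have "u' \<in> ell2 V" using w' by (simp add: operator_closure_def)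
    then obtain f g where fg: "u' = cplx f g" by (metis ell2_cplxE)
    have sum: "(\<Sum>y\<in>E `` {x}. u' y) = z * u' x + basis_vec v x" for x
      using closure_adjacency_pointwise[OF w', of x] eq'[of x] by (simp add: algebra_simps)
    have A': "cplx (adjop E f) (adjop E g) x = z * cplx f g x + basis_vec v x" for x
      using sum[of x] unfolding cplx_adjop fg .
    have "adjop E f = a *\<^sub>R f - b *\<^sub>R g + bvec v" "adjop E g = a *\<^sub>R g + b *\<^sub>R f"
      using A' by (auto intro!: l2_eqI simp: cplx_def zab complex_eq_iff coord_bvec basis_vec_def split: if_splits)
    moreover have "adjop E (x - y) = adjop E x - adjop E y" for x y
      by (rule linear_diff[OF bounded_linear.linear[OF bounded_linear_adjop]])
    ultimately have "adjop E (f - u1) = a *\<^sub>R (f - u1) - b *\<^sub>R (g - u2)" "adjop E (g - u2) = a *\<^sub>R (g - u2) + b *\<^sub>R (f - u1)"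
      using eqs by (simp_all add: scaleR_diff_right)
    from resolvent_equation_unique[OF b this] have "f = u1" "g = u2" by simp_all
    then show "u' = u" by (simp add: fg u_def)
  qed
  then have "resolvent_entry V E v z = (\<Sum>\<^sub>\<infinity>x\<in>V. cnj (basis_vec v x) * u x)"
    by (simp add: resolvent_entry_def ell2_inner_def)
  also have "\<dots> = (\<Sum>\<^sub>\<infinity>x\<in>{v}. cnj (basis_vec v x) * u x)"
    by (rule infsum_cong_neutral) (use v in \<open>auto simp: basis_vec_def\<close>)
  also have "\<dots> = Complex (inner (bvec v) u1) (inner (bvec v) u2)"
    by (simp add: basis_vec_def u_def cplx_def inner_bvec)
  finally show ?thesis using val zab by simp
qed

theorem spectral_atom:
  assumes v: "v \<in> V" and M: "real D + \<bar>t\<bar> < M"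
  obtains h where "(\<lambda>n. opoly (adjop E) (kernel_poly M t ^ n) (bvec v)) \<longlonglongrightarrow> h"
    "adjop E h = t *\<^sub>R h" "\<And>f. adjop E f = t *\<^sub>R f \<Longrightarrow> inner h f = coord f v"
    "emeasure (spectral_measure V E v) {t} \<le> ennreal (coord h v)"
proof -
  obtain \<mu> where \<mu>: "real_distribution \<mu>" "AE s in \<mu>. \<bar>s\<bar> \<le> real D"
    and mom: "\<And>p. integral\<^sup>L \<mu> (poly p) = inner (bvec v) (opoly (adjop E) p (bvec v))"
    using ex_spectral_measure[OF norm_bvec] by metis
  interpret \<mu>: real_distribution \<mu> by fact
  obtain h where h: "(\<lambda>n. opoly (adjop E) (kernel_poly M t ^ n) (bvec v)) \<longlonglongrightarrow> h"
    "adjop E h = t *\<^sub>R h" "\<And>f. adjop E f = t *\<^sub>R f \<Longrightarrow> inner h f = inner (bvec v) f"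
    "inner (bvec v) h = measure \<mu> {t}"
    using kernel_projection[OF norm_bvec M \<mu> mom] by metis
  have "(THE \<nu>. prob_space \<nu> \<and> sets \<nu> = sets borel \<and>
           (\<forall>z. Im z \<noteq> 0 \<longrightarrow> resolvent_entry V E v z = (LINT \<xi>|\<nu>. 1 / (complex_of_real \<xi> - z)))) = \<mu>"
  proof (rule the_equality)
    show "prob_space \<mu> \<and> sets \<mu> = sets borel \<and>
           (\<forall>z. Im z \<noteq> 0 \<longrightarrow> resolvent_entry V E v z = (LINT \<xi>|\<mu>. 1 / (complex_of_real \<xi> - z)))"
      using resolvent_entry_eq[OF v _ \<mu> mom] \<mu>.prob_space_axioms by simp
    fix \<nu> :: "real measure" assume *: "prob_space \<nu> \<and> sets \<nu> = sets borel \<and>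
           (\<forall>z. Im z \<noteq> 0 \<longrightarrow> resolvent_entry V E v z = (LINT \<xi>|\<nu>. 1 / (complex_of_real \<xi> - z)))"
    show "\<nu> = \<mu>"
    proof (rule Stieltjes_unique)
      show "real_distribution \<nu>"
        using * by (auto simp: real_distribution_def real_distribution_axioms_def)
    qed (use * \<mu> resolvent_entry_eq[OF v _ \<mu> mom] in auto)
  qed
  \<comment> \<open>The inequality covers both branches of \<open>spectral_measure\<close>, the null
    measure having no atom.\<close>
  then have "emeasure (spectral_measure V E v) {t} \<le> emeasure \<mu> {t}"
    by (simp add: spectral_measure_def)
  also have "\<dots> = ennreal (coord h v)"
    using h(4) by (simp add: \<mu>.emeasure_eq_measure inner_bvec)
  finally show ?thesis using that h by (simp add: inner_bvec)
qed

end

section \<open>Measurability on rooted graphs and mass transport\<close>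

lemma mem_graph_ball: "y \<in> graph_ball E x r \<longleftrightarrow> (\<exists>n. real n \<le> r \<and> (x, y) \<in> E ^^ n)"
  by (simp add: graph_ball_def)

lemma graph_ball_self: "r \<ge> 0 \<Longrightarrow> x \<in> graph_ball E x r"
  unfolding mem_graph_ball by (intro exI[of _ 0]) auto

lemma graph_ball_trans:
  "y \<in> graph_ball E x r \<Longrightarrow> z \<in> graph_ball E y s \<Longrightarrow> r + s \<le> q \<Longrightarrow> z \<in> graph_ball E x q"
  unfolding mem_graph_ball
proof (elim exE conjE)
  fix m n assume "real m \<le> r" "(x, y) \<in> E ^^ m" "real n \<le> s" "(y, z) \<in> E ^^ n" "r + s \<le> q"
  then show "\<exists>n. real n \<le> q \<and> (x, z) \<in> E ^^ n"
    by (intro exI[of _ "m + n"]) (auto simp: relpow_add)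
qed

lemma graph_ball_mono: "r \<le> s \<Longrightarrow> graph_ball E x r \<subseteq> graph_ball E x s"
  by (meson mem_graph_ball order_trans subsetI)

lemma graph_iso_walk:
  assumes iso: "graph_iso \<phi> W E W' E'" and W: "graph_ball E w s \<subseteq> W"
    and "(w, z) \<in> E ^^ n" "real n \<le> s"
  shows "(\<phi> w, \<phi> z) \<in> E' ^^ n"
  using assms(3,4)
proof (induction n arbitrary: z)
  case (Suc n)
  then obtain y where y: "(w, y) \<in> E ^^ n" "(y, z) \<in> E" by auto
  have "y \<in> W" "z \<in> W"
  proof -
    have "y \<in> graph_ball E w s"
      unfolding mem_graph_ball using y(1) Suc.prems(2) by (intro exI[of _ n]) auto
    moreover have "z \<in> graph_ball E w s"
      unfolding mem_graph_ball using Suc.prems by blast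
    ultimately show "y \<in> W" "z \<in> W" using W by blast+
  qed
  then have "(\<phi> y, \<phi> z) \<in> E'" using iso y(2) by (simp add: graph_iso_def)
  then show ?case using Suc.IH[OF y(1)] Suc.prems(2) by auto
qed simp

text \<open>Distances from w up to s are realised by walks inside the ball, where \<phi> preserves
  edges; the same applies to the inverse of \<phi>, hence the two inclusion hypotheses.\<close>

lemma graph_iso_ball_image:
  assumes iso: "graph_iso \<phi> W E W' E'" and W: "graph_ball E w s \<subseteq> W"
    and W': "graph_ball E' (\<phi> w) s \<subseteq> W'" and s: "s \<ge> 0"
  shows "\<phi> ` graph_ball E w s = graph_ball E' (\<phi> w) s"
proof
  show "\<phi> ` graph_ball E w s \<subseteq> graph_ball E' (\<phi> w) s"
  proof
    fix z assume "z \<in> \<phi> ` graph_ball E w s"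
    then obtain y n where y: "z = \<phi> y" "real n \<le> s" "(w, y) \<in> E ^^ n" by (auto simp: mem_graph_ball)
    show "z \<in> graph_ball E' (\<phi> w) s"
      unfolding mem_graph_ball y(1) using y(2) graph_iso_walk[OF iso W y(3,2)] by (intro exI conjI)
  qed
  have wW: "w \<in> W" by (rule subsetD[OF W graph_ball_self[OF s]])
  show "graph_ball E' (\<phi> w) s \<subseteq> \<phi> ` graph_ball E w s"
  proof
    fix z assume z: "z \<in> graph_ball E' (\<phi> w) s"
    then obtain n where n: "real n \<le> s" "(\<phi> w, z) \<in> E' ^^ n" by (auto simp: mem_graph_ball)
    have bij: "bij_betw \<phi> W W'" using iso by (simp add: graph_iso_def)
    have "(inv_into W \<phi> (\<phi> w), inv_into W \<phi> z) \<in> E ^^ n"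
      by (rule graph_iso_walk[OF graph_iso_sym[OF iso] W' n(2,1)])
    then have "(w, inv_into W \<phi> z) \<in> E ^^ n"
      by (simp only: bij_betw_inv_into_left[OF bij wW])
    then have "inv_into W \<phi> z \<in> graph_ball E w s"
      unfolding mem_graph_ball using n(1) by blast
    moreover have "\<phi> (inv_into W \<phi> z) = z"
      using z W' by (intro bij_betw_inv_into_right[OF bij]) blast
    ultimately show "z \<in> \<phi> ` graph_ball E w s" by (metis image_eqI)
  qed
qed

lemma graph_iso_locally_agree:
  assumes iso: "graph_iso \<phi> W E W' E'"
    and W: "\<And>w. w \<in> set ws \<Longrightarrow> graph_ball E w s \<subseteq> W"
    and W': "\<And>w. w \<in> set ws \<Longrightarrow> graph_ball E' (\<phi> w) s \<subseteq> W'" and s: "s \<ge> 0"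
  shows "locally_agree E ws E' (map \<phi> ws) s"
  unfolding locally_agree_def
proof (intro exI conjI)
  have im: "\<phi> ` (\<Union>w\<in>set ws. graph_ball E w s) = (\<Union>w\<in>set (map \<phi> ws). graph_ball E' w s)"
    using graph_iso_ball_image[OF iso W W' s] by (simp add: image_UN)
  have sub: "(\<Union>w\<in>set ws. graph_ball E w s) \<subseteq> W" using W by blast
  have bij: "bij_betw \<phi> W W'" and edges: "\<And>x y. x \<in> W \<Longrightarrow> y \<in> W \<Longrightarrow> (x, y) \<in> E \<longleftrightarrow> (\<phi> x, \<phi> y) \<in> E'"
    using iso by (auto simp: graph_iso_def)
  show "graph_iso \<phi> (\<Union>w\<in>set ws. graph_ball E w s) E (\<Union>w\<in>set (map \<phi> ws). graph_ball E' w s) E'"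
    unfolding graph_iso_def
  proof (intro conjI ballI)
    fix x y assume "x \<in> (\<Union>w\<in>set ws. graph_ball E w s)" "y \<in> (\<Union>w\<in>set ws. graph_ball E w s)"
    with sub have "x \<in> W" "y \<in> W" by auto
    then show "(x, y) \<in> E \<longleftrightarrow> (\<phi> x, \<phi> y) \<in> E'" by (rule edges)
  qed (rule bij_betw_subset[OF bij sub im])
qed simp

text \<open>Roots may be exchanged for vertices within distance s of the old ones at the price of s
  in the radius. With s = 0 this selects roots, with s = r it adds a root from the ball of radius
  r.\<close>

lemma locally_agree_sub:
  assumes iso: "graph_iso \<phi> (\<Union>x\<in>set xs. graph_ball E x r) E (\<Union>x\<in>set (map \<phi> xs). graph_ball E' x r) E'"
    and ws: "\<And>w. w \<in> set ws \<Longrightarrow> \<exists>x\<in>set xs. w \<in> graph_ball E x s"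
    and s: "s \<ge> 0" "s' \<ge> 0" "s + s' \<le> r"
  shows "locally_agree E ws E' (map \<phi> ws) s'"
proof (rule graph_iso_locally_agree[OF iso _ _ s(2)])
  fix w assume "w \<in> set ws"
  then obtain x where x: "x \<in> set xs" "w \<in> graph_ball E x s" using ws by blast
  show "graph_ball E w s' \<subseteq> (\<Union>x\<in>set xs. graph_ball E x r)"
    using graph_ball_trans[OF x(2) _ s(3)] x(1) by blast
  have "graph_ball E x s \<subseteq> (\<Union>x\<in>set xs. graph_ball E x r)"
    using graph_ball_mono[of s r E x] s x(1) by fastforce
  then have "\<phi> w \<in> graph_ball E' (\<phi> x) s"
    using graph_iso_walk[OF iso] x(2) by (meson mem_graph_ball)
  then show "graph_ball E' (\<phi> w) s' \<subseteq> (\<Union>x\<in>set (map \<phi> xs). graph_ball E' x r)"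
    using graph_ball_trans[OF _ _ s(3)] x(1) by fastforce
qed

section \<open>Local functions of finitely many vertices\<close>

text \<open>The vertex set is not stored: by connectedness it is recovered from any root, see
  \<open>verts_of_eq\<close>.\<close>

definition nets :: "nat \<Rightarrow> (nat rel \<times> nat list) set" where
  "nets k = {(E, xs). length xs = k \<and> (\<exists>V. network_graph V E \<and> set xs \<subseteq> V)}"

text \<open>
  The sigma-algebra below is generated by the properties of finitely many vertices of a network that
  only depend on the balls of some radius around them.  Such properties are open in the spaces of
  rooted and doubly rooted graphs.  Working with lists of roots makes the class of measurable
  functions closed under summation over a vertex.
\<close>

definition local_on :: "nat \<Rightarrow> (nat rel \<times> nat list \<Rightarrow> 'b) \<Rightarrow> bool" where
  "local_on k f \<longleftrightarrow> (\<exists>R. \<forall>p\<in>nets k. \<forall>q\<in>nets k. \<forall>r\<ge>R.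
     locally_agree (fst p) (snd p) (fst q) (snd q) r \<longrightarrow> f p = f q)"

definition netM :: "nat \<Rightarrow> (nat rel \<times> nat list) measure" where
  "netM k = sigma (nets k) {A. A \<subseteq> nets k \<and> local_on k (\<lambda>p. p \<in> A)}"

lemma space_netM [simp]: "space (netM k) = nets k"
  unfolding netM_def by (rule space_measure_of) auto

lemma sets_netM: "sets (netM k) = sigma_sets (nets k) {A. A \<subseteq> nets k \<and> local_on k (\<lambda>p. p \<in> A)}"
  unfolding netM_def by (rule sets_measure_of) auto

lemma local_onI:
  assumes "\<And>E xs E' \<phi> r. (E, xs) \<in> nets k \<Longrightarrow> (E', map \<phi> xs) \<in> nets k \<Longrightarrow> r \<ge> R \<Longrightarrow>
     graph_iso \<phi> (\<Union>x\<in>set xs. graph_ball E x r) E (\<Union>x\<in>set (map \<phi> xs). graph_ball E' x r) E' \<Longrightarrow>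
     f (E, xs) = f (E', map \<phi> xs)"
  shows "local_on k f"
  unfolding local_on_def
proof (intro exI[of _ R] ballI allI impI)
  fix p q r assume *: "p \<in> nets k" "q \<in> nets k" "R \<le> r" "locally_agree (fst p) (snd p) (fst q) (snd q) r"
  then obtain \<phi> where "graph_iso \<phi> (\<Union>x\<in>set (snd p). graph_ball (fst p) x r) (fst p) (\<Union>x\<in>set (snd q). graph_ball (fst q) x r) (fst q)"
    "map \<phi> (snd p) = snd q" by (auto simp: locally_agree_def)
  then show "f p = f q"
    using assms[of "fst p" "snd p" "fst q" \<phi> r] * by simp
qed

lemma local_onE:
  assumes "local_on k f"
  obtains R where "R \<ge> 0" "\<And>E xs E' ys r. (E, xs) \<in> nets k \<Longrightarrow> (E', ys) \<in> nets k \<Longrightarrow> r \<ge> R \<Longrightarrow>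
     locally_agree E xs E' ys r \<Longrightarrow> f (E, xs) = f (E', ys)"
proof -
  obtain R where R: "\<forall>p\<in>nets k. \<forall>q\<in>nets k. \<forall>r\<ge>R.
     locally_agree (fst p) (snd p) (fst q) (snd q) r \<longrightarrow> f p = f q"
    using assms unfolding local_on_def by blast
  show ?thesis by (rule that[of "max R 0"]) (use R in force)+
qed

lemma local_on_comp:
  assumes "local_on k f" "\<And>p. p \<in> nets k \<Longrightarrow> g p = h (f p)"
  shows "local_on k g"
proof -
  obtain R where R: "\<forall>p\<in>nets k. \<forall>q\<in>nets k. \<forall>r\<ge>R.
     locally_agree (fst p) (snd p) (fst q) (snd q) r \<longrightarrow> f p = f q"
    using assms(1) unfolding local_on_def by blast
  show ?thesis
    unfolding local_on_def
  proof (intro exI[of _ R] ballI allI impI)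
    fix p q r assume "p \<in> nets k" "q \<in> nets k" "R \<le> r" "locally_agree (fst p) (snd p) (fst q) (snd q) r"
    then show "g p = g q" using R assms(2) by metis
  qed
qed

lemma measurable_local:
  assumes "local_on k f" "f \<in> nets k \<rightarrow> space N"
  shows "f \<in> measurable (netM k) N"
proof (rule measurableI)
  fix B assume "B \<in> sets N"
  have "local_on k (\<lambda>p. p \<in> f -` B \<inter> nets k)"
    by (rule local_on_comp[OF assms(1), of _ "\<lambda>y. y \<in> B"]) auto
  then show "f -` B \<inter> space (netM k) \<in> sets (netM k)"
    unfolding sets_netM space_netM by (intro sigma_sets.Basic) auto
qed (use assms in auto)

lemma nets_proj:
  assumes "(E, xs) \<in> nets k" "set js \<subseteq> {..<k}"
  shows "(E, map ((!) xs) js) \<in> nets (length js)"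
  using assms unfolding nets_def by (auto simp: subset_iff)

text \<open>Selecting roots keeps the radius of dependence. The indices \<open>js\<close> may be
  permuted or repeated, which is how all later reorderings of arguments are handled.\<close>

lemma measurable_proj:
  assumes js: "set js \<subseteq> {..<k}"
  shows "(\<lambda>p. (fst p, map ((!) (snd p)) js)) \<in> measurable (netM k) (netM (length js))"
  unfolding netM_def[of "length js"]
proof (rule measurable_measure_of)
  show "(\<lambda>p. (fst p, map ((!) (snd p)) js)) \<in> space (netM k) \<rightarrow> nets (length js)"
    using nets_proj[OF _ js] by auto
  fix A assume "A \<in> {A. A \<subseteq> nets (length js) \<and> local_on (length js) (\<lambda>p. p \<in> A)}"
  then obtain R where R: "R \<ge> 0" "\<And>E xs E' ys r. (E, xs) \<in> nets (length js) \<Longrightarrow> (E', ys) \<in> nets (length js) \<Longrightarrow> r \<ge> R \<Longrightarrow>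
     locally_agree E xs E' ys r \<Longrightarrow> (E, xs) \<in> A \<longleftrightarrow> (E', ys) \<in> A"
    by (auto elim!: local_onE)
  let ?f = "\<lambda>p::nat rel \<times> nat list. (fst p, map ((!) (snd p)) js)"
  have "local_on k (\<lambda>p. ?f p \<in> A)"
  proof (rule local_onI[of _ R])
    fix E xs E' \<phi> r
    assume *: "(E, xs) \<in> nets k" "(E', map \<phi> xs) \<in> nets k" "r \<ge> R"
      and iso: "graph_iso \<phi> (\<Union>x\<in>set xs. graph_ball E x r) E (\<Union>x\<in>set (map \<phi> xs). graph_ball E' x r) E'"
    have len: "length xs = k" using * by (simp add: nets_def)
    have "locally_agree E (map ((!) xs) js) E' (map \<phi> (map ((!) xs) js)) r"
      by (rule locally_agree_sub[OF iso, of _ 0])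
         (use R(1) *(3) js len in \<open>auto intro!: bexI[of _ "xs ! _"] graph_ball_self\<close>)
    moreover have "map \<phi> (map ((!) xs) js) = map ((!) (map \<phi> xs)) js"
      using js len by auto
    ultimately have la: "locally_agree E (map ((!) xs) js) E' (map ((!) (map \<phi> xs)) js) r"
      by (simp only:)
    show "(?f (E, xs) \<in> A) = (?f (E', map \<phi> xs) \<in> A)"
      unfolding fst_conv snd_conv
      by (rule R(2)[OF nets_proj[OF *(1) js] nets_proj[OF *(2) js] *(3) la])
  qed
  then have "local_on k (\<lambda>p. p \<in> ?f -` A \<inter> nets k)"
    by (rule local_on_comp[of _ _ _ "\<lambda>y. y"]) auto
  then show "?f -` A \<inter> space (netM k) \<in> sets (netM k)"
    unfolding sets_netM space_netM by (intro sigma_sets.Basic) auto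
qed auto

lemma pred_adjacent:
  assumes "i < k" "j < k"
  shows "Measurable.pred (netM k) (\<lambda>p. (snd p ! i, snd p ! j) \<in> fst p)"
proof (rule measurable_local)
  show "local_on k (\<lambda>p. (snd p ! i, snd p ! j) \<in> fst p)"
  proof (rule local_onI[of _ 0])
    fix E xs E' \<phi> and r :: real
    assume *: "(E, xs) \<in> nets k" "(E', map \<phi> xs) \<in> nets k" "r \<ge> 0"
      and iso: "graph_iso \<phi> (\<Union>x\<in>set xs. graph_ball E x r) E (\<Union>x\<in>set (map \<phi> xs). graph_ball E' x r) E'"
    have len: "length xs = k" using * by (simp add: nets_def)
    then have mem: "xs ! l \<in> (\<Union>x\<in>set xs. graph_ball E x r)" if "l < k" for l
      using that graph_ball_self[OF *(3)] by force
    have "\<forall>x\<in>\<Union>x\<in>set xs. graph_ball E x r. \<forall>y\<in>\<Union>x\<in>set xs. graph_ball E x r.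
        (x, y) \<in> E \<longleftrightarrow> (\<phi> x, \<phi> y) \<in> E'"
      using iso unfolding graph_iso_def by (elim conjE)
    from bspec[OF bspec[OF this mem[OF assms(1)]] mem[OF assms(2)]]
    have "(xs ! i, xs ! j) \<in> E \<longleftrightarrow> (\<phi> (xs ! i), \<phi> (xs ! j)) \<in> E'" .
    then show "((snd (E, xs) ! i, snd (E, xs) ! j) \<in> fst (E, xs)) =
      ((snd (E', map \<phi> xs) ! i, snd (E', map \<phi> xs) ! j) \<in> fst (E', map \<phi> xs))"
      using assms len by simp
  qed
qed auto

lemma pred_equal:
  assumes "i < k" "j < k"
  shows "Measurable.pred (netM k) (\<lambda>p. snd p ! i = snd p ! j)"
proof (rule measurable_local)
  show "local_on k (\<lambda>p. snd p ! i = snd p ! j)"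
  proof (rule local_onI[of _ 0])
    fix E xs E' \<phi> and r :: real
    assume *: "(E, xs) \<in> nets k" "(E', map \<phi> xs) \<in> nets k" "r \<ge> 0"
      and iso: "graph_iso \<phi> (\<Union>x\<in>set xs. graph_ball E x r) E (\<Union>x\<in>set (map \<phi> xs). graph_ball E' x r) E'"
    have len: "length xs = k" using * by (simp add: nets_def)
    then have mem: "xs ! l \<in> (\<Union>x\<in>set xs. graph_ball E x r)" if "l < k" for l
      using that graph_ball_self[OF *(3)] by force
    have "inj_on \<phi> (\<Union>x\<in>set xs. graph_ball E x r)"
      using iso unfolding graph_iso_def bij_betw_def by (elim conjE)
    from inj_on_eq_iff[OF this mem[OF assms(1)] mem[OF assms(2)]]
    have "xs ! i = xs ! j \<longleftrightarrow> \<phi> (xs ! i) = \<phi> (xs ! j)" ..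
    then show "(snd (E, xs) ! i = snd (E, xs) ! j) = (snd (E', map \<phi> xs) ! i = snd (E', map \<phi> xs) ! j)"
      using assms len by simp
  qed
qed auto

lemma finite_graph_ball:
  assumes "network_graph V E" "x \<in> V"
  shows "finite (graph_ball E x r)" "graph_ball E x r \<subseteq> V"
proof -
  have E: "E \<subseteq> V \<times> V" "\<And>x. x \<in> V \<Longrightarrow> finite (E `` {x})"
    using assms by (auto simp: network_graph_def simple_graph_def locally_finite_graph_def)
  have fin: "finite ((E ^^ n) `` {x}) \<and> (E ^^ n) `` {x} \<subseteq> V" for n
  proof (induction n)
    case (Suc n)
    have "(E ^^ Suc n) `` {x} = (\<Union>y\<in>(E ^^ n) `` {x}. E `` {y})" by auto
    then show ?case using Suc E by auto
  qed (use assms in auto)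
  have "graph_ball E x r \<subseteq> (\<Union>n\<le>nat \<lfloor>r\<rfloor>. (E ^^ n) `` {x})"
    by (auto simp: mem_graph_ball intro!: bexI le_nat_floor)
  then show "finite (graph_ball E x r)" "graph_ball E x r \<subseteq> V"
    using fin by (auto intro: finite_subset)
qed

lemma nets_Cons:
  assumes "(E, xs) \<in> nets k" "k > 0" "z \<in> graph_ball E (hd xs) r"
  shows "(E, z # xs) \<in> nets (Suc k)"
proof -
  obtain V where V: "network_graph V E" "set xs \<subseteq> V" "length xs = k"
    using assms(1) by (auto simp: nets_def)
  then have "hd xs \<in> V" using assms(2) by (cases xs) auto
  then have "z \<in> V" using finite_graph_ball(2)[OF V(1)] assms(3) by blast
  then show ?thesis using V by (auto simp: nets_def)
qed

text \<open>Confining the new root to a ball keeps the sum finite and its value local; the sum over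
  all vertices is recovered as a supremum over r.\<close>

definition ball_sum :: "nat \<Rightarrow> (nat rel \<times> nat list \<Rightarrow> ennreal) \<Rightarrow> nat rel \<times> nat list \<Rightarrow> ennreal" where
  "ball_sum r f p = (\<integral>\<^sup>+z. f (fst p, z # snd p) \<partial>count_space (graph_ball (fst p) (hd (snd p)) r))"

text \<open>If f reads radius R, its sum reads radius r + R: agreement at that radius maps the
  r-ball around the first root bijectively and still covers the R-balls around all of its
  points.\<close>

lemma measurable_ball_sum_local:
  assumes f: "local_on (Suc k) f" and k: "k > 0"
  shows "ball_sum r f \<in> borel_measurable (netM k)"
proof (rule measurable_local)
  obtain R where R: "R \<ge> 0" "\<And>E xs E' ys r. (E, xs) \<in> nets (Suc k) \<Longrightarrow> (E', ys) \<in> nets (Suc k) \<Longrightarrow> r \<ge> R \<Longrightarrow>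
     locally_agree E xs E' ys r \<Longrightarrow> f (E, xs) = f (E', ys)"
    using f by (auto elim!: local_onE)
  show "local_on k (ball_sum r f)"
  proof (rule local_onI[of _ "real r + R"])
    fix E xs E' \<phi> q
    assume *: "(E, xs) \<in> nets k" "(E', map \<phi> xs) \<in> nets k" "q \<ge> real r + R"
      and iso: "graph_iso \<phi> (\<Union>x\<in>set xs. graph_ball E x q) E (\<Union>x\<in>set (map \<phi> xs). graph_ball E' x q) E'"
    have len: "length xs = k" using * by (simp add: nets_def)
    then have ne: "xs \<noteq> []" using k by auto
    then have hd: "hd xs \<in> set xs" by simp
    have sub: "graph_ball E (hd xs) (real r) \<subseteq> (\<Union>x\<in>set xs. graph_ball E x q)"
      using hd graph_ball_mono[of r q E] *(3) R(1) by force
    have sub': "graph_ball E' (\<phi> (hd xs)) (real r) \<subseteq> (\<Union>x\<in>set (map \<phi> xs). graph_ball E' x q)"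
      using hd graph_ball_mono[of r q E'] *(3) R(1) by force
    have im: "\<phi> ` graph_ball E (hd xs) r = graph_ball E' (\<phi> (hd xs)) r"
      by (rule graph_iso_ball_image[OF iso sub sub']) simp
    have bij: "bij_betw \<phi> (graph_ball E (hd xs) r) (graph_ball E' (hd (map \<phi> xs)) r)"
      using iso sub im ne by (auto simp: graph_iso_def hd_map intro: bij_betw_subset)
    have "ball_sum r f (E, xs) = (\<integral>\<^sup>+z. f (E', \<phi> z # map \<phi> xs) \<partial>count_space (graph_ball E (hd xs) r))"
      unfolding ball_sum_def fst_conv snd_conv
    proof (rule nn_integral_cong)
      fix z assume "z \<in> space (count_space (graph_ball E (hd xs) (real r)))"
      then have z: "z \<in> graph_ball E (hd xs) r" by simp
      have "\<exists>x\<in>set xs. w \<in> graph_ball E x r" if "w \<in> set (z # xs)" for w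
        using that z hd graph_ball_self[of r w E] by auto
      then have "locally_agree E (z # xs) E' (map \<phi> (z # xs)) R"
        by (rule locally_agree_sub[OF iso, of _ r]) (use R(1) *(3) in auto)
      moreover have "(E', \<phi> z # map \<phi> xs) \<in> nets (Suc k)"
        by (rule nets_Cons[OF *(2) k, of _ r]) (use z im ne in \<open>auto simp: hd_map\<close>)
      ultimately show "f (E, z # xs) = f (E', \<phi> z # map \<phi> xs)"
        by (intro R(2)[OF nets_Cons[OF *(1) k z] _ order_refl]) simp_all
    qed
    also have "\<dots> = ball_sum r f (E', map \<phi> xs)"
      unfolding ball_sum_def fst_conv snd_conv by (rule nn_integral_bij_count_space[OF bij])
    finally show "ball_sum r f (E, xs) = ball_sum r f (E', map \<phi> xs)" .
  qed
qed simp

lemma ball_sum_cong: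
  assumes "\<And>q. q \<in> nets (Suc k) \<Longrightarrow> f q = g q" "p \<in> nets k" "k > 0"
  shows "ball_sum r f p = ball_sum r g p"
  unfolding ball_sum_def
proof (rule nn_integral_cong)
  fix z assume "z \<in> space (count_space (graph_ball (fst p) (hd (snd p)) (real r)))"
  then have z: "z \<in> graph_ball (fst p) (hd (snd p)) (real r)" by simp
  have p: "(fst p, snd p) \<in> nets k" using assms(2) by simp
  show "f (fst p, z # snd p) = g (fst p, z # snd p)"
    by (rule assms(1)[OF nets_Cons[OF p assms(3) z]])
qed

text \<open>Extends the local case to all measurable f. Local sets are stable under intersection, so
  Dynkin's theorem handles indicators, and linearity with monotone limits handles the rest.\<close>

lemma measurable_ball_sum:
  assumes f: "f \<in> borel_measurable (netM (Suc k))" and k: "k > 0"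
  shows "ball_sum r f \<in> borel_measurable (netM k)"
  using f
proof (induction rule: borel_measurable_induct)
  case (cong f g)
  have "ball_sum r f p = ball_sum r g p" if "p \<in> nets k" for p
    by (rule ball_sum_cong[OF _ that k]) (use cong(3) in simp)
  then have "ball_sum r f \<in> borel_measurable (netM k) \<longleftrightarrow> ball_sum r g \<in> borel_measurable (netM k)"
    by (intro measurable_cong) simp
  then show ?case using cong(4) by simp
next
  case (set A)
  let ?G = "{A. A \<subseteq> nets (Suc k) \<and> local_on (Suc k) (\<lambda>p. p \<in> A)}"
  have "Int_stable ?G"
  proof (rule Int_stableI)
    fix A B assume A: "A \<in> ?G" and B: "B \<in> ?G"
    have "local_on (Suc k) (\<lambda>p. p \<in> A \<inter> B)"
    proof -
      obtain R where R: "\<forall>p\<in>nets (Suc k). \<forall>q\<in>nets (Suc k). \<forall>r\<ge>R.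
        locally_agree (fst p) (snd p) (fst q) (snd q) r \<longrightarrow> (p \<in> A) = (q \<in> A)"
        using A unfolding local_on_def by blast
      obtain R' where R': "\<forall>p\<in>nets (Suc k). \<forall>q\<in>nets (Suc k). \<forall>r\<ge>R'.
        locally_agree (fst p) (snd p) (fst q) (snd q) r \<longrightarrow> (p \<in> B) = (q \<in> B)"
        using B unfolding local_on_def by blast
      show ?thesis unfolding local_on_def by (rule exI[of _ "max R R'"]) (use R R' in auto)
    qed
    then show "A \<inter> B \<in> ?G" using A by auto
  qed
  moreover have "?G \<subseteq> Pow (nets (Suc k))" by auto
  moreover have "A \<in> sigma_sets (nets (Suc k)) ?G" using set sets_netM by blast
  ultimately show ?case
  proof (induction rule: sigma_sets_induct_disjoint)
    case (basic A)
    then have "local_on (Suc k) (\<lambda>p. p \<in> A)" by simp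
    then have "local_on (Suc k) (indicator A :: _ \<Rightarrow> ennreal)"
      by (rule local_on_comp[of _ _ _ "\<lambda>b. if b then 1 else 0"]) (simp add: indicator_def)
    then show ?case by (intro measurable_ball_sum_local k)
  next
    case empty
    then show ?case by (simp add: ball_sum_def[abs_def])
  next
    \<comment> \<open>Subtraction in \<open>ennreal\<close> is legitimate because balls in a locally
      finite graph are finite.\<close>
    case (compl A)
    have "ball_sum r (indicator (nets (Suc k) - A)) p = ball_sum r (\<lambda>_. 1) p - ball_sum r (indicator A) p"
      if p: "p \<in> nets k" for p
    proof -
      obtain V where V: "network_graph V (fst p)" "set (snd p) \<subseteq> V" "length (snd p) = k"
        using p by (cases p) (auto simp: nets_def)
      then have "hd (snd p) \<in> V" using k by (cases "snd p") auto
      then have fin: "finite (graph_ball (fst p) (hd (snd p)) r)" using finite_graph_ball(1)[OF V(1)] by blast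
      have "ball_sum r (indicator (nets (Suc k) - A)) p = ball_sum r (\<lambda>q. 1 - indicator A q) p"
        by (rule ball_sum_cong[OF _ p k]) (auto simp: indicator_def)
      also have "\<dots> = ball_sum r (\<lambda>_. 1) p - ball_sum r (indicator A) p"
        unfolding ball_sum_def using fin
        by (subst nn_integral_diff)
           (auto simp: nn_integral_count_space_finite indicator_def ennreal_of_nat_eq_real_of_nat[symmetric] of_nat_less_top)
      finally show ?thesis .
    qed
    moreover have "(\<lambda>p. ball_sum r (\<lambda>_. 1) p - ball_sum r (indicator A) p) \<in> borel_measurable (netM k)"
      by (intro borel_measurable_minus_ennreal compl measurable_ball_sum_local k) (auto simp: local_on_def)
    ultimately show ?case
      using measurable_cong[of "netM k" "ball_sum r (indicator (nets (Suc k) - A))"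
          "\<lambda>p. ball_sum r (\<lambda>_. 1) p - ball_sum r (indicator A) p" borel] by simp
  next
    case (union A)
    have "ball_sum r (indicator (\<Union>i. A i)) p = (\<Sum>i. ball_sum r (indicator (A i)) p)" for p
      unfolding ball_sum_def suminf_indicator[OF union(1), symmetric]
      by (rule nn_integral_suminf) simp
    then show ?case using union by simp
  qed
next
  case (mult u c)
  have "ball_sum r (\<lambda>x. c * u x) p = c * ball_sum r u p" for p
    unfolding ball_sum_def by (rule nn_integral_cmult) simp
  then show ?case using mult by simp
next
  case (add u v)
  have "ball_sum r (\<lambda>x. v x + u x) p = ball_sum r v p + ball_sum r u p" for p
    unfolding ball_sum_def by (rule nn_integral_add) auto
  then show ?case using add by simp
next
  case (seq U)
  have "ball_sum r (SUP i. U i) p = (SUP i. ball_sum r (U i) p)" for p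
    unfolding ball_sum_def using \<open>incseq U\<close>
    by (subst nn_integral_monotone_convergence_SUP[symmetric])
       (auto simp: image_comp incseq_def le_fun_def)
  then have eq: "ball_sum r (SUP i. U i) = (\<lambda>p. SUP i. ball_sum r (U i) p)" by (rule ext)
  show ?case unfolding eq by (intro borel_measurable_SUP) (use seq in auto)
qed

section \<open>Sums over all vertices and invariance under isomorphism\<close>

definition verts_of :: "nat rel \<Rightarrow> nat \<Rightarrow> nat set" where
  "verts_of E x = E\<^sup>* `` {x}"

lemma verts_of_eq:
  assumes "network_graph V E" "x \<in> V"
  shows "verts_of E x = V"
proof
  have E: "E \<subseteq> V \<times> V" using assms by (auto simp: network_graph_def simple_graph_def)
  have "(x, y) \<in> E\<^sup>* \<Longrightarrow> y \<in> V" for y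
    by (induction rule: rtrancl_induct) (use assms E in auto)
  then show "verts_of E x \<subseteq> V" by (auto simp: verts_of_def)
  show "V \<subseteq> verts_of E x"
    using assms by (auto simp: network_graph_def graph_connected_def verts_of_def)
qed

lemma verts_of_eq_balls: "verts_of E x = (\<Union>r::nat. graph_ball E x r)"
proof (rule Set.set_eqI)
  fix y
  have "y \<in> verts_of E x \<longleftrightarrow> (\<exists>n. (x, y) \<in> E ^^ n)"
    by (simp add: verts_of_def rtrancl_power)
  also have "\<dots> \<longleftrightarrow> (\<exists>r::nat. y \<in> graph_ball E x r)"
  proof
    assume "\<exists>n. (x, y) \<in> E ^^ n"
    then obtain n where "(x, y) \<in> E ^^ n" ..
    then have "y \<in> graph_ball E x (real n)" unfolding mem_graph_ball by (intro exI[of _ n] conjI order_refl)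
    then show "\<exists>r::nat. y \<in> graph_ball E x r" ..
  next
    assume "\<exists>r::nat. y \<in> graph_ball E x r"
    then show "\<exists>n. (x, y) \<in> E ^^ n" unfolding mem_graph_ball by (elim exE conjE) (rule exI)
  qed
  finally show "y \<in> verts_of E x \<longleftrightarrow> y \<in> (\<Union>r::nat. graph_ball E x r)" by simp
qed

text \<open>By connectedness the balls around the first root exhaust the vertices; monotone
  convergence does the rest.\<close>

lemma measurable_verts_sum:
  assumes f: "f \<in> borel_measurable (netM (Suc k))" and k: "k > 0"
  shows "(\<lambda>p. \<integral>\<^sup>+z. f (fst p, z # snd p) \<partial>count_space (verts_of (fst p) (hd (snd p)))) \<in> borel_measurable (netM k)"
proof -
  have "(\<integral>\<^sup>+z. f (fst p, z # snd p) \<partial>count_space (verts_of (fst p) (hd (snd p)))) = (SUP r. ball_sum r f p)" for p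
  proof -
    let ?B = "\<lambda>r::nat. graph_ball (fst p) (hd (snd p)) r"
    have inc: "incseq (\<lambda>r z. f (fst p, z # snd p) * indicator (?B r) z)"
      unfolding incseq_def le_fun_def
    proof (intro allI impI)
      fix m n :: nat and z assume "m \<le> n"
      then have "?B m \<subseteq> ?B n" by (intro graph_ball_mono) simp
      then have "indicator (?B m) z \<le> (indicator (?B n) z :: ennreal)" by (auto simp: indicator_def)
      then show "f (fst p, z # snd p) * indicator (?B m) z \<le> f (fst p, z # snd p) * indicator (?B n) z"
        by (intro mult_left_mono) auto
    qed
    have "(SUP r. ball_sum r f p) = (SUP r. \<integral>\<^sup>+z. f (fst p, z # snd p) * indicator (?B r) z \<partial>count_space UNIV)"
      unfolding ball_sum_def by (subst nn_integral_count_space_indicator) auto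
    also have "\<dots> = (\<integral>\<^sup>+z. (SUP r. f (fst p, z # snd p) * indicator (?B r) z) \<partial>count_space UNIV)"
      by (rule nn_integral_monotone_convergence_SUP[symmetric]) (use inc in auto)
    also have "\<dots> = (\<integral>\<^sup>+z. f (fst p, z # snd p) * indicator (verts_of (fst p) (hd (snd p))) z \<partial>count_space UNIV)"
    proof (rule nn_integral_cong)
      fix z
      show "(SUP r. f (fst p, z # snd p) * indicator (?B r) z) = f (fst p, z # snd p) * indicator (verts_of (fst p) (hd (snd p))) z"
      proof (cases "z \<in> verts_of (fst p) (hd (snd p))")
        case True
        then obtain r where "z \<in> ?B r" unfolding verts_of_eq_balls by blast
        then show ?thesis using True
          by (intro antisym SUP_least SUP_upper2[of r]) (auto simp: indicator_def)
      next
        case False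
        then show ?thesis unfolding verts_of_eq_balls by (simp add: image_constant_conv)
      qed
    qed
    finally show ?thesis by (subst nn_integral_count_space_indicator) auto
  qed
  then show ?thesis using measurable_ball_sum[OF f k] by simp
qed

text \<open>An existential over vertices is the nonvanishing of a sum of indicators.\<close>

lemma pred_verts_ex:
  assumes f: "Measurable.pred (netM (Suc k)) Q" and k: "k > 0"
  shows "Measurable.pred (netM k) (\<lambda>p. \<exists>z\<in>verts_of (fst p) (hd (snd p)). Q (fst p, z # snd p))"
proof -
  have "(\<lambda>p. if Q p then 1 else 0 :: ennreal) \<in> borel_measurable (netM (Suc k))"
    using f by measurable
  from measurable_verts_sum[OF this k]
  have [measurable]: "(\<lambda>p. \<integral>\<^sup>+z. (if Q (fst p, z # snd p) then 1 else 0) \<partial>count_space (verts_of (fst p) (hd (snd p)))) \<in> borel_measurable (netM k)" .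
  have eq: "(\<exists>z\<in>verts_of (fst p) (hd (snd p)). Q (fst p, z # snd p)) \<longleftrightarrow>
    (\<integral>\<^sup>+z. (if Q (fst p, z # snd p) then 1 else 0 :: ennreal) \<partial>count_space (verts_of (fst p) (hd (snd p)))) \<noteq> 0" for p
    by (subst nn_integral_0_iff_AE) (auto simp: AE_count_space)
  show ?thesis unfolding eq by measurable
qed

text \<open>An isomorphism of whole networks yields agreement at every radius, so no local set
  separates its two sides; this passes to the generated sigma-algebra.\<close>

lemma sets_netM_iso:
  assumes B: "B \<in> sets (netM k)" and V: "network_graph V E" "network_graph V' E'"
    and iso: "graph_iso \<phi> V E V' E'" and xs: "set xs \<subseteq> V" "length xs = k"
  shows "(E, xs) \<in> B \<longleftrightarrow> (E', map \<phi> xs) \<in> B"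
proof -
  have \<phi>: "\<phi> x \<in> V'" if "x \<in> V" for x using iso that by (auto simp: graph_iso_def dest: bij_betwE)
  have n: "(E, xs) \<in> nets k" "(E', map \<phi> xs) \<in> nets k"
    using V xs \<phi> by (auto simp: nets_def)
  from B have "B \<in> sigma_sets (nets k) {A. A \<subseteq> nets k \<and> local_on k (\<lambda>p. p \<in> A)}" by (simp add: sets_netM)
  then show ?thesis
  proof (induction rule: sigma_sets.induct)
    case (Basic A)
    then have "local_on k (\<lambda>p. p \<in> A)" by simp
    then obtain R where R: "R \<ge> 0" "\<And>E xs E' ys r. (E, xs) \<in> nets k \<Longrightarrow> (E', ys) \<in> nets k \<Longrightarrow> r \<ge> R \<Longrightarrow>
       locally_agree E xs E' ys r \<Longrightarrow> (E, xs) \<in> A \<longleftrightarrow> (E', ys) \<in> A"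
      by (rule local_onE) blast
    have "locally_agree E xs E' (map \<phi> xs) R"
    proof (rule graph_iso_locally_agree[OF iso _ _ R(1)])
      fix w assume "w \<in> set xs"
      then have w: "w \<in> V" using xs by auto
      show "graph_ball E w R \<subseteq> V" by (rule finite_graph_ball(2)[OF V(1) w])
      show "graph_ball E' (\<phi> w) R \<subseteq> V'" by (rule finite_graph_ball(2)[OF V(2) \<phi>[OF w]])
    qed
    then show ?case by (rule R(2)[OF n order_refl])
  qed (use n in auto)
qed

text \<open>Points of a T1 space are closed, so the fibre through a network is measurable and hence
  isomorphism-invariant.\<close>

lemma borel_netM_iso:
  fixes f :: "_ \<Rightarrow> 'b :: t1_space"
  assumes f: "f \<in> borel_measurable (netM k)" and V: "network_graph V E" "network_graph V' E'"
    and iso: "graph_iso \<phi> V E V' E'" and xs: "set xs \<subseteq> V" "length xs = k"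
  shows "f (E', map \<phi> xs) = f (E, xs)"
proof -
  let ?B = "f -` {f (E, xs)} \<inter> space (netM k)"
  have "?B \<in> sets (netM k)" using f by (rule measurable_sets) simp
  moreover have "(E, xs) \<in> ?B" using V xs by (auto simp: nets_def)
  ultimately have "(E', map \<phi> xs) \<in> ?B" using sets_netM_iso[OF _ V iso xs] by blast
  then show ?thesis by simp
qed

section \<open>Rooted graphs as networks, and the mass transport principle\<close>

lemma rg_network: "network_graph (rg_verts g) (rg_edges g)" "rg_root g \<in> rg_verts g"
  using Quotient3_rep_reflp[OF Quotient3_rooted_graph, of g]
  by (auto simp: rg_verts_def rg_edges_def rg_root_def rooted_iso_def split: prod.splits)

definition rg_net :: "rooted_graph \<Rightarrow> nat rel \<times> nat list" where
  "rg_net g = (rg_edges g, [rg_root g])"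

definition drg_net :: "doubly_rooted_graph \<Rightarrow> nat rel \<times> nat list" where
  "drg_net d = (case rep_doubly_rooted_graph d of (V, E, x, y) \<Rightarrow> (E, [x, y]))"

lemma rg_net_in: "rg_net g \<in> nets 1"
  unfolding rg_net_def nets_def using rg_network[of g] by auto

lemma drg_net_in: "drg_net d \<in> nets 2"
proof -
  obtain V E x y where r: "rep_doubly_rooted_graph d = (V, E, x, y)" by (rule prod_cases4)
  have "doubly_rooted_iso (V, E, x, y) (V, E, x, y)"
    using Quotient3_rep_reflp[OF Quotient3_doubly_rooted_graph, of d] unfolding r .
  then have "network_graph V E" "x \<in> V" "y \<in> V" by (simp_all add: doubly_rooted_iso_iff)
  then show ?thesis unfolding drg_net_def r nets_def by auto
qed

text \<open>The supremum S in the distance may be infinite or unattained, but the strict bound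
  forces S > R, and then some radius of agreement exceeds R.\<close>

lemma local_distance_less:
  assumes less: "local_distance E xs E' ys < 1 / (1 + R)" and R: "R \<ge> 0"
  shows "\<exists>r\<ge>R. locally_agree E xs E' ys r"
proof -
  define S where "S = (SUP r\<in>{r. 0 \<le> r \<and> locally_agree E xs E' ys r}. ennreal r)"
  have "S > ennreal R"
  proof (rule ccontr)
    assume "\<not> ennreal R < S"
    then have S: "S \<le> ennreal R" by simp
    then obtain s where s: "S = ennreal s" "0 \<le> s" "s \<le> R"
      using R by (cases S) (auto simp: top_unique ennreal_le_iff)
    have "1 + S = ennreal (1 + s)" using s by simp
    then have "1 / (1 + S) = ennreal (1 / (1 + s))"
      using divide_ennreal[of 1 "1 + s"] s(2) by simp
    then have "local_distance E xs E' ys = 1 / (1 + s)"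
      unfolding local_distance_def S_def[symmetric] using s(2) by simp
    moreover have "1 / (1 + s) \<ge> 1 / (1 + R)" using s by (intro frac_le) auto
    ultimately show False using less by linarith
  qed
  then obtain r where r: "0 \<le> r" "locally_agree E xs E' ys r" "ennreal R < ennreal r"
    unfolding S_def less_SUP_iff by blast
  then have "R < r" using R by (simp add: ennreal_less_iff)
  then show ?thesis using r(2) by (intro exI[of _ r]) simp
qed

lemma measurable_rg_net: "rg_net \<in> measurable borel (netM 1)"
  unfolding netM_def
proof (rule measurable_measure_of)
  fix A assume "A \<in> {A. A \<subseteq> nets 1 \<and> local_on 1 (\<lambda>p. p \<in> A)}"
  then have "local_on 1 (\<lambda>p. p \<in> A)" by simp
  then obtain R where R: "R \<ge> 0" "\<And>E xs E' ys r. (E, xs) \<in> nets 1 \<Longrightarrow> (E', ys) \<in> nets 1 \<Longrightarrow> r \<ge> R \<Longrightarrow>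
       locally_agree E xs E' ys r \<Longrightarrow> (E, xs) \<in> A \<longleftrightarrow> (E', ys) \<in> A"
    by (rule local_onE) blast
  have "open (rg_net -` A)"
    unfolding open_rooted_graph_def
  proof (intro ballI exI conjI allI impI)
    fix g h assume g: "g \<in> rg_net -` A" and d: "rg_dist g h < 1 / (1 + R)"
    obtain r where r: "r \<ge> R" "locally_agree (rg_edges g) [rg_root g] (rg_edges h) [rg_root h] r"
      using local_distance_less[OF d[unfolded rg_dist_def] R(1)] by blast
    have "rg_net g \<in> A \<longleftrightarrow> rg_net h \<in> A"
      unfolding rg_net_def
      by (rule R(2)[OF _ _ r]) (use rg_net_in[of g] rg_net_in[of h] in \<open>simp_all add: rg_net_def\<close>)
    then show "h \<in> rg_net -` A" using g by simp
  qed (use R(1) in simp)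
  then show "rg_net -` A \<inter> space borel \<in> sets borel" by simp
qed (use rg_net_in in auto)

lemma measurable_drg_net: "drg_net \<in> measurable borel (netM 2)"
  unfolding netM_def
proof (rule measurable_measure_of)
  fix A assume "A \<in> {A. A \<subseteq> nets 2 \<and> local_on 2 (\<lambda>p. p \<in> A)}"
  then have "local_on 2 (\<lambda>p. p \<in> A)" by simp
  then obtain R where R: "R \<ge> 0" "\<And>E xs E' ys r. (E, xs) \<in> nets 2 \<Longrightarrow> (E', ys) \<in> nets 2 \<Longrightarrow> r \<ge> R \<Longrightarrow>
       locally_agree E xs E' ys r \<Longrightarrow> (E, xs) \<in> A \<longleftrightarrow> (E', ys) \<in> A"
    by (rule local_onE) blast
  have "open (drg_net -` A)"
    unfolding open_doubly_rooted_graph_def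
  proof (intro ballI exI conjI allI impI)
    fix g h assume g: "g \<in> drg_net -` A" and d: "drg_dist g h < 1 / (1 + R)"
    obtain V E x y where rg: "rep_doubly_rooted_graph g = (V, E, x, y)" by (rule prod_cases4)
    obtain V' E' x' y' where rh: "rep_doubly_rooted_graph h = (V', E', x', y')" by (rule prod_cases4)
    have d': "local_distance E [x, y] E' [x', y'] < 1 / (1 + R)"
      using d by (simp add: drg_dist_def rg rh)
    obtain r where r: "r \<ge> R" "locally_agree E [x, y] E' [x', y'] r"
      using local_distance_less[OF d' R(1)] by blast
    have "drg_net g \<in> A \<longleftrightarrow> drg_net h \<in> A"
      unfolding drg_net_def rg rh prod.case
      by (rule R(2)[OF _ _ r]) (use drg_net_in[of g] drg_net_in[of h] in \<open>simp_all add: drg_net_def rg rh\<close>)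
    then show "h \<in> drg_net -` A" using g by simp
  qed (use R(1) in simp)
  then show "drg_net -` A \<inter> space borel \<in> sets borel" by simp
qed (use drg_net_in in auto)

text \<open>\<open>with_two_roots\<close> passes through the quotient, whose representative may be
  another graph than that of g; invariance under isomorphism absorbs the change.\<close>

lemma drg_net_with_two_roots:
  fixes f :: "_ \<Rightarrow> 'b :: t1_space"
  assumes f: "f \<in> borel_measurable (netM 2)" and xy: "x \<in> rg_verts g" "y \<in> rg_verts g"
  shows "f (drg_net (with_two_roots g x y)) = f (rg_edges g, [x, y])"
proof -
  let ?t = "(rg_verts g, rg_edges g, x, y)"
  have "doubly_rooted_iso ?t ?t"
    using xy rg_network[of g] by (auto simp: doubly_rooted_iso_iff intro: exI[of _ id] graph_iso_id)
  then have iso: "doubly_rooted_iso (rep_doubly_rooted_graph (with_two_roots g x y)) ?t"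
    unfolding with_two_roots_def by (rule Quotient3_rep_abs[OF Quotient3_doubly_rooted_graph])
  obtain V E x' y' where r: "rep_doubly_rooted_graph (with_two_roots g x y) = (V, E, x', y')" by (rule prod_cases4)
  obtain \<phi> where \<phi>: "network_graph V E" "x' \<in> V" "y' \<in> V" "network_graph (rg_verts g) (rg_edges g)"
    "graph_iso \<phi> V E (rg_verts g) (rg_edges g)" "\<phi> x' = x" "\<phi> y' = y"
    using iso unfolding r doubly_rooted_iso_iff by blast
  have "f (rg_edges g, map \<phi> [x', y']) = f (E, [x', y'])"
    by (rule borel_netM_iso[OF f \<phi>(1,4,5)]) (use \<phi> in auto)
  then show ?thesis using \<phi> by (simp add: drg_net_def r)
qed

lemma infsum_ennreal_eq_nn_integral:
  fixes f :: "nat \<Rightarrow> ennreal"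
  shows "(\<Sum>\<^sub>\<infinity>x\<in>A. f x) = (\<integral>\<^sup>+x. f x \<partial>count_space A)"
proof -
  let ?g = "\<lambda>x. f x * indicator A x"
  have "(\<Sum>\<^sub>\<infinity>x\<in>A. f x) = (\<Sum>\<^sub>\<infinity>x\<in>UNIV. ?g x)"
    by (rule infsum_cong_neutral) auto
  also have "(?g has_sum (\<Sum>\<^sub>\<infinity>x\<in>UNIV. ?g x)) UNIV"
    by (intro has_sum_infsum nonneg_summable_on_complete) simp
  then have "(\<Sum>\<^sub>\<infinity>x\<in>UNIV. ?g x) = (\<Sum>x. ?g x)"
    by (intro sums_unique has_sum_imp_sums)
  also have "\<dots> = (\<integral>\<^sup>+x. ?g x \<partial>count_space UNIV)"
    by (rule nn_integral_count_space_nat[symmetric])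
  finally show ?thesis by (simp add: nn_integral_count_space_indicator)
qed

text \<open>Unimodularity restated for functions of concrete networks, the form in which all
  transports are built.\<close>

theorem mass_transport:
  assumes L: "unimodular L" and f: "f \<in> borel_measurable (netM 2)"
  shows "(\<integral>\<^sup>+g. (\<integral>\<^sup>+x. f (rg_edges g, [rg_root g, x]) \<partial>count_space (rg_verts g)) \<partial>L)
       = (\<integral>\<^sup>+g. (\<integral>\<^sup>+x. f (rg_edges g, [x, rg_root g]) \<partial>count_space (rg_verts g)) \<partial>L)"
proof -
  define F where "F d = f (drg_net d)" for d
  have "F \<in> borel_measurable borel"
    unfolding F_def[abs_def] by (rule measurable_compose[OF measurable_drg_net f])
  with L have "(\<integral>\<^sup>+ g. (\<Sum>\<^sub>\<infinity>x\<in>rg_verts g. F (with_two_roots g (rg_root g) x)) \<partial>L) =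
        (\<integral>\<^sup>+ g. (\<Sum>\<^sub>\<infinity>x\<in>rg_verts g. F (with_two_roots g x (rg_root g))) \<partial>L)"
    unfolding unimodular_def by blast
  moreover have "(\<Sum>\<^sub>\<infinity>x\<in>rg_verts g. F (with_two_roots g (rg_root g) x)) =
      (\<integral>\<^sup>+x. f (rg_edges g, [rg_root g, x]) \<partial>count_space (rg_verts g))" for g
    unfolding infsum_ennreal_eq_nn_integral F_def
    by (rule nn_integral_cong) (simp add: drg_net_with_two_roots[OF f] rg_network)
  moreover have "(\<Sum>\<^sub>\<infinity>x\<in>rg_verts g. F (with_two_roots g x (rg_root g))) =
      (\<integral>\<^sup>+x. f (rg_edges g, [x, rg_root g]) \<partial>count_space (rg_verts g))" for g
    unfolding infsum_ennreal_eq_nn_integral F_def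
    by (rule nn_integral_cong) (simp add: drg_net_with_two_roots[OF f] rg_network)
  ultimately show ?thesis by simp
qed

lemma measurable_proj1:
  assumes "f \<in> measurable (netM 1) N" "i < k"
  shows "(\<lambda>p. f (fst p, [snd p ! i])) \<in> measurable (netM k) N"
  using measurable_compose[OF measurable_proj[of "[i]" k], of f N] assms by simp

lemma measurable_proj2:
  assumes "f \<in> measurable (netM 2) N" "i < k" "j < k"
  shows "(\<lambda>p. f (fst p, [snd p ! i, snd p ! j])) \<in> measurable (netM k) N"
  using measurable_compose[OF measurable_proj[of "[i, j]" k], of f N] assms by (simp add: numeral_2_eq_2)

text \<open>Let every vertex send mass 1 to each vertex at which Q fails. The root almost surely
  receives nothing, so in expectation it sends nothing: almost surely Q fails nowhere.\<close>

lemma AE_all_vertices: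
  assumes L: "unimodular L" and Q: "Measurable.pred (netM 1) Q"
    and root: "AE g in L. Q (rg_edges g, [rg_root g])"
  shows "AE g in L. \<forall>x\<in>rg_verts g. Q (rg_edges g, [x])"
proof -
  have setsL: "sets L = sets borel" using L by (simp add: unimodular_def)
  define f where "f p = (if Q (fst p, [snd p ! 1]) then 0 else 1 :: ennreal)" for p :: "nat rel \<times> nat list"
  have Q1: "(\<lambda>p. Q (fst p, [snd p ! 1])) \<in> measurable (netM 2) (count_space UNIV)"
    using Q by (rule measurable_proj1) simp
  have f: "f \<in> borel_measurable (netM 2)"
    unfolding f_def[abs_def] using Q1 by measurable
  have m: "(\<lambda>g. \<integral>\<^sup>+x. f (rg_edges g, [x, rg_root g]) \<partial>count_space (rg_verts g)) = (\<lambda>g. \<integral>\<^sup>+x. (if Q (rg_edges g, [rg_root g]) then 0 else 1) \<partial>count_space (rg_verts g))"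
    by (simp add: f_def)
  have "(\<integral>\<^sup>+g. (\<integral>\<^sup>+x. f (rg_edges g, [rg_root g, x]) \<partial>count_space (rg_verts g)) \<partial>L) = 0"
    unfolding mass_transport[OF L f] m
    by (rule nn_integral_zero'[OF AE_mp[OF root AE_I2]]) simp
  moreover have meas: "(\<lambda>g. \<integral>\<^sup>+x. f (rg_edges g, [rg_root g, x]) \<partial>count_space (rg_verts g)) \<in> borel_measurable L"
  proof -
    have f': "(\<lambda>p. f (fst p, [snd p ! 1, snd p ! 0])) \<in> borel_measurable (netM (Suc 1))"
      by (rule measurable_proj2[OF f]) simp_all
    have "(\<lambda>p. \<integral>\<^sup>+z. f (fst p, [(z # snd p) ! 1, (z # snd p) ! 0]) \<partial>count_space (verts_of (fst p) (hd (snd p)))) \<in> borel_measurable (netM 1)"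
      using measurable_verts_sum[OF f'] by simp
    from measurable_compose[OF measurable_rg_net this]
    have "(\<lambda>g. \<integral>\<^sup>+z. f (rg_edges g, [rg_root g, z]) \<partial>count_space (verts_of (rg_edges g) (rg_root g))) \<in> borel_measurable borel"
      by (simp add: rg_net_def)
    then show ?thesis
      unfolding measurable_cong_sets[OF setsL refl] by (simp add: verts_of_eq[OF rg_network])
  qed
  ultimately have "AE g in L. (\<integral>\<^sup>+x. f (rg_edges g, [rg_root g, x]) \<partial>count_space (rg_verts g)) = 0"
    by (subst (asm) nn_integral_0_iff_AE) auto
  then show ?thesis
    by eventually_elim (auto simp: nn_integral_0_iff_AE AE_count_space f_def split: if_splits)
qed

lemma nn_integral_neighbours:
  assumes "network_graph V E" "x \<in> V"
  shows "(\<integral>\<^sup>+z. (if (x, z) \<in> E then f z else 0) \<partial>count_space (verts_of E x)) = (\<Sum>z\<in>E `` {x}. f z)"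
proof -
  have fin: "finite (E `` {x})" and sub: "E `` {x} \<subseteq> V"
    using assms by (auto simp: network_graph_def simple_graph_def locally_finite_graph_def)
  have "(\<integral>\<^sup>+z. (if (x, z) \<in> E then f z else 0) \<partial>count_space (verts_of E x)) = (\<Sum>z\<in>E `` {x}. if (x, z) \<in> E then f z else 0)"
    by (rule nn_integral_count_space') (use fin sub verts_of_eq[OF assms] in auto)
  then show ?thesis by simp
qed

section \<open>Measurability of walk counts, projection entries and reachability\<close>

text \<open>The number of walks of length i from x to y. It uses \<open>adj\<close> on plain
  functions, so it is meaningful and measurable on every network, including those of unbounded
  degree.\<close>

definition walks :: "nat rel \<Rightarrow> nat \<Rightarrow> nat \<Rightarrow> nat \<Rightarrow> real" where
  "walks E i x y = (adj E ^^ i) (coord (bvec y)) x"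

lemma walks_nonneg: "walks E i x y \<ge> 0"
proof -
  have "\<forall>x. (adj E ^^ i) (coord (bvec y)) x \<ge> 0"
    by (induction i) (auto simp: coord_bvec adj_def intro!: sum_nonneg)
  then show ?thesis by (simp add: walks_def)
qed

lemma nets_E:
  assumes "p \<in> nets k" "k > 0"
  obtains V where "network_graph V (fst p)" "set (snd p) \<subseteq> V" "length (snd p) = k"
    "\<And>i. i < k \<Longrightarrow> snd p ! i \<in> V" "verts_of (fst p) (hd (snd p)) = V" "hd (snd p) = snd p ! 0"
proof -
  obtain V where V: "network_graph V (fst p)" "set (snd p) \<subseteq> V" "length (snd p) = k"
    using assms by (cases p) (auto simp: nets_def)
  have hd: "hd (snd p) = snd p ! 0" using V(3) assms(2) by (cases "snd p") auto
  have mem: "\<And>i. i < k \<Longrightarrow> snd p ! i \<in> V" using V by (auto dest: nth_mem)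
  show ?thesis by (rule that[OF V mem _ hd]) (use verts_of_eq[OF V(1)] mem assms(2) hd in auto)
qed

lemma measurable_walks [measurable]: "(\<lambda>p. walks (fst p) i (snd p ! 0) (snd p ! 1)) \<in> borel_measurable (netM 2)"
proof (induction i)
  case 0
  have "(\<lambda>p. walks (fst p) 0 (snd p ! 0) (snd p ! 1)) = (\<lambda>p. if snd p ! 0 = snd p ! 1 then 1 else 0)"
    by (simp add: walks_def coord_bvec)
  then show ?case using pred_equal[of 0 2 1] by simp
next
  case (Suc i)
  \<comment> \<open>With the summed vertex z prepended, index 0 is z, index 1 is the start x and
    index 2 is the end y: the first step of the walk goes from x to z.\<close>
  let ?f = "\<lambda>p. if (snd p ! 1, snd p ! 0) \<in> fst p then ennreal (walks (fst p) i (snd p ! 0) (snd p ! 2)) else 0"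
  have [measurable]: "(\<lambda>p. walks (fst p) i (snd p ! 0) (snd p ! 2)) \<in> borel_measurable (netM 3)"
    using measurable_compose[OF measurable_proj[of "[0, 2]" 3], of "\<lambda>p. walks (fst p) i (snd p ! 0) (snd p ! 1)" borel] Suc
    by (simp add: numeral_2_eq_2)
  have [measurable]: "Measurable.pred (netM 3) (\<lambda>p. (snd p ! 1, snd p ! 0) \<in> fst p)"
    by (rule pred_adjacent) auto
  have "?f \<in> borel_measurable (netM 3)" by measurable
  then have f: "?f \<in> borel_measurable (netM (Suc 2))" by (simp add: eval_nat_numeral)
  have m: "(\<lambda>p. enn2real (\<integral>\<^sup>+z. ?f (fst p, z # snd p) \<partial>count_space (verts_of (fst p) (hd (snd p))))) \<in> borel_measurable (netM 2)"
    using measurable_verts_sum[OF f] by measurable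
  have eq: "walks (fst p) (Suc i) (snd p ! 0) (snd p ! 1) = enn2real (\<integral>\<^sup>+z. ?f (fst p, z # snd p) \<partial>count_space (verts_of (fst p) (hd (snd p))))"
    if p: "p \<in> nets 2" for p
  proof -
    obtain V where V: "network_graph V (fst p)" "\<And>i. i < 2 \<Longrightarrow> snd p ! i \<in> V" "hd (snd p) = snd p ! 0"
      using nets_E[OF p] by (metis zero_less_numeral)
    have "(\<integral>\<^sup>+z. ?f (fst p, z # snd p) \<partial>count_space (verts_of (fst p) (hd (snd p))))
       = (\<Sum>z\<in>fst p `` {snd p ! 0}. ennreal (walks (fst p) i z (snd p ! 1)))"
      using nn_integral_neighbours[OF V(1) V(2)[of 0], of "\<lambda>z. ennreal (walks (fst p) i z (snd p ! 1))"]
      by (simp add: V(3) cong: if_cong)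
    also have "\<dots> = ennreal (\<Sum>z\<in>fst p `` {snd p ! 0}. walks (fst p) i z (snd p ! 1))"
      by (rule sum_ennreal) (rule walks_nonneg)
    finally show ?thesis
      by (simp add: walks_def adj_def sum_nonneg[OF walks_nonneg[unfolded walks_def]])
  qed
  show ?case using m by (subst measurable_cong[OF eq]) simp_all
qed

text \<open>
  The limit exists, and is the entry at \<open>(x, y)\<close> of the projection onto the eigenspace at \<open>t\<close>, when
  the degrees are at most \<open>D\<close> with \<open>D + \<bar>t\<bar> < M\<close>.  For other graphs it is an unspecified
  measurable function.
\<close>

definition kernel_entry :: "real \<Rightarrow> real \<Rightarrow> nat rel \<Rightarrow> nat \<Rightarrow> nat \<Rightarrow> real" where
  "kernel_entry M t E x y = lim (\<lambda>n. \<Sum>i\<le>degree (kernel_poly M t ^ n). coeff (kernel_poly M t ^ n) i * walks E i x y)"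

lemma measurable_kernel_entry: "(\<lambda>p. kernel_entry M t (fst p) (snd p ! 0) (snd p ! 1)) \<in> borel_measurable (netM 2)"
  unfolding kernel_entry_def by measurable

lemma (in bounded_degree_graph) kernel_entry_eq:
  assumes "(\<lambda>n. opoly (adjop E) (kernel_poly M t ^ n) (bvec y)) \<longlonglongrightarrow> h"
  shows "kernel_entry M t E x y = coord h x"
proof -
  have "coord (opoly (adjop E) p (bvec y)) x = (\<Sum>i\<le>degree p. coeff p i * walks E i x y)" for p
    by (simp add: opoly_def coord_sum coord_adjop_funpow walks_def)
  then have "(\<lambda>n. \<Sum>i\<le>degree (kernel_poly M t ^ n). coeff (kernel_poly M t ^ n) i * walks E i x y) \<longlonglongrightarrow> coord h x"
    using tendsto_coord[OF assms, of x] by simp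
  then show ?thesis unfolding kernel_entry_def by (rule limI)
qed

text \<open>Powers of the relation are treated by induction, each adding an existential over one
  intermediate vertex. \<open>QE\<close> keeps paths inside the network, so this vertex may range
  over \<open>verts_of\<close>. The m extra roots are parameters, such as the deleted edge that
  defines a branch.\<close>

lemma pred_reachable:
  assumes Q: "Measurable.pred (netM (m + 2)) Q"
    and QE: "\<And>E a b ps. Q (E, a # b # ps) \<Longrightarrow> (a, b) \<in> E"
  shows "Measurable.pred (netM (m + 2)) (\<lambda>p. (snd p ! 0, snd p ! 1) \<in> {(a, b). Q (fst p, a # b # drop 2 (snd p))}\<^sup>*)"
proof -
  let ?r = "\<lambda>p. {(a, b). Q (fst p, a # b # drop 2 (snd p))}"
  have tail: "map ((!) (a # b # c # ps)) [3..<m + 3] = ps" if "length ps = m" for a b c :: nat and ps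
  proof -
    have "map ((!) (a # b # c # ps)) [3..<m + 3] = map ((!) (a # b # c # ps)) (map (\<lambda>i. i + 3) [0..<m])"
      by (simp only: map_add_upt)
    also have "\<dots> = map ((!) ps) [0..<m]" by (simp add: eval_nat_numeral)
    finally show ?thesis using map_nth[of ps] that by simp
  qed
  have "Measurable.pred (netM (m + 2)) (\<lambda>p. (snd p ! 0, snd p ! 1) \<in> ?r p ^^ n)" for n
  proof (induction n)
    case 0
    show ?case using pred_equal[of 0 "m + 2" 1] by simp
  next
    case (Suc n)
    \<comment> \<open>On the list z, u, v, ps the first selection is u, z, ps and the second is z,
      v, ps.\<close>
    let ?j1 = "[1, 0] @ [3..<m + 3]" and ?j2 = "[0, 2] @ [3..<m + 3]"
    let ?P = "\<lambda>p. (snd p ! 0, snd p ! 1) \<in> ?r p ^^ n"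
    have [measurable]: "Measurable.pred (netM (Suc (m + 2))) (\<lambda>p. ?P (fst p, map ((!) (snd p)) ?j1))"
      by (rule measurable_compose[OF measurable_proj[of ?j1 "Suc (m + 2)"]]) (use Suc in auto)
    have [measurable]: "Measurable.pred (netM (Suc (m + 2))) (\<lambda>p. Q (fst p, map ((!) (snd p)) ?j2))"
      by (rule measurable_compose[OF measurable_proj[of ?j2 "Suc (m + 2)"]]) (use Q in auto)
    have "Measurable.pred (netM (Suc (m + 2))) (\<lambda>p. ?P (fst p, map ((!) (snd p)) ?j1) \<and> Q (fst p, map ((!) (snd p)) ?j2))"
      by measurable
    from pred_verts_ex[OF this]
    have meas: "Measurable.pred (netM (m + 2)) (\<lambda>p. \<exists>z\<in>verts_of (fst p) (hd (snd p)).
        ?P (fst p, map ((!) (z # snd p)) ?j1) \<and> Q (fst p, map ((!) (z # snd p)) ?j2))" by simp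
    have eq: "(snd p ! 0, snd p ! 1) \<in> ?r p ^^ Suc n \<longleftrightarrow> (\<exists>z\<in>verts_of (fst p) (hd (snd p)).
        ?P (fst p, map ((!) (z # snd p)) ?j1) \<and> Q (fst p, map ((!) (z # snd p)) ?j2))"
      if p: "p \<in> nets (m + 2)" for p
    proof -
      obtain E u v ps where p': "p = (E, u # v # ps)" "length ps = m"
        using p by (cases p; cases "snd p"; cases "tl (snd p)") (auto simp: nets_def)
      have reach: "z \<in> verts_of E u" if "(u, z) \<in> ?r p ^^ n" for z
      proof -
        have "?r p \<subseteq> E" using QE p' by auto
        moreover have "(u, z) \<in> (?r p)\<^sup>*" using that relpow_imp_rtrancl by blast
        ultimately show ?thesis unfolding verts_of_def using rtrancl_mono by blast
      qed
      have 1: "map ((!) (z # u # v # ps)) ?j1 = u # z # ps" "map ((!) (z # u # v # ps)) ?j2 = z # v # ps" for z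
        using tail[OF p'(2)] by (simp_all add: eval_nat_numeral)
      have "(snd p ! 0, snd p ! 1) \<in> ?r p ^^ Suc n \<longleftrightarrow> (\<exists>z. (u, z) \<in> ?r p ^^ n \<and> Q (E, z # v # ps))"
        by (auto simp: p')
      also have "\<dots> \<longleftrightarrow> (\<exists>z\<in>verts_of E u. (u, z) \<in> ?r p ^^ n \<and> Q (E, z # v # ps))"
        using reach by blast
      finally show ?thesis unfolding p' fst_conv snd_conv 1 by simp
    qed
    show ?case using meas by (subst measurable_cong[OF eq]) simp_all
  qed
  then have "Measurable.pred (netM (m + 2)) (\<lambda>p. \<exists>n. (snd p ! 0, snd p ! 1) \<in> ?r p ^^ n)"
    by measurable
  then show ?thesis by (simp add: rtrancl_power)
qed

section \<open>Eigenspaces on trees\<close>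

text \<open>The side of x after the edge xy is deleted; \<open>branch E y x\<close> is therefore
  what lies beyond y as seen from x.\<close>

definition branch :: "'a rel \<Rightarrow> 'a \<Rightarrow> 'a \<Rightarrow> 'a set" where
  "branch E x y = (E - {(x, y), (y, x)})\<^sup>* `` {x}"

lemma branch_self: "x \<in> branch E x y"
  by (simp add: branch_def)

lemma branch_step:
  assumes "u \<in> branch E x y" "(u, v) \<in> E" "(u, v) \<noteq> (x, y)" "(u, v) \<noteq> (y, x)"
  shows "v \<in> branch E x y"
  using assms unfolding branch_def by (auto intro: rtrancl_into_rtrancl)

text \<open>A shortest path repeats no vertex, since a loop could be cut out. Its length is not 0
  because x and y differ, and not 1 because the edge xy is missing from E', so adding that edge
  closes a cycle with at least three vertices.\<close>

lemma path_closes_cycle: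
  assumes sym: "sym E" and E': "E' \<subseteq> E" and path: "(x, y) \<in> E'\<^sup>*" and xy: "(x, y) \<in> E" "x \<noteq> y" "(x, y) \<notin> E'"
  shows "\<exists>xs. is_cycle E xs"
proof -
  define n where "n = (LEAST n. (x, y) \<in> E' ^^ n)"
  have ex: "\<exists>n. (x, y) \<in> E' ^^ n" using path by (simp add: rtrancl_power)
  have n: "(x, y) \<in> E' ^^ n" unfolding n_def using ex by (rule LeastI_ex)
  have least: "n \<le> m" if "(x, y) \<in> E' ^^ m" for m unfolding n_def using that by (rule Least_le)
  obtain f where f: "f 0 = x" "f n = y" "\<And>i. i < n \<Longrightarrow> (f i, f (Suc i)) \<in> E'"
    using n unfolding relpow_fun_conv by blast
  have seg: "(f i, f (i + k)) \<in> E' ^^ k" if "i + k \<le> n" for i k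
    unfolding relpow_fun_conv by (rule exI[of _ "\<lambda>l. f (i + l)"]) (use f(3) that in auto)
  have "inj_on f {..n}"
  proof (rule linorder_inj_onI)
    fix i j assume ij: "i < j" "i \<in> {..n}" "j \<in> {..n}"
    show "f i \<noteq> f j"
    proof
      assume eq: "f i = f j"
      have "(x, f i) \<in> E' ^^ i" using seg[of 0 i] ij f(1) by simp
      moreover have "(f i, y) \<in> E' ^^ (n - j)" using seg[of j "n - j"] ij f(2) eq by simp
      ultimately have "(x, y) \<in> E' ^^ (i + (n - j))" by (auto simp: relpow_add)
      from least[OF this] show False using ij by auto
    qed
  qed auto
  moreover have "n \<noteq> 0" using n xy(2) by (intro notI) simp
  moreover have "n \<noteq> 1" using n xy(3) by (intro notI) simp
  ultimately have "is_cycle E (map f [0..<Suc n])"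
  proof -
    assume inj: "inj_on f {..n}" and "n \<noteq> 0" "n \<noteq> 1"
    show ?thesis
      unfolding is_cycle_def
    proof (intro conjI allI impI)
      show "3 \<le> length (map f [0..<Suc n])" using \<open>n \<noteq> 0\<close> \<open>n \<noteq> 1\<close> by simp
      have "{0..<Suc n} = {..n}" by auto
      then show "distinct (map f [0..<Suc n])" using inj by (simp only: distinct_map distinct_upt set_upt)
      fix i assume "i < length (map f [0..<Suc n])"
      then have i: "i \<le> n" by simp
      show "(map f [0..<Suc n] ! i, map f [0..<Suc n] ! (Suc i mod length (map f [0..<Suc n]))) \<in> E"
      proof (cases "i = n")
        case True
        then have "map f [0..<Suc n] ! i = y" "map f [0..<Suc n] ! (Suc i mod length (map f [0..<Suc n])) = x"
          using f by (simp_all del: upt_Suc)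
        then show ?thesis using xy(1) sym by (simp add: symD)
      next
        case False
        then have "map f [0..<Suc n] ! i = f i" "map f [0..<Suc n] ! (Suc i mod length (map f [0..<Suc n])) = f (Suc i)"
          using i by (simp_all del: upt_Suc)
        then show ?thesis using f(3)[of i] i False E' by auto
      qed
    qed
  qed
  then show ?thesis by blast
qed

locale tree =
  fixes V :: "'a set" and E :: "'a rel"
  assumes tree: "is_tree V E"
begin

lemma sym_E: "sym E" and irrefl_E: "(x, x) \<notin> E" and E_V: "E \<subseteq> V \<times> V"
  using tree by (auto simp: is_tree_def simple_graph_def irrefl_def)

lemma connected: "x \<in> V \<Longrightarrow> y \<in> V \<Longrightarrow> (x, y) \<in> E\<^sup>*"
  using tree by (auto simp: is_tree_def graph_connected_def)

lemma other_end_notin_branch: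
  assumes "(x, y) \<in> E"
  shows "y \<notin> branch E x y"
proof
  assume "y \<in> branch E x y"
  then have "(x, y) \<in> (E - {(x, y), (y, x)})\<^sup>*" by (simp add: branch_def)
  from path_closes_cycle[OF sym_E _ this assms] show False
    using tree irrefl_E assms by (auto simp: is_tree_def)
qed

lemma branch_disjoint:
  assumes "(x, y) \<in> E"
  shows "branch E x y \<inter> branch E y x = {}"
proof -
  have sym: "sym ((E - {(x, y), (y, x)})\<^sup>*)"
    by (rule sym_rtrancl) (use sym_E in \<open>auto simp: sym_def\<close>)
  have "y \<in> branch E x y" if z: "z \<in> branch E x y" "z \<in> branch E y x" for z
  proof -
    have 1: "(x, z) \<in> (E - {(x, y), (y, x)})\<^sup>*" using z by (simp add: branch_def)
    have 2: "(y, z) \<in> (E - {(x, y), (y, x)})\<^sup>*" using z by (simp add: branch_def insert_commute)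
    show ?thesis using rtrancl_trans[OF 1 symD[OF sym 2]] by (simp add: branch_def)
  qed
  then show ?thesis using other_end_notin_branch[OF assms] by blast
qed

lemma branch_cover:
  assumes "(x, y) \<in> E" "z \<in> V"
  shows "z \<in> branch E x y \<or> z \<in> branch E y x"
proof -
  have "(x, z) \<in> E\<^sup>*" using assms E_V by (intro connected) auto
  then show ?thesis
  proof (induction rule: rtrancl_induct)
    case (step u v)
    show ?case
    proof (cases "(u, v) = (x, y) \<or> (u, v) = (y, x)")
      case True
      then show ?thesis using branch_self[of x E y] branch_self[of y E x] by auto
    next
      case False
      then show ?thesis using step branch_step[of u E x y v] branch_step[of u E y x v] by blast
    qed
  qed (simp add: branch_self)
qed

text \<open>A connected C stays on the inner side of each edge leaving it. A branch beyond y
  therefore never meets C, so it cannot cross another exit edge x'y' and lies entirely on the side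
  of x'.\<close>

lemma component_branches_disjoint:
  assumes C: "\<And>u v. u \<in> C \<Longrightarrow> v \<in> C \<Longrightarrow> (u, v) \<in> (E \<inter> C \<times> C)\<^sup>*"
    and xy: "(x, y) \<in> E" "x \<in> C" "y \<notin> C"
  shows "C \<inter> branch E y x = {}"
    and "(x', y') \<in> E \<Longrightarrow> x' \<in> C \<Longrightarrow> y' \<notin> C \<Longrightarrow> (x', y') \<noteq> (x, y) \<Longrightarrow> branch E y x \<inter> branch E y' x' = {}"
proof -
  have sub: "C \<subseteq> branch E x y" if xy: "(x, y) \<in> E" "x \<in> C" "y \<notin> C" for x y
  proof
    fix z assume "z \<in> C"
    then have "(x, z) \<in> (E \<inter> C \<times> C)\<^sup>*" using C xy by blast
    then show "z \<in> branch E x y"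
    proof (induction rule: rtrancl_induct)
      case (step u v)
      then show ?case using branch_step[of u E x y v] xy(3) by blast
    qed (rule branch_self)
  qed
  show dC: "C \<inter> branch E y x = {}" using sub[OF xy] branch_disjoint[OF xy(1)] by blast
  assume xy': "(x', y') \<in> E" "x' \<in> C" "y' \<notin> C" "(x', y') \<noteq> (x, y)"
  have "branch E y x \<subseteq> branch E x' y'"
  proof
    fix z assume "z \<in> branch E y x"
    then have "(y, z) \<in> (E - {(y, x), (x, y)})\<^sup>*" by (simp add: branch_def)
    then have "z \<in> branch E x' y' \<and> z \<in> branch E y x"
    proof (induction rule: rtrancl_induct)
      case base
      have "x \<in> branch E x' y'" using sub[OF xy'(1-3)] xy by blast
      then have "y \<in> branch E x' y'" using branch_step[of x E x' y' y] xy xy' by blast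
      then show ?case by (simp add: branch_self)
    next
      case (step u v)
      have v: "v \<in> branch E y x" using branch_step[of u E y x v] step by blast
      have "u \<noteq> x'" "v \<noteq> x'" using dC xy'(2) v step by blast+
      then have "v \<in> branch E x' y'" using branch_step[of u E x' y' v] step by blast
      then show ?case using v by simp
    qed
    then show "z \<in> branch E x' y'" ..
  qed
  then show "branch E y x \<inter> branch E y' x' = {}" using branch_disjoint[OF xy'(1)] by blast
qed

lemma is_tree_subset:
  assumes "C \<subseteq> V" "C \<noteq> {}" and C: "\<And>u v. u \<in> C \<Longrightarrow> v \<in> C \<Longrightarrow> (u, v) \<in> (E \<inter> C \<times> C)\<^sup>*"
  shows "is_tree C (E \<inter> C \<times> C)"
proof -
  have "\<not> is_cycle (E \<inter> C \<times> C) xs" for xs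
  proof
    assume "is_cycle (E \<inter> C \<times> C) xs"
    then have "is_cycle E xs" by (auto simp: is_cycle_def)
    then show False using tree by (auto simp: is_tree_def)
  qed
  then show ?thesis
    using assms sym_E irrefl_E
    by (auto simp: is_tree_def simple_graph_def graph_connected_def sym_def irrefl_def)
qed

end

section \<open>Projections onto the eigenspace and components of their support\<close>

lemma norm_restr_UN_sq: "finite I \<Longrightarrow> disjoint_family_on B I \<Longrightarrow>
  (\<Sum>i\<in>I. (norm (restr (B i) u))\<^sup>2) = (norm (restr (\<Union>i\<in>I. B i) u))\<^sup>2"
proof (induction I rule: finite_induct)
  case (insert i I)
  have "restr (\<Union>j\<in>insert i I. B j) u = restr (B i) u + restr (\<Union>j\<in>I. B j) u"
    using insert by (intro l2_eqI) (auto simp: disjoint_family_on_def)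
  moreover have "inner (restr (B i) u) (restr (\<Union>j\<in>I. B j) u) = 0"
  proof -
    have "coord (restr (B i) u) n * coord (restr (\<Union>j\<in>I. B j) u) n = 0" for n
      using insert by (auto simp: disjoint_family_on_def)
    then show ?thesis by (simp only: inner_l2_def suminf_zero)
  qed
  ultimately have "(norm (restr (\<Union>j\<in>insert i I. B j) u))\<^sup>2 = (norm (restr (B i) u))\<^sup>2 + (norm (restr (\<Union>j\<in>I. B j) u))\<^sup>2"
    by (simp add: power2_norm_eq_inner inner_add_left inner_add_right inner_commute)
  then show ?case using insert by (simp add: disjoint_family_on_def)
next
  case empty
  have "restr {} u = 0" by (intro l2_eqI) simp
  then show ?case by simp
qed

lemma norm_restr_split:
  assumes "supported V u" "V \<subseteq> A \<union> B" "A \<inter> B = {}"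
  shows "(norm u)\<^sup>2 = (norm (restr A u))\<^sup>2 + (norm (restr B u))\<^sup>2"
proof -
  have "u = restr (\<Union>b\<in>UNIV. if b then A else B) u"
    using assms by (intro l2_eqI) (auto simp: supported_def)
  moreover have "disjoint_family_on (\<lambda>b. if b then A else B) UNIV"
    using assms(3) by (auto simp: disjoint_family_on_def)
  ultimately show ?thesis
    using norm_restr_UN_sq[of UNIV "\<lambda>b. if b then A else B" u] by (simp add: UNIV_bool add.commute)
qed

text \<open>\<open>K x\<close> is the projection of the basis vector at \<open>x\<close> onto the eigenspace.\<close>

locale tree_eigenspace = tree V E + bounded_degree_network E D V for V :: "nat set" and E D +
  fixes t :: real and K :: "nat \<Rightarrow> l2"
  assumes K_ker: "x \<in> V \<Longrightarrow> adjop E (K x) = t *\<^sub>R K x"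
    and K_reproduces: "x \<in> V \<Longrightarrow> adjop E f = t *\<^sub>R f \<Longrightarrow> inner (K x) f = coord f x"
    and K_supported: "x \<in> V \<Longrightarrow> supported V (K x)"
begin

interpretation A: bounded_linear "adjop E" by (rule bounded_linear_adjop)

definition S :: "nat set" where "S = {x \<in> V. coord (K x) x > 0}"

lemma coord_K_inner: "x \<in> V \<Longrightarrow> y \<in> V \<Longrightarrow> coord (K x) y = inner (K y) (K x)"
  using K_reproduces K_ker by simp

lemma coord_K_commute: "x \<in> V \<Longrightarrow> y \<in> V \<Longrightarrow> coord (K x) y = coord (K y) x"
  by (simp add: coord_K_inner inner_commute)

lemma coord_K_diag: "x \<in> V \<Longrightarrow> coord (K x) x = (norm (K x))\<^sup>2"
  by (simp add: coord_K_inner power2_norm_eq_inner)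

lemma K_eq_0: "x \<in> V \<Longrightarrow> x \<notin> S \<Longrightarrow> K x = 0"
  using coord_K_diag[of x] by (auto simp: S_def)

text \<open>Inside the branch the only neighbour lost is y, where f vanishes. Outside, only y has a
  neighbour in the branch, namely x, so the error is concentrated at y and equals f(x).\<close>

lemma adjop_restr_branch:
  assumes f: "adjop E f = t *\<^sub>R f" and xy: "(x, y) \<in> E" and y: "coord f y = 0"
  shows "adjop E (restr (branch E x y) f) = t *\<^sub>R restr (branch E x y) f + coord f x *\<^sub>R bvec y"
proof (rule l2_eqI)
  fix z
  let ?B = "branch E x y"
  have xny: "x \<noteq> y" using xy irrefl_E by auto
  have yB: "y \<notin> ?B" by (rule other_end_notin_branch[OF xy])
  have fz: "(\<Sum>w\<in>E `` {z}. coord f w) = t * coord f z"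
    using arg_cong[OF f, of "\<lambda>u. coord u z"] by (simp add: coord_adjop adj_def)
  have "coord (adjop E (restr ?B f)) z = (\<Sum>w\<in>E `` {z}. if w \<in> ?B then coord f w else 0)"
    by (simp add: coord_adjop adj_def)
  also have "\<dots> = t * (if z \<in> ?B then coord f z else 0) + coord f x * (if z = y then 1 else 0)"
  proof (cases "z \<in> ?B")
    case True
    have "(\<Sum>w\<in>E `` {z}. if w \<in> ?B then coord f w else 0) = (\<Sum>w\<in>E `` {z}. coord f w)"
    proof (rule sum.cong)
      fix w assume "w \<in> E `` {z}"
      then have zw: "(z, w) \<in> E" by simp
      show "(if w \<in> ?B then coord f w else 0) = coord f w"
      proof (cases "(z, w) = (x, y)")
        case False
        then have "w \<in> ?B" using branch_step[OF True zw] True yB by blast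
        then show ?thesis by simp
      qed (use y in simp)
    qed simp
    then show ?thesis using True yB fz by auto
  next
    case zB: False
    show ?thesis
    proof (cases "z = y")
      case True
      have "(\<Sum>w\<in>E `` {z}. if w \<in> ?B then coord f w else 0) = (\<Sum>w\<in>{x}. coord f w)"
      proof (rule sum.mono_neutral_cong_right)
        show "{x} \<subseteq> E `` {z}" using xy sym_E True by (auto dest: symD)
        show "\<forall>i\<in>E `` {z} - {x}. (if i \<in> ?B then coord f i else 0) = 0"
        proof
          fix w assume w: "w \<in> E `` {z} - {x}"
          have "w \<notin> ?B"
          proof
            assume wB: "w \<in> ?B"
            have "(w, y) \<in> E" using w True sym_E by (auto dest: symD)
            then have "y \<in> ?B" using branch_step[OF wB] w xny by blast
            then show False using yB by simp
          qed
          then show "(if w \<in> ?B then coord f w else 0) = 0" by simp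
        qed
      qed (use finite_nbrs branch_self[of x E y] in auto)
      then show ?thesis using True yB by simp
    next
      case False
      have "(\<Sum>w\<in>E `` {z}. if w \<in> ?B then coord f w else 0) = 0"
      proof (rule sum.neutral, rule ballI)
        fix w assume w: "w \<in> E `` {z}"
        have "w \<notin> ?B"
        proof
          assume wB: "w \<in> ?B"
          have "(w, z) \<in> E" using w sym_E by (auto dest: symD)
          then have "z \<in> ?B" using branch_step[OF wB] False wB yB by blast
          then show False using zB by simp
        qed
        then show "(if w \<in> ?B then coord f w else 0) = 0" by simp
      qed
      then show ?thesis using False zB by simp
    qed
  qed
  finally show "coord (adjop E (restr ?B f)) z = coord (t *\<^sub>R restr ?B f + coord f x *\<^sub>R bvec y) z"
    by (simp add: coord_bvec)
qed

lemma vanish_propagates: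
  assumes "x \<in> S" "(x, y) \<in> E" "adjop E f = t *\<^sub>R f" "coord f x = 0"
  shows "coord f y = 0"
proof -
  have x: "x \<in> V" "coord (K x) x > 0" using assms(1) by (auto simp: S_def)
  have yx: "(y, x) \<in> E" using assms(2) sym_E by (auto dest: symD)
  define g where "g = restr (branch E y x) f"
  have g: "adjop E g = t *\<^sub>R g + coord f y *\<^sub>R bvec x"
    unfolding g_def by (rule adjop_restr_branch[OF assms(3) yx assms(4)])
  \<comment> \<open>The eigenfunction \<open>K x\<close> is orthogonal to the range of A - t, which
    contains f(y) times the basis vector at x.\<close>
  have "inner (K x) (adjop E g) = t * inner (K x) g"
    using adjop_symmetric[of "K x" g] K_ker[OF x(1)] by simp
  then have "coord f y * coord (K x) x = 0"
    unfolding g by (simp add: inner_add_right inner_bvec)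
  then show ?thesis using x(2) by simp
qed

text \<open>Subtract from \<open>K y\<close> the multiple of \<open>K x\<close> that makes the
  difference f vanish at x, hence also at y. By reproduction <f, f> = f(y) - c f(x) = 0.\<close>

lemma K_proportional_step:
  assumes "x \<in> S" "y \<in> S" "(x, y) \<in> E"
  shows "\<exists>c. c \<noteq> 0 \<and> K y = c *\<^sub>R K x"
proof -
  have V: "x \<in> V" "y \<in> V" and pos: "coord (K x) x > 0" "coord (K y) y > 0" using assms by (auto simp: S_def)
  define c where "c = coord (K y) x / coord (K x) x"
  define f where "f = K y - c *\<^sub>R K x"
  have f: "adjop E f = t *\<^sub>R f"
    unfolding f_def using K_ker V by (simp add: A.diff A.scaleR scaleR_diff_right)
  have fx: "coord f x = 0" unfolding f_def c_def using pos by simp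
  have fy: "coord f y = 0" by (rule vanish_propagates[OF assms(1,3) f fx])
  have "inner f f = inner (K y) f - c * inner (K x) f"
    by (subst (1) f_def) (simp add: inner_diff_left)
  then have "inner f f = 0" using K_reproduces[OF V(1) f] K_reproduces[OF V(2) f] fx fy by simp
  then have "K y = c *\<^sub>R K x" by (simp add: f_def)
  moreover have "c \<noteq> 0" using calculation pos by auto
  ultimately show ?thesis by blast
qed

definition component :: "nat \<Rightarrow> nat set" where
  "component x = (E \<inter> S \<times> S)\<^sup>* `` {x}"

lemma comp_subset_S: "x \<in> S \<Longrightarrow> component x \<subseteq> S"
proof
  fix w assume x: "x \<in> S" and "w \<in> component x"
  then have "(x, w) \<in> (E \<inter> S \<times> S)\<^sup>*" by (simp add: component_def)
  then show "w \<in> S" by (induction rule: rtrancl_induct) (use x in auto)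
qed

lemma comp_self: "x \<in> component x"
  by (simp add: component_def)

lemma comp_sym: "y \<in> component x \<Longrightarrow> x \<in> component y"
proof -
  have "sym ((E \<inter> S \<times> S)\<^sup>*)"
    by (rule sym_rtrancl) (use sym_E in \<open>auto simp: sym_def\<close>)
  then show "y \<in> component x \<Longrightarrow> x \<in> component y" by (auto simp: component_def dest: symD)
qed

lemma comp_eq: "y \<in> component x \<Longrightarrow> component y = component x"
proof -
  have "component y \<subseteq> component x" if "y \<in> component x" for x y
    using that by (auto simp: component_def intro: rtrancl_trans)
  then show "y \<in> component x \<Longrightarrow> component y = component x" using comp_sym by blast
qed

lemma comp_step: "w \<in> component x \<Longrightarrow> w \<in> S \<Longrightarrow> (w, y) \<in> E \<Longrightarrow> y \<in> S \<Longrightarrow> y \<in> component x"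
  by (auto simp: component_def intro: rtrancl_into_rtrancl)

lemma comp_connected:
  assumes "u \<in> component x" "v \<in> component x"
  shows "(u, v) \<in> (E \<inter> component x \<times> component x)\<^sup>*"
proof -
  have "(u, v) \<in> (E \<inter> S \<times> S)\<^sup>*" using assms comp_eq[of u x] by (auto simp: component_def)
  then show ?thesis
  proof (induction rule: rtrancl_induct)
    case (step a b)
    have "a \<in> component x"
      using step(1) assms(1) comp_eq[OF assms(1)] by (auto simp: component_def)
    then have "b \<in> component x" using step(2) by (auto intro: comp_step)
    then show ?case using step \<open>a \<in> component x\<close> by (auto intro: rtrancl_into_rtrancl)
  qed simp
qed

lemma K_proportional:
  assumes "x \<in> S" "w \<in> component x"
  shows "\<exists>c. c \<noteq> 0 \<and> K w = c *\<^sub>R K x"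
proof -
  have "(x, w) \<in> (E \<inter> S \<times> S)\<^sup>*" using assms(2) by (simp add: component_def)
  then show ?thesis
  proof (induction rule: rtrancl_induct)
    case base show ?case by (rule exI[of _ 1]) simp
  next
    case (step a b)
    then obtain c d where "c \<noteq> 0" "K a = c *\<^sub>R K x" "d \<noteq> 0" "K b = d *\<^sub>R K a"
      using K_proportional_step[of a b] by blast
    then show ?case by (intro exI[of _ "d * c"]) simp
  qed
qed

text \<open>The part of the mass of the unit eigenfunction proportional to \<open>K x\<close> that lies beyond \<open>y\<close>.\<close>

definition \<alpha> :: "nat \<Rightarrow> nat \<Rightarrow> real" where
  "\<alpha> y x = (norm (restr (branch E y x) (K x)))\<^sup>2 / coord (K x) x"

lemma \<alpha>_nonneg: "x \<in> S \<Longrightarrow> \<alpha> y x \<ge> 0"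
  by (simp add: \<alpha>_def S_def)

text \<open>
  Cutting \<open>K x\<close> off at \<open>y\<close> and normalizing at \<open>x\<close> gives solutions \<open>g x\<close> of \<open>(A - t) (g x) = \<delta>\<^sub>y\<close> for all
  neighbours \<open>x\<close> of \<open>y\<close>.  They differ by eigenfunctions, which determines the neighbouring values of
  the projection of any one of them, and these values sum to 0 because the projection vanishes at \<open>y\<close>.
\<close>

lemma sum_\<alpha>_boundary:
  assumes y: "y \<in> V" "y \<notin> S" and N: "E `` {y} \<inter> S \<noteq> {}"
  shows "(\<Sum>x\<in>E `` {y} \<inter> S. \<alpha> y x) = 1"
proof -
  define N where "N = E `` {y} \<inter> S"
  have finN: "finite N" unfolding N_def using finite_nbrs by auto
  have xN: "(x, y) \<in> E" "x \<in> V" "coord (K x) x > 0" if "x \<in> N" for x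
    using that sym_E unfolding N_def S_def by (auto dest: symD)
  define g where "g x = (1 / coord (K x) x) *\<^sub>R restr (branch E x y) (K x)" for x
  have g: "adjop E (g x) = t *\<^sub>R g x + bvec y" if "x \<in> N" for x
  proof -
    have "coord (K x) y = 0" using coord_K_commute[of x y] K_eq_0[OF y] xN[OF that] y by simp
    then show ?thesis
      using adjop_restr_branch[OF K_ker xN(1), OF xN(2)] that xN[OF that]
      by (simp add: g_def A.scaleR scaleR_add_right mult.commute)
  qed
  have gc: "coord (g x) w = (if w = x then 1 else 0)" if "x \<in> N" "w \<in> N" for x w
  proof (cases "w = x")
    case True
    then show ?thesis using xN[OF that(1)] branch_self[of x E y] by (simp add: g_def)
  next
    case False
    have "w \<notin> branch E x y"
    proof
      assume "w \<in> branch E x y"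
      then have "y \<in> branch E x y" using branch_step[of w E x y y] xN[OF that(2)] False irrefl_E by blast
      then show False using other_end_notin_branch xN[OF that(1)] by blast
    qed
    then show ?thesis using False by (simp add: g_def)
  qed
  have Kg: "inner (K x) (g x) = 1 - \<alpha> y x" if "x \<in> N" for x
  proof -
    have "(norm (K x))\<^sup>2 = (norm (restr (branch E x y) (K x)))\<^sup>2 + (norm (restr (branch E y x) (K x)))\<^sup>2"
      by (rule norm_restr_split[OF K_supported])
         (use xN[OF that] branch_cover[OF xN(1)[OF that]] branch_disjoint[OF xN(1)[OF that]] in auto)
    moreover have "inner (K x) (g x) = (norm (restr (branch E x y) (K x)))\<^sup>2 / coord (K x) x"
      unfolding g_def by (simp add: inner_restr_right[of "K x"] power2_norm_eq_inner)
    ultimately have "inner (K x) (g x) = (coord (K x) x - (norm (restr (branch E y x) (K x)))\<^sup>2) / coord (K x) x"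
      unfolding coord_K_diag[OF xN(2)[OF that]] by simp
    also have "\<dots> = 1 - \<alpha> y x"
      unfolding \<alpha>_def diff_divide_distrib using xN(3)[OF that] by simp
    finally show ?thesis .
  qed
  obtain x0 where x0: "x0 \<in> N" using N unfolding N_def by blast
  \<comment> \<open>For x other than x0 the difference g x - g x0 is an eigenfunction with value 1
    at x, so reproduction lowers the value of \<open>Kg\<close> by exactly 1.\<close>
  have val: "inner (K x) (g x0) = (if x = x0 then 1 else 0) - \<alpha> y x" if x: "x \<in> N" for x
  proof (cases "x = x0")
    case False
    have "adjop E (g x - g x0) = t *\<^sub>R (g x - g x0)"
      using g[OF x] g[OF x0] by (simp add: A.diff scaleR_diff_right)
    from K_reproduces[OF xN(2)[OF x] this]
    have "inner (K x) (g x) - inner (K x) (g x0) = 1"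
      using gc[OF x x] gc[OF x0 x] False by (simp add: inner_diff_right)
    then show ?thesis using Kg[OF x] False by simp
  qed (use Kg x in simp)
  \<comment> \<open>By symmetry of the kernel, the value of this sum at z is A K_z at y, that is t
    K_z(y) = t K_y(z), and \<open>K y\<close> is zero since y lies outside \<open>S\<close>.\<close>
  have "(\<Sum>x\<in>E `` {y}. K x) = 0"
  proof (rule l2_eqI)
    fix z
    show "coord (\<Sum>x\<in>E `` {y}. K x) z = coord 0 z"
    proof (cases "z \<in> V")
      case True
      have "(\<Sum>x\<in>E `` {y}. coord (K x) z) = (\<Sum>x\<in>E `` {y}. coord (K z) x)"
        by (rule sum.cong) (use E_V True coord_K_commute in auto)
      also have "\<dots> = coord (adjop E (K z)) y" by (simp add: coord_adjop adj_def)
      also have "\<dots> = t * coord (K y) z" using K_ker[OF True] coord_K_commute[OF True y(1)] by simp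
      finally show ?thesis using K_eq_0[OF y] by (simp add: coord_sum)
    next
      case False
      then show ?thesis using E_V K_supported by (auto simp: coord_sum supported_def intro!: sum.neutral)
    qed
  qed
  then have "0 = (\<Sum>x\<in>E `` {y}. inner (K x) (g x0))" by (simp flip: inner_sum_left)
  also have "\<dots> = (\<Sum>x\<in>N. inner (K x) (g x0))"
    unfolding N_def
  proof (rule sum.mono_neutral_right)
    show "\<forall>i\<in>E `` {y} - E `` {y} \<inter> S. inner (K i) (g x0) = 0"
    proof
      fix i assume "i \<in> E `` {y} - E `` {y} \<inter> S"
      then have "K i = 0" using E_V by (intro K_eq_0) auto
      then show "inner (K i) (g x0) = 0" by simp
    qed
  qed (use finite_nbrs in auto)
  also have "\<dots> = (\<Sum>x\<in>N. (if x = x0 then 1 else 0) - \<alpha> y x)"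
    by (rule sum.cong) (use val in auto)
  also have "\<dots> = 1 - (\<Sum>x\<in>N. \<alpha> y x)"
    using x0 finN by (simp add: sum_subtractf)
  finally show ?thesis unfolding N_def by simp
qed

text \<open>Scaling \<open>K x\<close> multiplies both numerator and denominator of \<alpha> by the
  square of the factor, as \<open>coord (K x) x\<close> is a squared norm. All edges leaving one
  component can thus be measured with a single function.\<close>

lemma \<alpha>_comp:
  assumes "x0 \<in> S" "x \<in> component x0"
  shows "\<alpha> y x = (norm (restr (branch E y x) (K x0)))\<^sup>2 / coord (K x0) x0"
proof -
  obtain c where c: "c \<noteq> 0" "K x = c *\<^sub>R K x0" using K_proportional[OF assms] by blast
  have V: "x \<in> V" "x0 \<in> V" using assms comp_subset_S by (auto simp: S_def)
  have "restr B (c *\<^sub>R K x0) = c *\<^sub>R restr B (K x0)" for B by (rule l2_eqI) simp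
  then show ?thesis
    unfolding \<alpha>_def coord_K_diag[OF V(1)] coord_K_diag[OF V(2)]
    unfolding c(2) using c(1) by (simp add: power_mult_distrib)
qed

text \<open>The branches beyond the edges leaving the component are pairwise disjoint, so the sum is
  the fraction of the squared norm of \<open>K x0\<close> lying in their union. That union misses
  x0, where \<open>K x0\<close> does not vanish.\<close>

lemma sum_\<alpha>_component:
  assumes x0: "x0 \<in> S" and fin: "finite (component x0)"
  shows "(\<Sum>x\<in>component x0. \<Sum>y\<in>E `` {x} - S. \<alpha> y x) < 1"
proof -
  let ?C = "component x0"
  define F where "F = (SIGMA x:?C. E `` {x} - S)"
  have finF: "finite F" unfolding F_def using fin finite_nbrs by auto
  have CS: "?C \<subseteq> S" by (rule comp_subset_S[OF x0])
  have F: "(x, y) \<in> E" "x \<in> ?C" "y \<notin> ?C" if "(x, y) \<in> F" for x y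
    using that CS unfolding F_def by auto
  let ?B = "\<lambda>p. branch E (snd p) (fst p)"
  have disj: "disjoint_family_on ?B F"
    unfolding disjoint_family_on_def
  proof (intro ballI impI)
    fix p q assume pq: "p \<in> F" "q \<in> F" "p \<noteq> q"
    obtain x y x' y' where p: "p = (x, y)" "q = (x', y')" by (cases p, cases q)
    note Fp = F[OF pq(1)[unfolded p]] and Fq = F[OF pq(2)[unfolded p]]
    have "(x', y') \<noteq> (x, y)" using pq(3) p by auto
    then have "branch E y x \<inter> branch E y' x' = {}"
      using Fp Fq by (intro component_branches_disjoint(2)[of ?C x y x' y']) (auto intro: comp_connected)
    then show "?B p \<inter> ?B q = {}" by (simp add: p)
  qed
  have x0U: "x0 \<notin> (\<Union>p\<in>F. ?B p)"
  proof
    assume "x0 \<in> (\<Union>p\<in>F. ?B p)"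
    then obtain x y where xy: "(x, y) \<in> F" "x0 \<in> branch E y x" by auto
    then show False
      using component_branches_disjoint(1)[of ?C x y] comp_connected F[OF xy(1)] comp_self by blast
  qed
  have V: "x0 \<in> V" and pos: "coord (K x0) x0 > 0" using x0 by (auto simp: S_def)
  have "(\<Sum>x\<in>?C. \<Sum>y\<in>E `` {x} - S. \<alpha> y x) = (\<Sum>p\<in>F. \<alpha> (snd p) (fst p))"
    unfolding F_def using fin finite_nbrs by (subst sum.Sigma) (auto simp: case_prod_beta)
  also have "\<dots> = (\<Sum>p\<in>F. (norm (restr (?B p) (K x0)))\<^sup>2) / coord (K x0) x0"
    unfolding sum_divide_distrib by (rule sum.cong) (use F \<alpha>_comp[OF x0] in auto)
  also have "\<dots> = (norm (restr (\<Union>p\<in>F. ?B p) (K x0)))\<^sup>2 / coord (K x0) x0"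
    using norm_restr_UN_sq[OF finF disj] by simp
  also have "\<dots> < 1"
  proof -
    let ?U = "\<Union>p\<in>F. ?B p"
    have "(norm (K x0))\<^sup>2 = (norm (restr ?U (K x0)))\<^sup>2 + (norm (restr (- ?U) (K x0)))\<^sup>2"
      by (rule norm_restr_split[OF K_supported[OF V]]) auto
    moreover have "(norm (restr (- ?U) (K x0)))\<^sup>2 > 0"
    proof -
      have "coord (restr (- ?U) (K x0)) x0 \<noteq> 0" using x0U pos by simp
      then have "restr (- ?U) (K x0) \<noteq> 0" by (metis coord_zero)
      then show ?thesis by simp
    qed
    ultimately show ?thesis using coord_K_diag[OF V] pos by simp
  qed
  finally show ?thesis .
qed

text \<open>Neighbours outside the component are outside \<open>S\<close>, where \<open>K x0\<close>
  vanishes, so restricting the neighbourhood sum loses nothing.\<close>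

lemma component_eigenvector:
  assumes x0: "x0 \<in> S" and z: "z \<in> component x0"
  shows "(\<Sum>w\<in>E `` {z} \<inter> component x0. coord (K x0) w) = t * coord (K x0) z"
proof -
  have V: "x0 \<in> V" using x0 by (auto simp: S_def)
  have zS: "z \<in> S" using z comp_subset_S[OF x0] by auto
  have "(\<Sum>w\<in>E `` {z} \<inter> component x0. coord (K x0) w) = (\<Sum>w\<in>E `` {z}. coord (K x0) w)"
  proof (rule sum.mono_neutral_left)
    show "\<forall>w\<in>E `` {z} - E `` {z} \<inter> component x0. coord (K x0) w = 0"
    proof
      fix w assume w: "w \<in> E `` {z} - E `` {z} \<inter> component x0"
      then have "w \<notin> S" using comp_step[OF z zS] by blast
      moreover have "w \<in> V" using w E_V by auto
      ultimately show "coord (K x0) w = 0" using K_eq_0 coord_K_commute[OF V, of w] by simp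
    qed
  qed (use finite_nbrs in auto)
  also have "\<dots> = coord (adjop E (K x0)) z" by (simp add: coord_adjop adj_def)
  finally show ?thesis using K_ker[OF V] by simp
qed

end

section \<open>Eigenvalues of finite trees\<close>

text \<open>\<open>tree_complexity\<close> refers to trees on initial segments of the naturals, so a
  component must be relabelled.\<close>

lemma is_tree_bij_image:
  assumes h: "bij_betw h A C" and tree: "is_tree C F"
  shows "is_tree A {(i, j). i \<in> A \<and> j \<in> A \<and> (h i, h j) \<in> F}"
proof -
  let ?F = "{(i, j). i \<in> A \<and> j \<in> A \<and> (h i, h j) \<in> F}"
  have F: "F \<subseteq> C \<times> C" "sym F" "irrefl F" and conn: "\<And>x y. x \<in> C \<Longrightarrow> y \<in> C \<Longrightarrow> (x, y) \<in> F\<^sup>*"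
    and ne: "C \<noteq> {}" and acyc: "\<And>xs. \<not> is_cycle F xs"
    using tree by (auto simp: is_tree_def simple_graph_def graph_connected_def)
  have inj: "inj_on h A" and im: "h ` A = C" using h by (auto simp: bij_betw_def)
  have path: "j \<in> A \<Longrightarrow> h j = v \<Longrightarrow> (i, j) \<in> ?F\<^sup>*" if i: "i \<in> A" and "(h i, v) \<in> F\<^sup>*" for i j v
    using that(2)
  proof (induction arbitrary: j rule: rtrancl_induct)
    case base
    then show ?case using inj_onD[OF inj, of j i] i by simp
  next
    case (step u v)
    then have "u \<in> h ` A" using F im by auto
    then obtain k where k: "k \<in> A" "h k = u" by auto
    have "(k, j) \<in> ?F" using k step by auto
    then show ?case using step.IH[OF k] by (rule rtrancl_into_rtrancl[rotated])
  qed
  have "\<not> is_cycle ?F xs" for xs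
  proof
    assume c: "is_cycle ?F xs"
    then have sub: "set xs \<subseteq> A" by (auto simp: is_cycle_def in_set_conv_nth)
    have len: "length xs \<ge> 3" using c by (simp add: is_cycle_def)
    have "is_cycle F (map h xs)"
      unfolding is_cycle_def
    proof (intro conjI allI impI)
      show "distinct (map h xs)"
        using c sub inj by (auto simp: is_cycle_def distinct_map intro: inj_on_subset)
      fix i assume i: "i < length (map h xs)"
      then have "(xs ! i, xs ! (Suc i mod length xs)) \<in> ?F" using c by (simp add: is_cycle_def)
      moreover have "Suc i mod length xs < length xs" using len by (intro mod_less_divisor) linarith
      ultimately show "(map h xs ! i, map h xs ! (Suc i mod length (map h xs))) \<in> F" using i by simp
    qed (use len in simp)
    then show False using acyc by blast
  qed
  moreover have "simple_graph A ?F"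
    using F by (auto simp: simple_graph_def sym_def irrefl_def)
  moreover have "graph_connected A ?F"
    unfolding graph_connected_def
  proof (intro conjI ballI)
    show "A \<noteq> {}" using ne im by auto
    fix i j assume "i \<in> A" "j \<in> A"
    then show "(i, j) \<in> ?F\<^sup>*" using path[OF _ conn, of i "h j" j] im by blast
  qed
  ultimately show ?thesis by (auto simp: is_tree_def)
qed

lemma eigenvalue_symmetric_real:
  fixes A :: "complex mat"
  assumes A: "A \<in> carrier_mat n n" and sym: "\<And>i j. i < n \<Longrightarrow> j < n \<Longrightarrow> A $$ (i, j) = A $$ (j, i)"
    and re: "\<And>i j. i < n \<Longrightarrow> j < n \<Longrightarrow> A $$ (i, j) \<in> \<real>" and ev: "eigenvalue A z"
  shows "z \<in> \<real>"
proof -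
  obtain v where v: "v \<in> carrier_vec n" "v \<noteq> 0\<^sub>v n" "A *\<^sub>v v = z \<cdot>\<^sub>v v"
    using ev A by (auto simp: eigenvalue_def eigenvector_def)
  have row: "(\<Sum>j<n. A $$ (i, j) * v $ j) = z * v $ i" if i: "i < n" for i
  proof -
    have "(A *\<^sub>v v) $ i = (\<Sum>j<n. A $$ (i, j) * v $ j)"
      using A v(1) i by (auto simp: scalar_prod_def lessThan_atLeast0 intro!: sum.cong)
    then show ?thesis using v(1) i by (simp add: v(3))
  qed
  define s where "s = (\<Sum>i<n. \<Sum>j<n. cnj (v $ i) * A $$ (i, j) * v $ j)"
  have "s = (\<Sum>i<n. cnj (v $ i) * (z * v $ i))"
    unfolding s_def by (rule sum.cong) (simp_all add: row[symmetric] sum_distrib_left mult.assoc)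
  moreover have "cnj w * (z * w) = z * of_real ((cmod w)\<^sup>2)" for w
    by (simp add: complex_norm_square del: of_real_power)
  ultimately have s1: "s = z * of_real (\<Sum>i<n. (cmod (v $ i))\<^sup>2)"
    by (simp add: sum_distrib_left)
  have "cnj s = (\<Sum>i<n. \<Sum>j<n. cnj (v $ j) * A $$ (j, i) * v $ i)"
    unfolding s_def cnj_sum
  proof (intro sum.cong refl)
    fix i j assume "i \<in> {..<n}" "j \<in> {..<n}"
    then have "cnj (A $$ (i, j)) = A $$ (j, i)" using re sym by (simp add: Reals_cnj_iff)
    then show "cnj (cnj (v $ i) * A $$ (i, j) * v $ j) = cnj (v $ j) * A $$ (j, i) * v $ i"
      by (simp add: algebra_simps)
  qed
  also have "\<dots> = s" unfolding s_def by (rule sum.swap)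
  finally have "cnj z * of_real (\<Sum>i<n. (cmod (v $ i))\<^sup>2) = z * of_real (\<Sum>i<n. (cmod (v $ i))\<^sup>2)"
    unfolding s1 by simp
  moreover have "(\<Sum>i<n. (cmod (v $ i))\<^sup>2) \<noteq> 0"
  proof
    assume "(\<Sum>i<n. (cmod (v $ i))\<^sup>2) = 0"
    then have "\<forall>i<n. v $ i = 0" by (subst (asm) sum_nonneg_eq_0_iff) auto
    then show False using v(1,2) by auto
  qed
  ultimately have "cnj z = z" by (simp del: of_real_sum of_real_power)
  then show ?thesis by (simp add: Reals_cnj_iff)
qed

text \<open>The characteristic polynomial of the integer adjacency matrix is the monic witness; its
  complex roots are eigenvalues of a real symmetric matrix, hence real.\<close>

theorem finite_tree_eigenvalue:
  fixes C :: "nat set" and f :: "nat \<Rightarrow> real"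
  assumes C: "finite C" and tree: "is_tree C F"
    and x0: "x0 \<in> C" "f x0 \<noteq> 0" and ev: "\<And>z. z \<in> C \<Longrightarrow> (\<Sum>w\<in>F `` {z}. f w) = t * f z"
  shows "t \<in> totally_real_algebraic_integers" "tree_complexity t \<le> card C"
proof -
  define n where "n = card C"
  obtain h where h: "bij_betw h {..<n} C"
    using ex_bij_betw_nat_finite[OF C] by (auto simp: n_def lessThan_atLeast0)
  define F' where "F' = {(i, j). i \<in> {..<n} \<and> j \<in> {..<n} \<and> (h i, h j) \<in> F}"
  have tree': "is_tree {..<n} F'" unfolding F'_def by (rule is_tree_bij_image[OF h tree])
  have FC: "F \<subseteq> C \<times> C" and symF: "sym F" using tree by (auto simp: is_tree_def simple_graph_def)
  have hC: "h i \<in> C" if "i < n" for i using h that by (auto dest: bij_betwE)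
  have ev': "eigenvalue (adjacency_matrix n F') t"
  proof -
    let ?v = "vec n (\<lambda>i. f (h i))"
    have "adjacency_matrix n F' *\<^sub>v ?v = t \<cdot>\<^sub>v ?v"
    proof (rule eq_vecI)
      fix i assume "i < dim_vec (t \<cdot>\<^sub>v ?v)"
      then have i: "i < n" by simp
      have "(adjacency_matrix n F' *\<^sub>v ?v) $ i = (\<Sum>j<n. (if (i, j) \<in> F' then 1 else 0) * f (h j))"
        using i by (auto simp: adjacency_matrix_def scalar_prod_def lessThan_atLeast0 intro!: sum.cong)
      also have "\<dots> = (\<Sum>j<n. if (h i, h j) \<in> F then f (h j) else 0)"
        using i by (intro sum.cong) (auto simp: F'_def)
      also have "\<dots> = (\<Sum>w\<in>C. if (h i, w) \<in> F then f w else 0)"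
        using sum.reindex_bij_betw[OF h, of "\<lambda>w. if (h i, w) \<in> F then f w else 0"] .
      also have "\<dots> = (\<Sum>w\<in>F `` {h i}. f w)"
        by (rule sum.mono_neutral_cong_right) (use C FC in auto)
      finally show "(adjacency_matrix n F' *\<^sub>v ?v) $ i = (t \<cdot>\<^sub>v ?v) $ i"
        using ev[OF hC[OF i]] i by simp
    qed (simp add: adjacency_matrix_def)
    moreover have "?v \<noteq> 0\<^sub>v n"
    proof
      assume 0: "?v = 0\<^sub>v n"
      obtain i where i: "i < n" "h i = x0" using h x0(1) by (auto simp: bij_betw_def)
      have "?v $ i = 0" unfolding 0 using i by simp
      then show False using i x0 by simp
    qed
    ultimately show ?thesis
      unfolding eigenvalue_def eigenvector_def
      by (intro exI[of _ ?v]) (simp add: adjacency_matrix_def)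
  qed
  show "tree_complexity t \<le> card C"
    unfolding tree_complexity_def n_def[symmetric] by (rule Least_le) (use tree' ev' in blast)
  define A :: "int mat" where "A = Matrix.mat n n (\<lambda>(i, j). if (i, j) \<in> F' then 1 else 0)"
  have A: "A \<in> carrier_mat n n" by (simp add: A_def)
  have Ar: "map_mat of_int A = adjacency_matrix n F'"
    by (rule eq_matI) (auto simp: A_def adjacency_matrix_def)
  have "poly (map_poly of_int (char_poly A)) t = 0"
    using ev' eigenvalue_root_char_poly[of "map_mat real_of_int A" n t] A
    by (simp add: Ar[symmetric] of_int_hom.char_poly_hom[OF A])
  moreover have "lead_coeff (char_poly A) = 1"
    using degree_monic_char_poly[OF A] by simp
  moreover have "z \<in> \<real>" if z: "poly (map_poly of_int (char_poly A)) z = 0" for z :: complex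
  proof (rule eigenvalue_symmetric_real)
    show "eigenvalue (map_mat of_int A) z"
      using z eigenvalue_root_char_poly[of "map_mat complex_of_int A" n z] A
      by (simp add: of_int_hom.char_poly_hom[OF A])
  qed (use A symF in \<open>auto simp: A_def F'_def dest: symD\<close>)
  ultimately show "t \<in> totally_real_algebraic_integers"
    unfolding totally_real_algebraic_integers_def by blast
qed

section \<open>Balance of mass between components and their boundaries\<close>

text \<open>Everything here is built from the edge relation alone and is measurable on all networks.
  Its relation to eigenfunctions is established in \<open>network_eigenspace\<close>, for trees of
  bounded degree.\<close>

locale kernel_parameters =
  fixes M t :: real
begin

abbreviation ke :: "nat rel \<Rightarrow> nat \<Rightarrow> nat \<Rightarrow> real" where
  "ke \<equiv> kernel_entry M t"

definition in_supp :: "nat rel \<Rightarrow> nat \<Rightarrow> bool" where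
  "in_supp E x \<longleftrightarrow> ke E x x > 0"

definition supp_rel :: "nat rel \<Rightarrow> nat rel" where
  "supp_rel E = {(a, b). (a, b) \<in> E \<and> in_supp E a \<and> in_supp E b}"

definition comp_size :: "nat rel \<Rightarrow> nat \<Rightarrow> ennreal" where
  "comp_size E x = (\<integral>\<^sup>+w. (if (x, w) \<in> (supp_rel E)\<^sup>* then 1 else 0) \<partial>count_space (verts_of E x))"

text \<open>
  \<open>share\<close> is \<open>\<alpha>\<close> written in terms of the kernel entries, and \<open>transport \<beta>\<close> sends from each boundary
  vertex \<open>y\<close> the mass \<open>\<beta> y x\<close> to the component of each neighbour \<open>x\<close>, spread uniformly.
\<close>

definition share :: "nat rel \<Rightarrow> nat \<Rightarrow> nat \<Rightarrow> ennreal" where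
  "share E y x = (\<integral>\<^sup>+z. (if z \<in> branch E y x then ennreal ((ke E x z)\<^sup>2) else 0) \<partial>count_space (verts_of E y))
     / ennreal (ke E x x)"

definition transport :: "(nat rel \<Rightarrow> nat \<Rightarrow> nat \<Rightarrow> ennreal) \<Rightarrow> nat rel \<Rightarrow> nat \<Rightarrow> nat \<Rightarrow> ennreal" where
  "transport \<beta> E y w = (\<integral>\<^sup>+x. (if (x, y) \<in> E \<and> \<not> in_supp E y \<and> in_supp E x \<and> (x, w) \<in> (supp_rel E)\<^sup>*
     then \<beta> E y x / comp_size E x else 0) \<partial>count_space (verts_of E y))"

lemma nets_hd: "p \<in> nets k \<Longrightarrow> k > 0 \<Longrightarrow> hd (snd p) = snd p ! 0"
  by (erule nets_E) auto

lemma measurable_ke: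
  assumes "i < k" "j < k"
  shows "(\<lambda>p. ke (fst p) (snd p ! i) (snd p ! j)) \<in> borel_measurable (netM k)"
  using measurable_proj2[OF measurable_kernel_entry assms, of M t] by simp

lemma measurable_in_supp:
  assumes "i < k"
  shows "Measurable.pred (netM k) (\<lambda>p. in_supp (fst p) (snd p ! i))"
  using measurable_ke[OF assms assms] unfolding in_supp_def by measurable

lemma measurable_comp_rel:
  assumes "i < k" "j < k"
  shows "Measurable.pred (netM k) (\<lambda>p. (snd p ! i, snd p ! j) \<in> (supp_rel (fst p))\<^sup>*)"
proof -
  let ?Q = "\<lambda>p. (snd p ! 0, snd p ! 1) \<in> fst p \<and> in_supp (fst p) (snd p ! 0) \<and> in_supp (fst p) (snd p ! 1)"
  have [measurable]: "Measurable.pred (netM 2) (\<lambda>p. (snd p ! 0, snd p ! 1) \<in> fst p)"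
    "Measurable.pred (netM 2) (\<lambda>p. in_supp (fst p) (snd p ! 0))"
    "Measurable.pred (netM 2) (\<lambda>p. in_supp (fst p) (snd p ! 1))"
    by (rule pred_adjacent measurable_in_supp; simp)+
  have "Measurable.pred (netM (0 + 2)) ?Q" unfolding add_0 by measurable
  from pred_reachable[OF this]
  have "Measurable.pred (netM 2) (\<lambda>p. (snd p ! 0, snd p ! 1) \<in> (supp_rel (fst p))\<^sup>*)"
    by (simp add: supp_rel_def numeral_2_eq_2)
  from measurable_proj2[OF this assms] show ?thesis by simp
qed

lemma measurable_comp_size:
  assumes "i < k"
  shows "(\<lambda>p. comp_size (fst p) (snd p ! i)) \<in> borel_measurable (netM k)"
proof -
  have [measurable]: "Measurable.pred (netM (Suc 1)) (\<lambda>p. (snd p ! 1, snd p ! 0) \<in> (supp_rel (fst p))\<^sup>*)"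
    by (rule measurable_comp_rel) auto
  have "(\<lambda>p. if (snd p ! 1, snd p ! 0) \<in> (supp_rel (fst p))\<^sup>* then 1 else 0 :: ennreal) \<in> borel_measurable (netM (Suc 1))"
    by measurable
  from measurable_verts_sum[OF this]
  have m: "(\<lambda>p. \<integral>\<^sup>+z. (if (snd p ! 0, z) \<in> (supp_rel (fst p))\<^sup>* then 1 else 0) \<partial>count_space (verts_of (fst p) (hd (snd p)))) \<in> borel_measurable (netM 1)"
    by simp
  have "comp_size (fst p) (snd p ! 0) = (\<integral>\<^sup>+z. (if (snd p ! 0, z) \<in> (supp_rel (fst p))\<^sup>* then 1 else 0) \<partial>count_space (verts_of (fst p) (hd (snd p))))"
    if "p \<in> nets 1" for p
    by (simp add: comp_size_def nets_hd[OF that])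
  then have "(\<lambda>p. comp_size (fst p) (snd p ! 0)) \<in> borel_measurable (netM 1)"
    using m by (subst measurable_cong) simp_all
  from measurable_proj1[OF this assms] show ?thesis by simp
qed

lemma measurable_branch:
  "Measurable.pred (netM 3) (\<lambda>p. snd p ! 0 \<in> branch (fst p) (snd p ! 1) (snd p ! 2))"
proof -
  let ?Q = "\<lambda>p. (snd p ! 0, snd p ! 1) \<in> fst p \<and> \<not> (snd p ! 0 = snd p ! 2 \<and> snd p ! 1 = snd p ! 3)
     \<and> \<not> (snd p ! 0 = snd p ! 3 \<and> snd p ! 1 = snd p ! 2)"
  have [measurable]: "Measurable.pred (netM 4) (\<lambda>p. (snd p ! 0, snd p ! 1) \<in> fst p)"
    "Measurable.pred (netM 4) (\<lambda>p. snd p ! 0 = snd p ! 2)" "Measurable.pred (netM 4) (\<lambda>p. snd p ! 0 = snd p ! 3)"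
    "Measurable.pred (netM 4) (\<lambda>p. snd p ! 1 = snd p ! 2)" "Measurable.pred (netM 4) (\<lambda>p. snd p ! 1 = snd p ! 3)"
    by (rule pred_adjacent pred_equal; simp)+
  have "Measurable.pred (netM 4) ?Q" by measurable
  then have "Measurable.pred (netM (2 + 2)) ?Q" by simp
  then have r: "Measurable.pred (netM (2 + 2)) (\<lambda>p. (snd p ! 0, snd p ! 1) \<in> {(a, b). ?Q (fst p, a # b # drop 2 (snd p))}\<^sup>*)"
    by (rule pred_reachable) simp
  \<comment> \<open>A branch is reachability from index 1 to index 0 with the deleted edge, indices
    1 and 2, passed as parameters; this explains the selection [1, 0, 1, 2].\<close>
  have eq: "snd p ! 0 \<in> branch (fst p) (snd p ! 1) (snd p ! 2) \<longleftrightarrow>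
     (\<lambda>p. (snd p ! 0, snd p ! 1) \<in> {(a, b). ?Q (fst p, a # b # drop 2 (snd p))}\<^sup>*) (fst p, map ((!) (snd p)) [1, 0, 1, 2])"
    for p :: "nat rel \<times> nat list"
  proof -
    have "{(a, b). ?Q (fst p, a # b # [snd p ! 1, snd p ! 2])} = fst p - {(snd p ! 1, snd p ! 2), (snd p ! 2, snd p ! 1)}"
      by auto
    then show ?thesis by (simp add: branch_def)
  qed
  have "(\<lambda>p. (fst p, map ((!) (snd p)) [1, 0, 1, 2])) \<in> measurable (netM 3) (netM (length [1::nat, 0, 1, 2]))"
    by (rule measurable_proj) auto
  then have "(\<lambda>p. (fst p, map ((!) (snd p)) [1, 0, 1, 2])) \<in> measurable (netM 3) (netM (2 + 2))"
    by (simp add: eval_nat_numeral)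
  from measurable_compose[OF this r] show ?thesis unfolding eq .
qed

lemma measurable_share [measurable]:
  "(\<lambda>p. share (fst p) (snd p ! 0) (snd p ! 1)) \<in> borel_measurable (netM 2)"
proof -
  have three: "netM (Suc 2) = netM 3" by (simp add: eval_nat_numeral)
  have [measurable]: "Measurable.pred (netM (Suc 2)) (\<lambda>p. snd p ! 0 \<in> branch (fst p) (snd p ! 1) (snd p ! 2))"
    unfolding three by (rule measurable_branch)
  have [measurable]: "(\<lambda>p. ke (fst p) (snd p ! 2) (snd p ! 0)) \<in> borel_measurable (netM (Suc 2))"
    by (rule measurable_ke) auto
  have "(\<lambda>p. if snd p ! 0 \<in> branch (fst p) (snd p ! 1) (snd p ! 2) then ennreal ((ke (fst p) (snd p ! 2) (snd p ! 0))\<^sup>2) else 0)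
      \<in> borel_measurable (netM (Suc 2))" by measurable
  from measurable_verts_sum[OF this]
  have m: "(\<lambda>p. \<integral>\<^sup>+z. (if z \<in> branch (fst p) (snd p ! 0) (snd p ! 1) then ennreal ((ke (fst p) (snd p ! 1) z)\<^sup>2) else 0)
      \<partial>count_space (verts_of (fst p) (hd (snd p)))) \<in> borel_measurable (netM 2)" by (simp cong: if_cong)
  have [measurable]: "(\<lambda>p. ke (fst p) (snd p ! 1) (snd p ! 1)) \<in> borel_measurable (netM 2)"
    by (rule measurable_ke) auto
  have eq: "share (fst p) (snd p ! 0) (snd p ! 1) =
     (\<integral>\<^sup>+z. (if z \<in> branch (fst p) (snd p ! 0) (snd p ! 1) then ennreal ((ke (fst p) (snd p ! 1) z)\<^sup>2) else 0)
      \<partial>count_space (verts_of (fst p) (hd (snd p)))) / ennreal (ke (fst p) (snd p ! 1) (snd p ! 1))"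
    if "p \<in> nets 2" for p
    by (simp only: share_def nets_hd[OF that zero_less_numeral])
  show ?thesis
    by (subst measurable_cong[OF eq], simp, rule borel_measurable_divide_ennreal[OF m]) measurable
qed

lemma measurable_transport:
  assumes "(\<lambda>p. \<beta> (fst p) (snd p ! 0) (snd p ! 1)) \<in> borel_measurable (netM 2)"
  shows "(\<lambda>p. transport \<beta> (fst p) (snd p ! 0) (snd p ! 1)) \<in> borel_measurable (netM 2)"
proof -
  have [measurable]: "(\<lambda>p. \<beta> (fst p) (snd p ! 1) (snd p ! 0)) \<in> borel_measurable (netM (Suc 2))"
    using measurable_proj2[OF assms, of 1 "Suc 2" 0] by simp
  have [measurable]: "Measurable.pred (netM (Suc 2)) (\<lambda>p. (snd p ! 0, snd p ! 1) \<in> fst p)"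
    "Measurable.pred (netM (Suc 2)) (\<lambda>p. in_supp (fst p) (snd p ! 0))"
    "Measurable.pred (netM (Suc 2)) (\<lambda>p. in_supp (fst p) (snd p ! 1))"
    "Measurable.pred (netM (Suc 2)) (\<lambda>p. (snd p ! 0, snd p ! 2) \<in> (supp_rel (fst p))\<^sup>*)"
    "(\<lambda>p. comp_size (fst p) (snd p ! 0)) \<in> borel_measurable (netM (Suc 2))"
    by (rule pred_adjacent measurable_in_supp measurable_comp_rel measurable_comp_size; simp)+
  have "(\<lambda>p. if (snd p ! 0, snd p ! 1) \<in> fst p \<and> \<not> in_supp (fst p) (snd p ! 1) \<and> in_supp (fst p) (snd p ! 0) \<and>
      (snd p ! 0, snd p ! 2) \<in> (supp_rel (fst p))\<^sup>* then \<beta> (fst p) (snd p ! 1) (snd p ! 0) / comp_size (fst p) (snd p ! 0) else 0)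
      \<in> borel_measurable (netM (Suc 2))"
    by (intro measurable_If borel_measurable_divide_ennreal; measurable)
  from measurable_verts_sum[OF this zero_less_numeral]
  have m: "(\<lambda>p. \<integral>\<^sup>+x. (if (x, snd p ! 0) \<in> fst p \<and> \<not> in_supp (fst p) (snd p ! 0) \<and> in_supp (fst p) x \<and>
      (x, snd p ! 1) \<in> (supp_rel (fst p))\<^sup>* then \<beta> (fst p) (snd p ! 0) x / comp_size (fst p) x else 0)
      \<partial>count_space (verts_of (fst p) (hd (snd p)))) \<in> borel_measurable (netM 2)"
    by (simp only: fst_conv snd_conv nth_Cons_0 nth_Cons_Suc One_nat_def numeral_2_eq_2)
  have eq: "transport \<beta> (fst p) (snd p ! 0) (snd p ! 1) =
     (\<integral>\<^sup>+x. (if (x, snd p ! 0) \<in> fst p \<and> \<not> in_supp (fst p) (snd p ! 0) \<and> in_supp (fst p) x \<and>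
      (x, snd p ! 1) \<in> (supp_rel (fst p))\<^sup>* then \<beta> (fst p) (snd p ! 0) x / comp_size (fst p) x else 0)
      \<partial>count_space (verts_of (fst p) (hd (snd p))))"
    if "p \<in> nets 2" for p
    by (simp only: transport_def nets_hd[OF that zero_less_numeral])
  show ?thesis by (subst measurable_cong[OF eq], simp, rule m)
qed

end

section \<open>Evaluation of the transports on a tree of bounded degree\<close>

locale network_eigenspace = tree_eigenspace V E D t K + kernel_parameters M t
  for V :: "nat set" and E D t K M +
  assumes network: "network_graph V E"
    and ke_eq: "\<And>x y. x \<in> V \<Longrightarrow> y \<in> V \<Longrightarrow> kernel_entry M t E x y = coord (K y) x"
begin

lemma verts: "x \<in> V \<Longrightarrow> verts_of E x = V"
  by (rule verts_of_eq[OF network])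

lemma in_supp_iff: "x \<in> V \<Longrightarrow> in_supp E x \<longleftrightarrow> x \<in> S"
  by (simp add: in_supp_def S_def ke_eq)

lemma supp_rel_eq: "supp_rel E = E \<inter> S \<times> S"
  using E_V in_supp_iff unfolding supp_rel_def by blast

lemma comp_iff: "(x, w) \<in> (supp_rel E)\<^sup>* \<longleftrightarrow> w \<in> component x"
  by (simp add: supp_rel_eq component_def)

lemma S_V: "S \<subseteq> V" by (auto simp: S_def)

lemma comp_size_eq:
  assumes "x \<in> S"
  shows "comp_size E x = (\<integral>\<^sup>+w. 1 \<partial>count_space (component x))"
proof -
  have sub: "component x \<subseteq> V" using comp_subset_S[OF assms] S_V by blast
  have "comp_size E x = (\<integral>\<^sup>+w. (if w \<in> component x then 1 else 0) \<partial>count_space V)"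
    unfolding comp_size_def comp_iff using assms S_V verts[of x] by auto
  also have "\<dots> = (\<integral>\<^sup>+w. 1 \<partial>count_space (component x))"
    by (subst (1 2) nn_integral_count_space_indicator)
       (use sub in \<open>auto intro!: nn_integral_cong simp: indicator_def\<close>)
  finally show ?thesis .
qed

lemma comp_size_finite: "x \<in> S \<Longrightarrow> finite (component x) \<Longrightarrow> comp_size E x = of_nat (card (component x))"
  by (simp add: comp_size_eq nn_integral_count_space_finite)

lemma comp_size_infinite: "x \<in> S \<Longrightarrow> infinite (component x) \<Longrightarrow> comp_size E x = \<infinity>"
  by (simp add: comp_size_eq)

lemma nn_integral_coord_sq:
  assumes "supported V u"
  shows "(\<integral>\<^sup>+z. (if z \<in> B then ennreal ((coord u z)\<^sup>2) else 0) \<partial>count_space V) = ennreal ((norm (restr B u))\<^sup>2)"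
proof -
  have "(\<integral>\<^sup>+z. (if z \<in> B then ennreal ((coord u z)\<^sup>2) else 0) \<partial>count_space V)
     = (\<integral>\<^sup>+z. ennreal ((coord (restr B u) z)\<^sup>2) \<partial>count_space UNIV)"
    by (subst nn_integral_count_space_indicator)
       (use assms in \<open>auto intro!: nn_integral_cong simp: supported_def indicator_def\<close>)
  also have "\<dots> = (\<Sum>z. ennreal ((coord (restr B u) z)\<^sup>2))"
    by (rule nn_integral_count_space_nat)
  also have "\<dots> = ennreal (\<Sum>z. (coord (restr B u) z)\<^sup>2)"
    by (rule suminf_ennreal2) (rule zero_le_power2, rule summable_coord_sq)
  finally show ?thesis by (simp only: norm_l2_sq)
qed

lemma share_eq:
  assumes "x \<in> S" "y \<in> V"
  shows "share E y x = ennreal (\<alpha> y x)"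
proof -
  have x: "x \<in> V" "coord (K x) x > 0" using assms by (auto simp: S_def)
  have "(\<integral>\<^sup>+z. (if z \<in> branch E y x then ennreal ((ke E x z)\<^sup>2) else 0) \<partial>count_space (verts_of E y))
     = (\<integral>\<^sup>+z. (if z \<in> branch E y x then ennreal ((coord (K x) z)\<^sup>2) else 0) \<partial>count_space V)"
    unfolding verts[OF assms(2)]
    by (rule nn_integral_cong) (use x ke_eq coord_K_commute in auto)
  also have "\<dots> = ennreal ((norm (restr (branch E y x) (K x)))\<^sup>2)"
    by (rule nn_integral_coord_sq[OF K_supported[OF x(1)]])
  finally show ?thesis
    unfolding share_def \<alpha>_def using x by (simp add: ke_eq divide_ennreal)
qed

text \<open>Over all of V the squared entries of \<open>K v\<close> sum to its squared norm, which
  is \<open>coord (K v) v\<close>; restricting to the component only decreases the total.\<close>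

lemma finiteness_mass_out:
  assumes v: "v \<in> V"
  shows "(\<integral>\<^sup>+y. (if in_supp E v \<and> (v, y) \<in> (supp_rel E)\<^sup>* then ennreal ((ke E v y)\<^sup>2 / ke E v v) else 0) \<partial>count_space V) \<le> 1"
proof (cases "v \<in> S")
  case True
  then have pos: "coord (K v) v > 0" by (simp add: S_def)
  have "(\<integral>\<^sup>+y. (if in_supp E v \<and> (v, y) \<in> (supp_rel E)\<^sup>* then ennreal ((ke E v y)\<^sup>2 / ke E v v) else 0) \<partial>count_space V)
     \<le> (\<integral>\<^sup>+y. (if y \<in> UNIV then ennreal ((coord (K v) y)\<^sup>2) else 0) / ennreal (coord (K v) v) \<partial>count_space V)"
    by (rule nn_integral_mono)
       (use v pos ke_eq coord_K_commute in \<open>auto simp: divide_ennreal\<close>)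
  also have "\<dots> = ennreal ((norm (restr UNIV (K v)))\<^sup>2) / ennreal (coord (K v) v)"
    by (subst nn_integral_divide) (use nn_integral_coord_sq[OF K_supported[OF v], of UNIV] in auto)
  also have "restr UNIV (K v) = K v" by (rule l2_eqI) simp
  also have "ennreal ((norm (K v))\<^sup>2) / ennreal (coord (K v) v) = 1"
    using pos coord_K_diag[OF v] by (simp add: divide_ennreal)
  finally show ?thesis .
qed (use v in_supp_iff in simp)

text \<open>Since \<open>K x\<close> is a multiple of \<open>K v\<close> on the component, the
  quotient (K_xv)^2 / K_xx does not depend on x and equals K_vv. Every vertex of the component
  contributes this same amount.\<close>

lemma finiteness_mass_in:
  assumes v: "v \<in> S"
  shows "(\<integral>\<^sup>+x. (if in_supp E x \<and> (x, v) \<in> (supp_rel E)\<^sup>* then ennreal ((ke E x v)\<^sup>2 / ke E x x) else 0) \<partial>count_space V)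
     = ennreal (coord (K v) v) * comp_size E v"
proof -
  have oV: "v \<in> V" and pos: "coord (K v) v > 0" using v by (auto simp: S_def)
  have sub: "component v \<subseteq> S" by (rule comp_subset_S[OF v])
  have eq: "(ke E x v)\<^sup>2 / ke E x x = coord (K v) v" if x: "x \<in> component v" for x
  proof -
    obtain c where c: "c \<noteq> 0" "K x = c *\<^sub>R K v" using K_proportional[OF v x] by blast
    have xV: "x \<in> V" using x sub S_V by auto
    have "coord (K v) x = c * coord (K v) v"
      using coord_K_commute[OF oV xV] c(2) by simp
    moreover have "coord (K x) x = c * (c * coord (K v) v)"
      using calculation c(2) by simp
    ultimately show ?thesis using c(1) pos ke_eq[OF xV oV] ke_eq[OF xV xV] by (simp add: power2_eq_square)
  qed
  have "(\<integral>\<^sup>+x. (if in_supp E x \<and> (x, v) \<in> (supp_rel E)\<^sup>* then ennreal ((ke E x v)\<^sup>2 / ke E x x) else 0) \<partial>count_space V)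
     = (\<integral>\<^sup>+x. ennreal (coord (K v) v) * indicator (component v) x \<partial>count_space V)"
  proof (rule nn_integral_cong)
    fix x assume "x \<in> space (count_space V)"
    then have x: "x \<in> V" by simp
    show "(if in_supp E x \<and> (x, v) \<in> (supp_rel E)\<^sup>* then ennreal ((ke E x v)\<^sup>2 / ke E x x) else 0)
      = ennreal (coord (K v) v) * indicator (component v) x"
    proof (cases "x \<in> component v")
      case True
      then show ?thesis using eq[OF True] x sub comp_sym[OF True] by (auto simp: in_supp_iff comp_iff)
    next
      case False
      then show ?thesis using comp_sym[of v x] by (auto simp: comp_iff)
    qed
  qed
  also have "\<dots> = ennreal (coord (K v) v) * (\<integral>\<^sup>+x. indicator (component v) x \<partial>count_space V)"
    by (rule nn_integral_cmult) simp
  also have "(\<integral>\<^sup>+x. indicator (component v) x \<partial>count_space V) = comp_size E v"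
    unfolding comp_size_def comp_iff verts[OF oV] by (rule nn_integral_cong) (simp add: indicator_def)
  finally show ?thesis .
qed

lemma ennreal_div_mult_card:
  assumes "x \<in> S" "finite (component x)"
  shows "(b / comp_size E x) * comp_size E x = b"
proof -
  have "card (component x) \<noteq> 0" using assms comp_self[of x] by auto
  then have "comp_size E x \<noteq> 0" "comp_size E x \<noteq> \<top>"
    using comp_size_finite[OF assms] by simp_all
  then show ?thesis
    by (metis ennreal_times_divide mult.commute mult_divide_eq_ennreal)
qed

definition edge_mass :: "(nat rel \<Rightarrow> nat \<Rightarrow> nat \<Rightarrow> ennreal) \<Rightarrow> nat \<Rightarrow> nat \<Rightarrow> nat \<Rightarrow> ennreal" where
  "edge_mass \<beta> x y w = (if (x, y) \<in> E \<and> y \<notin> S \<and> x \<in> S \<and> w \<in> component x then \<beta> E y x / comp_size E x else 0)"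

lemma transport_eq:
  assumes "y \<in> V"
  shows "transport \<beta> E y w = (\<integral>\<^sup>+x. edge_mass \<beta> x y w \<partial>count_space V)"
  unfolding transport_def verts[OF assms] comp_iff
  by (rule nn_integral_cong) (use assms in_supp_iff in \<open>auto simp: edge_mass_def\<close>)

lemma neighbours: "x \<in> V \<Longrightarrow> (\<integral>\<^sup>+z. (if (x, z) \<in> E then f z else 0) \<partial>count_space V) = (\<Sum>z\<in>E `` {x}. f z)"
  using nn_integral_neighbours[OF network, of x f] verts[of x] by simp

text \<open>Spreading uniformly over a finite component preserves the total, so each neighbour x in
  \<open>S\<close> accounts for its full \<beta> after the sums are exchanged.\<close>

lemma transport_out:
  assumes y: "y \<in> V" and fin: "\<And>x. x \<in> S \<Longrightarrow> finite (component x)"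
  shows "(\<integral>\<^sup>+w. transport \<beta> E y w \<partial>count_space V) = (if y \<in> S then 0 else (\<Sum>x\<in>E `` {y} \<inter> S. \<beta> E y x))"
proof -
  have sw: "(x, y) \<in> E \<longleftrightarrow> (y, x) \<in> E" for x using sym_E by (auto dest: symD)
  have "(\<integral>\<^sup>+w. transport \<beta> E y w \<partial>count_space V) = (\<integral>\<^sup>+w. \<integral>\<^sup>+x. edge_mass \<beta> x y w \<partial>count_space V \<partial>count_space V)"
    unfolding transport_eq[OF y] ..
  also have "\<dots> = (\<integral>\<^sup>+x. \<integral>\<^sup>+w. edge_mass \<beta> x y w \<partial>count_space V \<partial>count_space V)"
    by (rule nn_integral_count_space_nn_integral[symmetric]) auto
  also have "\<dots> = (\<integral>\<^sup>+x. (if (y, x) \<in> E then (if y \<notin> S \<and> x \<in> S then \<beta> E y x else 0) else 0) \<partial>count_space V)"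
  proof (rule nn_integral_cong)
    fix x assume "x \<in> space (count_space V)"
    then have x: "x \<in> V" by simp
    show "(\<integral>\<^sup>+w. edge_mass \<beta> x y w \<partial>count_space V) = (if (y, x) \<in> E then (if y \<notin> S \<and> x \<in> S then \<beta> E y x else 0) else 0)"
    proof (cases "(y, x) \<in> E \<and> y \<notin> S \<and> x \<in> S")
      case True
      have "(\<integral>\<^sup>+w. edge_mass \<beta> x y w \<partial>count_space V) = (\<integral>\<^sup>+w. \<beta> E y x / comp_size E x * (if (x, w) \<in> (supp_rel E)\<^sup>* then 1 else 0) \<partial>count_space V)"
        by (rule nn_integral_cong) (use True sw in \<open>simp add: edge_mass_def comp_iff\<close>)
      also have "\<dots> = \<beta> E y x / comp_size E x * comp_size E x"
        unfolding comp_size_def verts[OF x] by (rule nn_integral_cmult) simp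
      also have "\<dots> = \<beta> E y x" using True fin by (intro ennreal_div_mult_card) auto
      finally show ?thesis using True by simp
    next
      case False
      then have "edge_mass \<beta> x y w = 0" for w using sw by (auto simp: edge_mass_def)
      then show ?thesis using False by auto
    qed
  qed
  also have "\<dots> = (\<Sum>x\<in>E `` {y}. if y \<notin> S \<and> x \<in> S then \<beta> E y x else 0)"
    by (rule neighbours[OF y])
  also have "\<dots> = (if y \<in> S then 0 else (\<Sum>x\<in>E `` {y} \<inter> S. \<beta> E y x))"
    using finite_nbrs by (simp add: sum.inter_restrict)
  finally show ?thesis .
qed

lemma transport_in:
  assumes w: "w \<in> V" and fin: "\<And>x. x \<in> S \<Longrightarrow> finite (component x)"
  shows "(\<integral>\<^sup>+y. transport \<beta> E y w \<partial>count_space V) =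
    (if w \<in> S then (\<Sum>x\<in>component w. \<Sum>y\<in>E `` {x} - S. \<beta> E y x / of_nat (card (component w))) else 0)"
proof -
  have inner: "(\<integral>\<^sup>+y. edge_mass \<beta> x y w \<partial>count_space V) =
      (if w \<in> S \<and> x \<in> component w then (\<Sum>y\<in>E `` {x} - S. \<beta> E y x / of_nat (card (component w))) else 0)" if x: "x \<in> V" for x
  proof (cases "w \<in> S \<and> x \<in> component w")
    case True
    then have xS: "x \<in> S" and wx: "w \<in> component x" and eq: "component x = component w"
      using comp_subset_S comp_sym comp_eq by blast+
    have "(\<integral>\<^sup>+y. edge_mass \<beta> x y w \<partial>count_space V)
       = (\<integral>\<^sup>+y. (if (x, y) \<in> E then (if y \<notin> S then \<beta> E y x / of_nat (card (component w)) else 0) else 0) \<partial>count_space V)"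
      by (rule nn_integral_cong)
         (use xS wx comp_size_finite[OF xS fin[OF xS]] eq in \<open>auto simp: edge_mass_def\<close>)
    also have "\<dots> = (\<Sum>y\<in>E `` {x}. if y \<notin> S then \<beta> E y x / of_nat (card (component w)) else 0)"
      by (rule neighbours[OF x])
    also have "\<dots> = (\<Sum>y\<in>E `` {x} - S. \<beta> E y x / of_nat (card (component w)))"
      by (rule sum.mono_neutral_cong_right) (use finite_nbrs in auto)
    finally show ?thesis using True by simp
  next
    case False
    then have "\<not> (x \<in> S \<and> w \<in> component x)" using comp_subset_S comp_sym by blast
    then have "edge_mass \<beta> x y w = 0" for y by (auto simp: edge_mass_def)
    then show ?thesis using False by auto
  qed
  have "(\<integral>\<^sup>+y. transport \<beta> E y w \<partial>count_space V) = (\<integral>\<^sup>+y. \<integral>\<^sup>+x. edge_mass \<beta> x y w \<partial>count_space V \<partial>count_space V)"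
    by (rule nn_integral_cong) (simp add: transport_eq)
  also have "\<dots> = (\<integral>\<^sup>+x. \<integral>\<^sup>+y. edge_mass \<beta> x y w \<partial>count_space V \<partial>count_space V)"
    by (rule nn_integral_count_space_nn_integral[symmetric]) auto
  also have "\<dots> = (\<integral>\<^sup>+x. (if w \<in> S \<and> x \<in> component w then (\<Sum>y\<in>E `` {x} - S. \<beta> E y x / of_nat (card (component w))) else 0) \<partial>count_space V)"
    by (rule nn_integral_cong) (use inner in simp)
  also have "\<dots> = (if w \<in> S then (\<Sum>x\<in>component w. \<Sum>y\<in>E `` {x} - S. \<beta> E y x / of_nat (card (component w))) else 0)"
  proof (cases "w \<in> S")
    case True
    have "component w \<subseteq> V" using comp_subset_S[OF True] S_V by blast
    then have "(\<integral>\<^sup>+x. (if w \<in> S \<and> x \<in> component w then (\<Sum>y\<in>E `` {x} - S. \<beta> E y x / of_nat (card (component w))) else 0) \<partial>count_space V)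
      = (\<Sum>x\<in>component w. if w \<in> S \<and> x \<in> component w then (\<Sum>y\<in>E `` {x} - S. \<beta> E y x / of_nat (card (component w))) else 0)"
      using fin[OF True] by (intro nn_integral_count_space') auto
    then show ?thesis using True by simp
  qed simp
  finally show ?thesis .
qed

text \<open>With unit masses a boundary vertex sends one unit per neighbour in \<open>S\<close>, at
  most \<Delta> in all, while with \<open>share\<close> it sends exactly 1. Other vertices send
  nothing in either case.\<close>

lemma boundary_inequality:
  assumes y: "y \<in> V" and fin: "\<And>x. x \<in> S \<Longrightarrow> finite (component x)" and deg: "real (card (E `` {y})) \<le> \<Delta>"
  shows "(\<integral>\<^sup>+w. transport (\<lambda>_ _ _. 1) E y w \<partial>count_space V) \<le> ennreal \<Delta> * (\<integral>\<^sup>+w. transport share E y w \<partial>count_space V)"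
proof (cases "y \<in> S \<or> E `` {y} \<inter> S = {}")
  case True
  then show ?thesis by (auto simp: transport_out[OF y fin])
next
  case False
  have "(\<Sum>x\<in>E `` {y} \<inter> S. share E y x) = (\<Sum>x\<in>E `` {y} \<inter> S. ennreal (\<alpha> y x))"
    by (rule sum.cong) (use share_eq y in auto)
  also have "\<dots> = ennreal (\<Sum>x\<in>E `` {y} \<inter> S. \<alpha> y x)"
    by (rule sum_ennreal) (use \<alpha>_nonneg in auto)
  finally have 1: "(\<Sum>x\<in>E `` {y} \<inter> S. share E y x) = 1"
    using sum_\<alpha>_boundary[OF y] False by simp
  have "card (E `` {y} \<inter> S) \<le> card (E `` {y})"
    using finite_nbrs by (intro card_mono) auto
  then have "real (card (E `` {y} \<inter> S)) \<le> \<Delta>" using deg by linarith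
  then have "of_nat (card (E `` {y} \<inter> S)) \<le> ennreal \<Delta>"
    by (simp add: ennreal_of_nat_eq_real_of_nat ennreal_leI)
  then show ?thesis using False by (simp add: transport_out[OF y fin] 1)
qed

text \<open>By maximality of the component its boundary lies outside \<open>S\<close>, and each
  boundary vertex ends at least one edge leaving it. With unit masses w receives the number of these
  edges divided by the size of the component.\<close>

lemma component_isoperimetry:
  assumes w: "w \<in> S" and fin: "\<And>x. x \<in> S \<Longrightarrow> finite (component x)"
    and iso: "\<iota> * real (card (component w)) \<le> real (card (vertex_boundary E (component w)))"
  shows "ennreal \<iota> \<le> (\<integral>\<^sup>+y. transport (\<lambda>_ _ _. 1) E y w \<partial>count_space V)"
proof -
  let ?C = "component w"
  have wV: "w \<in> V" using w S_V by auto
  have pos: "card ?C > 0" using fin[OF w] comp_self[of w] by (auto simp: card_gt_0_iff)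
  have "vertex_boundary E ?C \<subseteq> (\<Union>x\<in>?C. E `` {x} - S)"
    using comp_step comp_subset_S[OF w] by (fastforce simp: vertex_boundary_def)
  then have "card (vertex_boundary E ?C) \<le> card (\<Union>x\<in>?C. E `` {x} - S)"
    using fin[OF w] finite_nbrs by (intro card_mono) auto
  also have "\<dots> \<le> (\<Sum>x\<in>?C. card (E `` {x} - S))"
    by (rule card_UN_le[OF fin[OF w]])
  finally have "\<iota> * card ?C \<le> real (\<Sum>x\<in>?C. card (E `` {x} - S))" using iso by linarith
  then have "\<iota> \<le> (\<Sum>x\<in>?C. real (card (E `` {x} - S)) / card ?C)"
    using pos by (simp add: sum_divide_distrib[symmetric] pos_le_divide_eq)
  then have "ennreal \<iota> \<le> ennreal (\<Sum>x\<in>?C. real (card (E `` {x} - S)) / card ?C)" by (rule ennreal_leI)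
  also have "\<dots> = (\<Sum>x\<in>?C. ennreal (real (card (E `` {x} - S)) / card ?C))"
    by (rule sum_ennreal[symmetric]) simp
  also have "\<dots> = (\<Sum>x\<in>?C. \<Sum>y\<in>E `` {x} - S. 1 / of_nat (card ?C))"
  proof (rule sum.cong)
    fix x
    have "(\<Sum>y\<in>E `` {x} - S. 1 / of_nat (card ?C) :: ennreal) = (\<Sum>y\<in>E `` {x} - S. ennreal (1 / card ?C))"
      using pos divide_ennreal[of 1 "real (card ?C)"] by (simp add: ennreal_of_nat_eq_real_of_nat)
    also have "\<dots> = ennreal (\<Sum>y\<in>E `` {x} - S. 1 / card ?C)" by (rule sum_ennreal) simp
    finally show "ennreal (real (card (E `` {x} - S)) / card ?C) = (\<Sum>y\<in>E `` {x} - S. 1 / of_nat (card ?C))" by simp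
  qed simp
  finally show ?thesis using w by (simp add: transport_in[OF wV fin])
qed

text \<open>The component collects less than 1 and w gets an equal part of it. This is used with r =
  \<iota> / \<Delta>, where the contradiction hypothesis supplies the lower bound on the
  size.\<close>

lemma component_share:
  assumes w: "w \<in> S" and fin: "\<And>x. x \<in> S \<Longrightarrow> finite (component x)"
    and r: "r > 0" "1 / r \<le> real (card (component w))"
  shows "(\<integral>\<^sup>+y. transport share E y w \<partial>count_space V) < ennreal r"
proof -
  let ?C = "component w"
  have wV: "w \<in> V" using w S_V by auto
  have pos: "card ?C > 0" using fin[OF w] comp_self[of w] by (auto simp: card_gt_0_iff)
  have sub: "?C \<subseteq> S" by (rule comp_subset_S[OF w])
  have "(\<Sum>x\<in>?C. \<Sum>y\<in>E `` {x} - S. share E y x / of_nat (card ?C))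
     = (\<Sum>x\<in>?C. \<Sum>y\<in>E `` {x} - S. ennreal (\<alpha> y x / card ?C))"
  proof (intro sum.cong refl)
    fix x y assume "x \<in> ?C" "y \<in> E `` {x} - S"
    then have "x \<in> S" "y \<in> V" using sub E_V by auto
    then show "share E y x / of_nat (card ?C) = ennreal (\<alpha> y x / card ?C)"
      using pos \<alpha>_nonneg by (simp add: share_eq ennreal_of_nat_eq_real_of_nat divide_ennreal)
  qed
  also have "\<dots> = (\<Sum>x\<in>?C. ennreal (\<Sum>y\<in>E `` {x} - S. \<alpha> y x / card ?C))"
    by (intro sum.cong refl sum_ennreal) (use \<alpha>_nonneg sub in auto)
  also have "\<dots> = ennreal (\<Sum>x\<in>?C. \<Sum>y\<in>E `` {x} - S. \<alpha> y x / card ?C)"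
    by (intro sum_ennreal sum_nonneg) (use \<alpha>_nonneg sub in auto)
  also have "(\<Sum>x\<in>?C. \<Sum>y\<in>E `` {x} - S. \<alpha> y x / card ?C) = (\<Sum>x\<in>?C. \<Sum>y\<in>E `` {x} - S. \<alpha> y x) / card ?C"
    by (simp add: sum_divide_distrib)
  also have "ennreal \<dots> < ennreal r"
  proof (rule ennreal_lessI[OF r(1)])
    have "(\<Sum>x\<in>?C. \<Sum>y\<in>E `` {x} - S. \<alpha> y x) / card ?C < 1 / card ?C"
      using sum_\<alpha>_component[OF w fin[OF w]] pos by (intro divide_strict_right_mono) auto
    also have "\<dots> \<le> r" using r pos by (simp add: field_simps)
    finally show "(\<Sum>x\<in>?C. \<Sum>y\<in>E `` {x} - S. \<alpha> y x) / card ?C < r" .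
  qed
  finally show ?thesis using w by (simp add: transport_in[OF wV fin])
qed

lemma finite_component_eigenvalue:
  assumes w: "w \<in> S" and fin: "finite (component w)"
  shows "t \<in> totally_real_algebraic_integers" "tree_complexity t \<le> card (component w)"
proof -
  let ?C = "component w"
  have sub: "?C \<subseteq> V" using comp_subset_S[OF w] S_V by blast
  have tr: "is_tree ?C (E \<inter> ?C \<times> ?C)"
    by (rule is_tree_subset[OF sub _ comp_connected]) (use comp_self in auto)
  have nz: "coord (K w) w \<noteq> 0" using w by (auto simp: S_def)
  have ev: "(\<Sum>u\<in>(E \<inter> ?C \<times> ?C) `` {z}. coord (K w) u) = t * coord (K w) z" if "z \<in> ?C" for z
  proof -
    have "(E \<inter> ?C \<times> ?C) `` {z} = E `` {z} \<inter> ?C" using that by auto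
    then show ?thesis using component_eigenvector[OF w that] by simp
  qed
  show "t \<in> totally_real_algebraic_integers" "tree_complexity t \<le> card ?C"
    using finite_tree_eigenvalue[OF fin tr comp_self nz ev] by auto
qed

end

section \<open>The spectral inclusion for unimodular networks\<close>

lemma measurable_root_sum:
  assumes sets: "sets L = sets borel" and f: "f \<in> borel_measurable (netM 2)"
  shows "(\<lambda>g. \<integral>\<^sup>+x. f (rg_edges g, [x, rg_root g]) \<partial>count_space (rg_verts g)) \<in> borel_measurable L"
    and "(\<lambda>g. \<integral>\<^sup>+x. f (rg_edges g, [rg_root g, x]) \<partial>count_space (rg_verts g)) \<in> borel_measurable L"
proof -
  have m: "(\<lambda>g. \<integral>\<^sup>+x. f (rg_edges g, [x, rg_root g]) \<partial>count_space (rg_verts g)) \<in> borel_measurable L"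
    if f: "f \<in> borel_measurable (netM 2)" for f
  proof -
    have "f \<in> borel_measurable (netM (Suc 1))" using f by (simp add: numeral_2_eq_2)
    from measurable_compose[OF measurable_rg_net measurable_verts_sum[OF this]]
    have "(\<lambda>g. \<integral>\<^sup>+z. f (rg_edges g, [z, rg_root g]) \<partial>count_space (verts_of (rg_edges g) (rg_root g))) \<in> borel_measurable borel"
      by (simp add: rg_net_def)
    then show ?thesis
      unfolding measurable_cong_sets[OF sets refl] by (simp add: verts_of_eq[OF rg_network])
  qed
  show "(\<lambda>g. \<integral>\<^sup>+x. f (rg_edges g, [x, rg_root g]) \<partial>count_space (rg_verts g)) \<in> borel_measurable L"
    by (rule m[OF f])
  have "(\<lambda>p. f (fst p, [snd p ! 1, snd p ! 0])) \<in> borel_measurable (netM 2)"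
    by (rule measurable_proj2[OF f]) simp_all
  from m[OF this]
  show "(\<lambda>g. \<integral>\<^sup>+x. f (rg_edges g, [rg_root g, x]) \<partial>count_space (rg_verts g)) \<in> borel_measurable L"
    by simp
qed

lemma ex_network_eigenspace:
  fixes D :: nat and t :: real
  assumes net: "network_graph V E" and tree: "is_tree V E"
    and deg: "\<And>x. x \<in> V \<Longrightarrow> card (E `` {x}) \<le> D" and D: "D > 0" and M: "real D + \<bar>t\<bar> < M"
  obtains K where "network_eigenspace V E D t K M"
    "\<And>v. v \<in> V \<Longrightarrow> emeasure (spectral_measure V E v) {t} \<le> ennreal (coord (K v) v)"
proof -
  have E: "E \<subseteq> V \<times> V" "sym E" and fin: "\<And>x. x \<in> V \<Longrightarrow> finite (E `` {x})"
    using net by (auto simp: network_graph_def simple_graph_def locally_finite_graph_def)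
  have out: "E `` {x} = {}" if "x \<notin> V" for x using E that by auto
  interpret bounded_degree_network E D V
  proof
    show "finite (E `` {x})" "card (E `` {x}) \<le> D" for x
      using fin deg out by (cases "x \<in> V"; force)+
  qed (use E D in auto)
  have "\<exists>h. (\<lambda>n. opoly (adjop E) (kernel_poly M t ^ n) (bvec v)) \<longlonglongrightarrow> h \<and>
    adjop E h = t *\<^sub>R h \<and> (\<forall>f. adjop E f = t *\<^sub>R f \<longrightarrow> inner h f = coord f v) \<and>
    emeasure (spectral_measure V E v) {t} \<le> ennreal (coord h v)" if "v \<in> V" for v
    by (rule spectral_atom[OF that M]) blast
  then obtain K where K: "\<And>v. v \<in> V \<Longrightarrow> (\<lambda>n. opoly (adjop E) (kernel_poly M t ^ n) (bvec v)) \<longlonglongrightarrow> K v"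
    "\<And>v. v \<in> V \<Longrightarrow> adjop E (K v) = t *\<^sub>R K v"
    "\<And>v f. v \<in> V \<Longrightarrow> adjop E f = t *\<^sub>R f \<Longrightarrow> inner (K v) f = coord f v"
    "\<And>v. v \<in> V \<Longrightarrow> emeasure (spectral_measure V E v) {t} \<le> ennreal (coord (K v) v)"
    by metis
  have supp: "supported V (K v)" if v: "v \<in> V" for v
  proof (rule supported_lim[OF _ K(1)[OF v]])
    show "supported V (opoly (adjop E) (kernel_poly M t ^ n) (bvec v))" for n
      by (rule finite_support_opoly(2)) (use v in \<open>auto simp: coord_bvec supported_def\<close>)
  qed
  have "network_eigenspace V E D t K M"
  proof
    show "kernel_entry M t E x y = coord (K y) x" if "x \<in> V" "y \<in> V" for x y
      by (rule kernel_entry_eq[OF K(1)[OF that(2)]])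
  qed (use tree K supp net in auto)
  with K(4) show ?thesis by (intro that)
qed

theorem corollary5:
  fixes \<Delta> \<iota> :: real and L :: "rooted_graph measure"
  assumes "\<iota> > 0"
    and "unimodular L"
    and "AE g in L. infinite (rg_verts g) \<and> is_tree (rg_verts g) (rg_edges g)"
    and "AE g in L. \<forall>x\<in>rg_verts g. real (degree_of (rg_edges g) x) \<le> \<Delta>"
    and "AE g in L. isoperimetric_constant (rg_verts g) (rg_edges g) \<ge> \<iota>"
  shows "pure_point_support L \<subseteq>
    {t \<in> totally_real_algebraic_integers. real (tree_complexity t) < \<Delta> / \<iota>}"
proof (rule ccontr)
  assume "\<not> ?thesis"
  then obtain t where "t \<in> pure_point_support L"
    and not_in: "t \<notin> {t \<in> totally_real_algebraic_integers. real (tree_complexity t) < \<Delta> / \<iota>}" by blast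
  then have t: "mean_spectral_measure L {t} > 0" by (simp add: pure_point_support_def)
  have bad: "real (tree_complexity t) \<ge> \<Delta> / \<iota>" if "t \<in> totally_real_algebraic_integers"
    using that not_in by (simp add: not_less)
  have sets: "sets L = sets borel" and prob: "prob_space L"
    using assms(2) by (auto simp: unimodular_def)
  interpret prob_space L by fact
  \<comment> \<open>The successor makes D positive and at least \<Delta>; the extra 1 in M gives the
    strict inequality D + |t| < M needed for the kernel polynomial.\<close>
  define D where "D = Suc (nat \<lfloor>\<Delta>\<rfloor>)"
  define M where "M = real D + \<bar>t\<bar> + 1"
  interpret kernel_parameters M t .
  let ?V = rg_verts and ?E = rg_edges and ?o = rg_root
  define good where "good g \<longleftrightarrow> infinite (?V g) \<and> is_tree (?V g) (?E g) \<and>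
      (\<forall>x\<in>?V g. real (card (?E g `` {x})) \<le> \<Delta>) \<and> isoperimetric_constant (?V g) (?E g) \<ge> \<iota>" for g
  have AE_good: "AE g in L. good g"
    using assms(3-5) by eventually_elim (auto simp: good_def degree_of_def)
  have eig: "\<exists>K. network_eigenspace (?V g) (?E g) D t K M \<and>
     emeasure (spectral_measure (?V g) (?E g) (?o g)) {t} \<le> ennreal (coord (K (?o g)) (?o g))" if "good g" for g
  proof -
    have deg: "card (?E g `` {x}) \<le> D" if "x \<in> ?V g" for x
    proof -
      have "real (card (?E g `` {x})) \<le> \<Delta>" using \<open>good g\<close> that by (simp add: good_def)
      then show ?thesis unfolding D_def by linarith
    qed
    have tree: "is_tree (?V g) (?E g)" using that by (simp add: good_def)
    have D: "D > 0" "real D + \<bar>t\<bar> < M" by (simp_all add: D_def M_def)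
    obtain K where "network_eigenspace (?V g) (?E g) D t K M"
      "\<And>v. v \<in> ?V g \<Longrightarrow> emeasure (spectral_measure (?V g) (?E g) v) {t} \<le> ennreal (coord (K v) v)"
      using ex_network_eigenspace[OF rg_network(1)[of g] tree deg D] by blast
    then show ?thesis using rg_network(2)[of g] by blast
  qed
  have "\<exists>g. good g"
  proof (rule ccontr)
    assume "\<nexists>g. good g"
    then have "AE g in L. False" using AE_good by simp
    then show False by (simp add: AE_False)
  qed
  then obtain g0 where g0: "good g0" ..
  \<comment> \<open>An infinite connected graph has an edge at its root. Positivity is needed
    because \<open>component_share\<close> is applied with r = \<iota> / \<Delta>.\<close>
  have \<Delta>_pos: "\<Delta> > 0"
  proof -
    have "?V g0 \<noteq> {?o g0}" using g0 by (metis good_def finite.emptyI finite_insert)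
    then obtain x where x: "x \<in> ?V g0" "x \<noteq> ?o g0" using rg_network(2)[of g0] by blast
    have "(?o g0, x) \<in> (?E g0)\<^sup>*"
      using rg_network[of g0] x by (auto simp: network_graph_def graph_connected_def)
    then obtain y where "(?o g0, y) \<in> ?E g0" using x by (auto elim: converse_rtranclE)
    moreover have "finite (?E g0 `` {?o g0})"
      using rg_network[of g0] by (auto simp: network_graph_def locally_finite_graph_def)
    ultimately have "card (?E g0 `` {?o g0}) > 0" by (auto simp: card_gt_0_iff)
    moreover have "real (card (?E g0 `` {?o g0})) \<le> \<Delta>"
      using g0 rg_network(2)[of g0] by (simp add: good_def)
    ultimately show ?thesis by linarith
  qed
  \<comment> \<open>A vertex of the support sends out mass at most 1 and receives \<open>P\<^sub>o\<^sub>o\<close> times the size of its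
    component, so the components are almost surely finite.\<close>
  define f where "f p = (if in_supp (fst p) (snd p ! 0) \<and> (snd p ! 0, snd p ! 1) \<in> (supp_rel (fst p))\<^sup>*
     then ennreal ((ke (fst p) (snd p ! 0) (snd p ! 1))\<^sup>2 / ke (fst p) (snd p ! 0) (snd p ! 0)) else 0)"
    for p :: "nat rel \<times> nat list"
  have f_pair: "f (E, [x, y]) = (if in_supp E x \<and> (x, y) \<in> (supp_rel E)\<^sup>* then ennreal ((ke E x y)\<^sup>2 / ke E x x) else 0)"
    for E x y by (simp add: f_def cong: if_cong)
  have f: "f \<in> borel_measurable (netM 2)"
  proof -
    have [measurable]: "Measurable.pred (netM 2) (\<lambda>p. in_supp (fst p) (snd p ! 0))"
      "Measurable.pred (netM 2) (\<lambda>p. (snd p ! 0, snd p ! 1) \<in> (supp_rel (fst p))\<^sup>*)"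
      "(\<lambda>p. ke (fst p) (snd p ! 0) (snd p ! 1)) \<in> borel_measurable (netM 2)"
      "(\<lambda>p. ke (fst p) (snd p ! 0) (snd p ! 0)) \<in> borel_measurable (netM 2)"
      by (rule measurable_in_supp measurable_comp_rel measurable_ke; simp)+
    show ?thesis unfolding f_def[abs_def] by measurable
  qed
  have "AE g in L. (\<integral>\<^sup>+x. f (?E g, [x, ?o g]) \<partial>count_space (?V g)) \<noteq> \<infinity>"
  proof (rule nn_integral_PInf_AE[OF measurable_root_sum(1)[OF sets f]])
    have "(\<integral>\<^sup>+g. (\<integral>\<^sup>+x. f (?E g, [x, ?o g]) \<partial>count_space (?V g)) \<partial>L)
       = (\<integral>\<^sup>+g. (\<integral>\<^sup>+x. f (?E g, [?o g, x]) \<partial>count_space (?V g)) \<partial>L)"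
      by (rule mass_transport[OF assms(2) f, symmetric])
    also have "\<dots> \<le> (\<integral>\<^sup>+g. 1 \<partial>L)"
    proof (rule nn_integral_mono_AE)
      show "AE g in L. (\<integral>\<^sup>+x. f (?E g, [?o g, x]) \<partial>count_space (?V g)) \<le> 1"
        using AE_good
      proof eventually_elim
        case (elim g)
        then obtain K where "network_eigenspace (?V g) (?E g) D t K M" using eig by blast
        then interpret network_eigenspace "?V g" "?E g" D t K M .
        show ?case unfolding f_pair by (rule finiteness_mass_out[OF rg_network(2)])
      qed
    qed
    also have "\<dots> = 1" by (simp add: emeasure_space_1)
    finally show "(\<integral>\<^sup>+g. (\<integral>\<^sup>+x. f (?E g, [x, ?o g]) \<partial>count_space (?V g)) \<partial>L) \<noteq> \<infinity>"
      by (auto simp: top_unique)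
  qed
  with AE_good have "AE g in L. in_supp (?E g) (?o g) \<longrightarrow> comp_size (?E g) (?o g) \<noteq> \<infinity>"
  proof eventually_elim
    case (elim g)
    then obtain K where "network_eigenspace (?V g) (?E g) D t K M" using eig by blast
    then interpret network_eigenspace "?V g" "?E g" D t K M .
    show ?case
    proof
      assume "in_supp (?E g) (?o g)"
      then have S: "?o g \<in> S" using in_supp_iff rg_network(2) by blast
      have "ennreal (coord (K (?o g)) (?o g)) * comp_size (?E g) (?o g) \<noteq> \<infinity>"
        using elim(2) finiteness_mass_in[OF S] unfolding f_pair by simp
      then show "comp_size (?E g) (?o g) \<noteq> \<infinity>"
        using S by (auto simp: S_def ennreal_mult_eq_top_iff)
    qed
  qed
  moreover have "Measurable.pred (netM 1) (\<lambda>p. in_supp (fst p) (snd p ! 0) \<longrightarrow> comp_size (fst p) (snd p ! 0) \<noteq> \<infinity>)"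
  proof -
    have [measurable]: "Measurable.pred (netM 1) (\<lambda>p. in_supp (fst p) (snd p ! 0))"
      "(\<lambda>p. comp_size (fst p) (snd p ! 0)) \<in> borel_measurable (netM 1)"
      by (rule measurable_in_supp measurable_comp_size; simp)+
    show ?thesis by measurable
  qed
  \<comment> \<open>The estimates at a boundary root involve the components of its neighbours, so
    finiteness is transferred from the root to all vertices.\<close>
  ultimately have AE_fin: "AE g in L. \<forall>x\<in>?V g. in_supp (?E g) x \<longrightarrow> comp_size (?E g) x \<noteq> \<infinity>"
    using AE_all_vertices[OF assms(2), of "\<lambda>p. in_supp (fst p) (snd p ! 0) \<longrightarrow> comp_size (fst p) (snd p ! 0) \<noteq> \<infinity>"]
    by simp
  define T where "T \<beta> p = transport \<beta> (fst p) (snd p ! 0) (snd p ! 1)" for \<beta> and p :: "nat rel \<times> nat list"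
  have T: "T share \<in> borel_measurable (netM 2)" "T (\<lambda>_ _ _. 1) \<in> borel_measurable (netM 2)"
    unfolding T_def[abs_def] by (rule measurable_transport; use measurable_share in simp)+
  let ?u = "\<lambda>g. \<integral>\<^sup>+y. T share (?E g, [y, ?o g]) \<partial>count_space (?V g)"
  let ?s = "\<lambda>g. if in_supp (?E g) (?o g) then ennreal \<iota> else 0"
  \<comment> \<open>Three links of a chain closed by two uses of mass transport: \<open>?s\<close>
    is at most the unit mass received, the unit mass sent is at most \<Delta> times the share sent,
    and \<Delta> times the share received is at most \<open>?s\<close>. The last link is strict when
    the root is in the support.\<close>
  have ineq: "AE g in L.
      ?s g \<le> (\<integral>\<^sup>+y. T (\<lambda>_ _ _. 1) (?E g, [y, ?o g]) \<partial>count_space (?V g)) \<and>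
      (\<integral>\<^sup>+y. T (\<lambda>_ _ _. 1) (?E g, [?o g, y]) \<partial>count_space (?V g))
         \<le> ennreal \<Delta> * (\<integral>\<^sup>+y. T share (?E g, [?o g, y]) \<partial>count_space (?V g)) \<and>
      ennreal \<Delta> * ?u g \<le> ?s g \<and> (in_supp (?E g) (?o g) \<longrightarrow> ennreal \<Delta> * ?u g < ?s g)"
    using AE_good AE_fin
  proof eventually_elim
    case (elim g)
    then obtain K where "network_eigenspace (?V g) (?E g) D t K M" using eig by blast
    then interpret network_eigenspace "?V g" "?E g" D t K M .
    have o: "?o g \<in> ?V g" by (rule rg_network(2))
    have fin: "finite (component x)" if x: "x \<in> S" for x
      using elim(2) x S_V in_supp_iff[of x] comp_size_infinite[OF x] by blast
    have iso: "\<iota> * real (card (component x)) \<le> real (card (vertex_boundary (?E g) (component x)))"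
      and size: "\<Delta> / \<iota> \<le> real (card (component x))" if x: "x \<in> S" for x
    proof -
      have C: "component x \<subseteq> ?V g" "finite (component x)" "component x \<noteq> {}"
        using comp_subset_S[OF x] S_V fin[OF x] comp_self[of x] by auto
      have "isoperimetric_constant (?V g) (?E g) \<le> real (card (vertex_boundary (?E g) (component x))) / real (card (component x))"
        unfolding isoperimetric_constant_def
        by (rule cInf_lower) (use C in \<open>auto intro!: bdd_belowI[of _ 0]\<close>)
      then have "\<iota> \<le> real (card (vertex_boundary (?E g) (component x))) / real (card (component x))"
        using elim(1) by (simp add: good_def)
      then show "\<iota> * real (card (component x)) \<le> real (card (vertex_boundary (?E g) (component x)))"
        using C by (simp add: pos_le_divide_eq card_gt_0_iff)
      show "\<Delta> / \<iota> \<le> real (card (component x))"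
        \<comment> \<open>The finite component first shows that t is a totally real algebraic
          integer; then the contradiction hypothesis bounds its tree-complexity, and hence the size
          of the component, from below.\<close>
        using bad finite_component_eigenvalue[OF x fin[OF x]] by (simp add: order_trans)
    qed
    have strict: "ennreal \<Delta> * ?u g < ennreal \<iota>" if "?o g \<in> S"
    proof -
      have "?u g < ennreal (\<iota> / \<Delta>)"
        using component_share[OF that fin, of "\<iota> / \<Delta>"] size[OF that] assms(1) \<Delta>_pos
        by (simp add: T_def)
      then have "ennreal \<Delta> * ?u g < ennreal \<Delta> * ennreal (\<iota> / \<Delta>)"
        using \<Delta>_pos by (intro ennreal_mult_strict_left_mono) auto
      also have "\<dots> = ennreal \<iota>"
        using \<Delta>_pos assms(1) by (simp add: ennreal_mult[symmetric])
      finally show ?thesis .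
    qed
    have zero: "?u g = 0" if "?o g \<notin> S"
      using transport_in[OF o fin, of share] that by (simp add: T_def)
    show ?case
      using component_isoperimetry[OF _ fin iso, of "?o g"] boundary_inequality[OF o fin, of \<Delta>]
        elim(1) o strict zero in_supp_iff[OF o]
      by (auto simp: T_def good_def less_imp_le)
  qed
  have s_meas: "?s \<in> borel_measurable L"
  proof -
    have "Measurable.pred (netM 1) (\<lambda>p. in_supp (fst p) (snd p ! 0))" by (rule measurable_in_supp) simp
    from measurable_compose[OF measurable_rg_net this]
    have [measurable]: "Measurable.pred L (\<lambda>g. in_supp (?E g) (?o g))"
      unfolding measurable_cong_sets[OF sets refl] by (simp add: rg_net_def)
    show ?thesis by measurable
  qed
  have u_meas: "(\<lambda>g. ennreal \<Delta> * ?u g) \<in> borel_measurable L"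
    using measurable_root_sum(1)[OF sets T(1)] by measurable
  have fin_s: "(\<integral>\<^sup>+g. ?s g \<partial>L) < \<infinity>"
  proof -
    have "(\<integral>\<^sup>+g. ?s g \<partial>L) \<le> (\<integral>\<^sup>+g. ennreal \<iota> \<partial>L)" by (rule nn_integral_mono) simp
    also have "\<dots> < \<infinity>" by (simp add: emeasure_space_1)
    finally show ?thesis .
  qed
  have "(\<integral>\<^sup>+g. ?s g \<partial>L) \<le> (\<integral>\<^sup>+g. (\<integral>\<^sup>+y. T (\<lambda>_ _ _. 1) (?E g, [y, ?o g]) \<partial>count_space (?V g)) \<partial>L)"
    by (rule nn_integral_mono_AE) (use ineq in \<open>eventually_elim, blast\<close>)
  also have "\<dots> = (\<integral>\<^sup>+g. (\<integral>\<^sup>+y. T (\<lambda>_ _ _. 1) (?E g, [?o g, y]) \<partial>count_space (?V g)) \<partial>L)"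
    by (rule mass_transport[OF assms(2) T(2), symmetric])
  also have "\<dots> \<le> (\<integral>\<^sup>+g. ennreal \<Delta> * (\<integral>\<^sup>+y. T share (?E g, [?o g, y]) \<partial>count_space (?V g)) \<partial>L)"
    by (rule nn_integral_mono_AE) (use ineq in \<open>eventually_elim, blast\<close>)
  also have "\<dots> = ennreal \<Delta> * (\<integral>\<^sup>+g. (\<integral>\<^sup>+y. T share (?E g, [?o g, y]) \<partial>count_space (?V g)) \<partial>L)"
    by (rule nn_integral_cmult[OF measurable_root_sum(2)[OF sets T(1)]])
  also have "\<dots> = ennreal \<Delta> * (\<integral>\<^sup>+g. ?u g \<partial>L)"
    by (simp only: mass_transport[OF assms(2) T(1)])
  also have "\<dots> = (\<integral>\<^sup>+g. ennreal \<Delta> * ?u g \<partial>L)"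
    by (rule nn_integral_cmult[OF measurable_root_sum(1)[OF sets T(1)], symmetric])
  finally have le: "(\<integral>\<^sup>+g. ?s g \<partial>L) \<le> (\<integral>\<^sup>+g. ennreal \<Delta> * ?u g \<partial>L)" .
  \<comment> \<open>This pointwise order and the opposite order \<open>le\<close> of the integrals,
    finite by \<open>fin_s\<close>, force the nonnegative difference to vanish almost everywhere.
    Strictness on the support then makes the support event null.\<close>
  have AE_le: "AE g in L. ennreal \<Delta> * ?u g \<le> ?s g" using ineq by eventually_elim blast
  have "(\<integral>\<^sup>+g. ?s g - ennreal \<Delta> * ?u g \<partial>L) = (\<integral>\<^sup>+g. ?s g \<partial>L) - (\<integral>\<^sup>+g. ennreal \<Delta> * ?u g \<partial>L)"
    using nn_integral_mono_AE[OF AE_le] fin_s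
    by (intro nn_integral_diff[OF s_meas u_meas _ AE_le]) auto
  also have "\<dots> = 0" using le by (rule diff_eq_0_ennreal[rotated]) (use nn_integral_mono_AE[OF AE_le] fin_s in auto)
  finally have "AE g in L. ?s g - ennreal \<Delta> * ?u g = 0"
    by (subst (asm) nn_integral_0_iff_AE) (use s_meas u_meas in auto)
  with ineq have no_supp: "AE g in L. \<not> in_supp (?E g) (?o g)"
  proof eventually_elim
    case (elim g)
    show ?case
    proof
      assume "in_supp (?E g) (?o g)"
      then have "ennreal \<Delta> * ?u g < ?s g" using elim(1) by blast
      from diff_gr0_ennreal[OF this] show False unfolding elim(2) by simp
    qed
  qed
  have "mean_spectral_measure L {t} \<le> (\<integral>\<^sup>+g. 0 \<partial>L)"
    unfolding mean_spectral_measure_def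
  proof (rule nn_integral_mono_AE)
    show "AE g in L. emeasure (spectral_measure (?V g) (?E g) (?o g)) {t} \<le> 0"
      using AE_good no_supp
    proof eventually_elim
      case (elim g)
      then obtain K where K: "network_eigenspace (?V g) (?E g) D t K M"
        "emeasure (spectral_measure (?V g) (?E g) (?o g)) {t} \<le> ennreal (coord (K (?o g)) (?o g))" using eig by blast
      interpret network_eigenspace "?V g" "?E g" D t K M by (rule K(1))
      have "coord (K (?o g)) (?o g) \<le> 0"
        using elim(2) ke_eq[OF rg_network(2) rg_network(2)] by (simp add: in_supp_def)
      then show ?case using K(2) by (simp add: ennreal_neg)
    qed
  qed
  then show False using t by simp
qed

end
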